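(* There is an algorithm that, given a $k_0$-integral splittable singleton congestion game with player-specific affine costs (all data rational, $n$ players, $m$ resources, every demand an integer multiple of $k_0$, all demands at most $\delta$), computes an equilibrium of this game using $O(n^2m^{14}\log(\delta/k_0))$ arithmetic operations.
   Context: An integral splittable singleton congestion game with packet size $k_0\in\mathbb{Q}_{>0}$ has players $N=\{1,\dots,n\}$, resources $E$ ($|E|=m$), demands $d_i\in\mathbb{Q}_{\ge0}$ that are integer multiples of $k_0$, and costs $c_{i,e}(t)=a_{i,e}t+b_{i,e}$ with $a_{i,e}\in\mathbb{Q}_{>0}$, $b_{i,e}\in\mathbb{Q}_{\ge0}$. A strategy of player $i$ is $x_i$ with $x_{i,e}\in k_0\mathbb{Z}_{\ge0}$ and $\sum_e x_{i,e}=d_i$; $x_e=\sum_i x_{i,e}$; the cost of $i$ is $\pi_i(x)=\sum_e c_{i,e}(x_e)x_{i,e}$; an equilibrium is a profile in which no player can lower her cost by switching to another of her strategies. *)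

theory Defs
  imports Complex_Main
begin

definition is_strategy ::
  "nat \<Rightarrow> rat \<Rightarrow> (nat \<Rightarrow> rat) \<Rightarrow> rat \<Rightarrow> (nat \<Rightarrow> rat) \<Rightarrow> bool" where
  "is_strategy m k0 d di xi \<longleftrightarrow>
     (\<forall>e<m. \<exists>z::nat. xi e = of_nat z * k0) \<and> (\<Sum>e<m. xi e) = di"

definition load :: "nat \<Rightarrow> (nat \<Rightarrow> nat \<Rightarrow> rat) \<Rightarrow> nat \<Rightarrow> rat" where
  "load n x e = (\<Sum>i<n. x i e)"

definition player_cost ::
  "nat \<Rightarrow> nat \<Rightarrow> (nat \<Rightarrow> nat \<Rightarrow> rat) \<Rightarrow> (nat \<Rightarrow> nat \<Rightarrow> rat)
     \<Rightarrow> (nat \<Rightarrow> nat \<Rightarrow> rat) \<Rightarrow> nat \<Rightarrow> rat" where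
  "player_cost n m a b x i = (\<Sum>e<m. (a i e * load n x e + b i e) * x i e)"

definition is_equilibrium ::
  "nat \<Rightarrow> nat \<Rightarrow> rat \<Rightarrow> (nat \<Rightarrow> rat) \<Rightarrow> (nat \<Rightarrow> nat \<Rightarrow> rat)
     \<Rightarrow> (nat \<Rightarrow> nat \<Rightarrow> rat) \<Rightarrow> (nat \<Rightarrow> nat \<Rightarrow> rat) \<Rightarrow> bool" where
  "is_equilibrium n m k0 d a b x \<longleftrightarrow>
     (\<forall>i<n. is_strategy m k0 d (d i) (x i)) \<and>
     (\<forall>i<n. \<forall>y. is_strategy m k0 d (d i) y \<longrightarrow>
        player_cost n m a b x i \<le> player_cost n m a b (x(i := y)) i)"

definition valid_game ::
  "nat \<Rightarrow> nat \<Rightarrow> rat \<Rightarrow> (nat \<Rightarrow> rat) \<Rightarrow> (nat \<Rightarrow> nat \<Rightarrow> rat)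
     \<Rightarrow> (nat \<Rightarrow> nat \<Rightarrow> rat) \<Rightarrow> bool" where
  "valid_game n m k0 d a b \<longleftrightarrow>
     k0 > 0 \<and>
     (\<forall>i<n. \<exists>z::nat. d i = of_nat z * k0) \<and>
     (\<forall>i<n. \<forall>e<m. a i e > 0 \<and> b i e \<ge> 0)"

datatype instr =
    Const nat rat
  | Add nat nat nat
  | Sub nat nat nat
  | Mul nat nat nat
  | Div nat nat nat        \<comment> \<open>division by zero yields 0\<close>
  | Load nat nat
  | Store nat nat
  | JmpLe nat nat nat
  | Jmp nat

type_synonym config = "nat \<times> (nat \<Rightarrow> rat) \<times> nat"

fun exec_instr :: "instr \<Rightarrow> config \<Rightarrow> config" where
  "exec_instr (Const i q) (pc, r, c) = (Suc pc, r(i := q), c)"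
| "exec_instr (Add i j k) (pc, r, c) = (Suc pc, r(i := r j + r k), Suc c)"
| "exec_instr (Sub i j k) (pc, r, c) = (Suc pc, r(i := r j - r k), Suc c)"
| "exec_instr (Mul i j k) (pc, r, c) = (Suc pc, r(i := r j * r k), Suc c)"
| "exec_instr (Div i j k) (pc, r, c) = (Suc pc, r(i := r j / r k), Suc c)"
| "exec_instr (Load i j) (pc, r, c) = (Suc pc, r(i := r (nat \<lfloor>r j\<rfloor>)), c)"
| "exec_instr (Store i j) (pc, r, c) = (Suc pc, r(nat \<lfloor>r j\<rfloor> := r i), c)"
| "exec_instr (JmpLe i j l) (pc, r, c) = ((if r i \<le> r j then l else Suc pc), r, Suc c)"
| "exec_instr (Jmp l) (pc, r, c) = (l, r, c)"

definition step :: "instr list \<Rightarrow> config \<Rightarrow> config" where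
  "step P cfg = (if fst cfg < length P then exec_instr (P ! fst cfg) cfg else cfg)"

definition halted :: "instr list \<Rightarrow> config \<Rightarrow> bool" where
  "halted P cfg \<longleftrightarrow> length P \<le> fst cfg"

definition input_mem ::
  "nat \<Rightarrow> nat \<Rightarrow> rat \<Rightarrow> (nat \<Rightarrow> rat) \<Rightarrow> (nat \<Rightarrow> nat \<Rightarrow> rat)
     \<Rightarrow> (nat \<Rightarrow> nat \<Rightarrow> rat) \<Rightarrow> nat \<Rightarrow> rat" where
  "input_mem n m k0 d a b p =
     (if p = 0 then of_nat n
      else if p = 1 then of_nat m
      else if p = 2 then k0
      else if p < 3 + n then d (p - 3)
      else if p < 3 + n + n * m then a ((p - (3 + n)) div m) ((p - (3 + n)) mod m)
      else if p < 3 + n + 2 * n * m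
        then b ((p - (3 + n + n * m)) div m) ((p - (3 + n + n * m)) mod m)
      else 0)"

definition output_profile :: "nat \<Rightarrow> (nat \<Rightarrow> rat) \<Rightarrow> nat \<Rightarrow> nat \<Rightarrow> rat" where
  "output_profile m r i e = r (3 + i * m + e)"

end

(*
  An ascending auction with packet-size scaling.  Fix a packet size k.  Every resource e carries a
  price p_e, and every player holds a best response to the prices: the key
  a_ie * (p_e + x_ie) + b_ie of a used resource never exceeds the key a further packet would get on
  any resource.  A price p_e below the load x_e is raised, in steps of k and one player at a time; this
  costs the player at most one packet, which she re-inserts greedily.  By gross substitutability
  p_e <= x_e persists, and as the loads have a fixed sum, the number of raises is at most
  n * sum_e (x_e - p_e) / k.  Once x_e - k <= p_ie <= x_e for all i and e, best responses to the prices
  form an equilibrium.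

  For coarse packet sizes it is enough to raise prices until x_e <= p_e + n * k, always for
  all players together.  Halving k turns best responses into near-best responses, which become best
  responses to the same prices once every player has greedily added m more packets.  A margin of
  about (m + 2) * k of each demand is therefore withheld and only released in the last phase.
  So every phase starts with sum_e (x_e - p_e) = O(n * m * k), and there are O(log(delta / k0)) phases.
*)
theory Submission
  imports Defs
begin

section \<open>Structured code for the machine and a total-correctness calculus that counts
  operations\<close>

section \<open>Structured programs\<close>

text \<open>Prices decouple the players: at fixed prices a key depends on its owner's strategy
  alone, so a raise shown to one player moves at most one packet and changes nobody else's keys.
  What is stored is the gap, load minus price, in which a moved packet merely shifts one unit
  between resources; during raises the sum of the gaps drops only when a raise has been shown to all
  \<open>n\<close> players. Coarse phases must end with one price per resource common to all
  players, because packet counts are doubled next. So a round of raises must not stop halfway. It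
  starts only at a gap above \<open>n\<close> packets, and as each of its \<open>n\<close> raises
  removes at most one packet, there is always enough gap left to finish it. The final phase may stop
  halfway, since its bounds on \<open>p_ie\<close> are per player. The margin \<open>c * k\<close>
  comes from a fixed point: the last packet placed may leave barely more than
  \<open>(c - 1) * k\<close>, and after halving at least \<open>m\<close> packets must fit above the
  new margin, that is \<open>2 * (c - 1) >= c + m\<close>; the least solution is
  \<open>c = m + 2\<close>.\<close>

type_synonym mem = "nat \<Rightarrow> rat"

datatype com =
    Blk "instr list"
  | Seq com com (infixr ";;" 60)
  | IfLt nat nat com com
  | WhileLt nat nat com

fun clen :: "com \<Rightarrow> nat" where
  "clen (Blk is) = length is"
| "clen (c1 ;; c2) = clen c1 + clen c2"
| "clen (IfLt i j c1 c2) = clen c1 + clen c2 + 2"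
| "clen (WhileLt i j c) = clen c + 2"

text \<open>Jump targets are absolute, hence the offset argument. Tests are compiled negated:
  \<open>JmpLe j i\<close> leaves exactly when \<open>r i < r j\<close> fails. The closing
  \<open>Jmp\<close> is free, so every test costs one operation.\<close>

fun compile :: "nat \<Rightarrow> com \<Rightarrow> instr list" where
  "compile off (Blk is) = is"
| "compile off (c1 ;; c2) = compile off c1 @ compile (off + clen c1) c2"
| "compile off (IfLt i j c1 c2) =
     JmpLe j i (off + clen c1 + 2) # compile (off + 1) c1
     @ Jmp (off + clen c1 + clen c2 + 2) # compile (off + clen c1 + 2) c2"
| "compile off (WhileLt i j c) =
     JmpLe j i (off + clen c + 2) # compile (off + 1) c @ [Jmp off]"

lemma length_compile [simp]: "length (compile off c) = clen c"
  by (induction c arbitrary: off) auto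

definition embed :: "instr list \<Rightarrow> nat \<Rightarrow> instr list \<Rightarrow> bool" where
  "embed P off code \<longleftrightarrow> (\<exists>pre post. P = pre @ code @ post \<and> length pre = off)"

lemma embed_append:
  "embed P off (c1 @ c2) \<Longrightarrow> embed P off c1 \<and> embed P (off + length c1) c2"
  unfolding embed_def
  by (metis append.assoc length_append)

lemma embed_Cons:
  assumes "embed P off (ins # code)"
  shows "off < length P" "P ! off = ins" "embed P (Suc off) code"
proof -
  from assms obtain pre post where P: "P = pre @ ins # code @ post" "length pre = off"
    by (auto simp: embed_def)
  then show "off < length P" "P ! off = ins" by (auto simp: nth_append)
  have "P = (pre @ [ins]) @ code @ post" "length (pre @ [ins]) = Suc off" using P by auto
  then show "embed P (Suc off) code" unfolding embed_def by blast
qed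

text \<open>The number of machine steps stays open: constants, loads, stores and \<open>Jmp\<close>
  are steps but not arithmetic operations. Operations are read off the counter inside the
  configuration.\<close>

definition reach :: "instr list \<Rightarrow> config \<Rightarrow> config \<Rightarrow> bool" where
  "reach P c c' \<longleftrightarrow> (\<exists>j. (step P ^^ j) c = c')"

lemma reach_refl: "reach P c c"
  unfolding reach_def by (rule exI[of _ 0]) simp

lemma reach_trans: "reach P c c' \<Longrightarrow> reach P c' c'' \<Longrightarrow> reach P c c''"
  unfolding reach_def by (metis comp_apply funpow_add)

lemma reach_step:
  assumes "off < length P" "exec_instr (P ! off) (off, r, t) = c"
  shows "reach P (off, r, t) c"
  unfolding reach_def using assms by (intro exI[of _ 1]) (simp add: step_def)

fun straight :: "instr \<Rightarrow> bool" where
  "straight (JmpLe _ _ _) = False"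
| "straight (Jmp _) = False"
| "straight _ = True"

fun effect :: "instr \<Rightarrow> mem \<Rightarrow> mem" where
  "effect (Const i q) r = r(i := q)"
| "effect (Add i j k) r = r(i := r j + r k)"
| "effect (Sub i j k) r = r(i := r j - r k)"
| "effect (Mul i j k) r = r(i := r j * r k)"
| "effect (Div i j k) r = r(i := r j / r k)"
| "effect (Load i j) r = r(i := r (nat \<lfloor>r j\<rfloor>))"
| "effect (Store i j) r = r(nat \<lfloor>r j\<rfloor> := r i)"
| "effect _ r = r"

fun cost :: "instr \<Rightarrow> nat" where
  "cost (Add i j k) = 1"
| "cost (Sub i j k) = 1"
| "cost (Mul i j k) = 1"
| "cost (Div i j k) = 1"
| "cost _ = 0"

fun effects :: "instr list \<Rightarrow> mem \<Rightarrow> mem" where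
  "effects [] r = r"
| "effects (i # is) r = effects is (effect i r)"

lemma effects_append [simp]: "effects (xs @ ys) r = effects ys (effects xs r)"
  by (induction xs arbitrary: r) auto

definition costs :: "instr list \<Rightarrow> nat" where "costs is = sum_list (map cost is)"

lemma costs_simps [simp]: "costs [] = 0" "costs (i # is) = cost i + costs is"
  "costs (xs @ ys) = costs xs + costs ys"
  by (simp_all add: costs_def)

lemma exec_straight:
  "straight ins \<Longrightarrow> exec_instr ins (pc, r, t) = (Suc pc, effect ins r, t + cost ins)"
  by (cases ins) auto

text \<open>Total correctness: a final memory \<open>r'\<close> and an operation count
  \<open>u\<close> are exhibited, and they do not depend on the surrounding program, the position of
  the code or the initial counter. This uniformity is what lets code fragments be composed.\<close>

definition wp :: "com \<Rightarrow> mem \<Rightarrow> (mem \<Rightarrow> nat \<Rightarrow> bool) \<Rightarrow> bool" where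
  "wp c r Q \<longleftrightarrow> (\<exists>r' u. Q r' u \<and>
     (\<forall>P off t. embed P off (compile off c) \<longrightarrow> reach P (off, r, t) (off + clen c, r', t + u)))"

lemma wp_mono: "wp c r Q \<Longrightarrow> (\<And>r' u. Q r' u \<Longrightarrow> Q' r' u) \<Longrightarrow> wp c r Q'"
  unfolding wp_def by blast

lemma reach_straight:
  assumes "\<forall>ins\<in>set is. straight ins" "embed P off is"
  shows "reach P (off, r, t) (off + length is, effects is r, t + costs is)"
  using assms
proof (induction "is" arbitrary: off r t)
  case Nil
  then show ?case by (simp add: reach_refl)
next
  case (Cons ins "is")
  from embed_Cons[OF Cons.prems(2)]
  have 1: "off < length P" "P ! off = ins" "embed P (Suc off) is" by auto
  have "reach P (off, r, t) (Suc off, effect ins r, t + cost ins)"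
    using 1 Cons.prems(1) by (intro reach_step) (auto simp: exec_straight)
  moreover have "reach P (Suc off, effect ins r, t + cost ins)
     (Suc off + length is, effects is (effect ins r), t + cost ins + costs is)"
    using Cons.IH[OF _ 1(3)] Cons.prems(1) by simp
  ultimately show ?case using reach_trans by (fastforce simp: add.assoc)
qed

lemma wp_Blk:
  assumes "\<forall>ins\<in>set is. straight ins" "Q (effects is r) (costs is)"
  shows "wp (Blk is) r Q"
  unfolding wp_def using assms reach_straight by fastforce

lemma wp_Seq:
  assumes "wp c1 r (\<lambda>r1 u1. wp c2 r1 (\<lambda>r2 u2. Q r2 (u1 + u2)))"
  shows "wp (c1 ;; c2) r Q"
proof -
  from assms obtain r1 u1 r2 u2 where Q: "Q r2 (u1 + u2)"
    and 1: "\<And>P off t. embed P off (compile off c1) \<Longrightarrow> reach P (off, r, t) (off + clen c1, r1, t + u1)"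
    and 2: "\<And>P off t. embed P off (compile off c2) \<Longrightarrow> reach P (off, r1, t) (off + clen c2, r2, t + u2)"
    unfolding wp_def by blast
  have "reach P (off, r, t) (off + clen (c1 ;; c2), r2, t + (u1 + u2))"
    if "embed P off (compile off (c1 ;; c2))" for P off t
  proof -
    from embed_append[of P off "compile off c1"] that
    have e: "embed P off (compile off c1)" "embed P (off + clen c1) (compile (off + clen c1) c2)" by auto
    show ?thesis using reach_trans[OF 1[OF e(1)] 2[OF e(2)]] by (simp add: add.assoc)
  qed
  with Q show ?thesis unfolding wp_def by blast
qed

lemma wp_IfLt:
  assumes "r i < r j \<Longrightarrow> wp c1 r (\<lambda>r' u. Q r' (Suc u))"
    and "\<not> r i < r j \<Longrightarrow> wp c2 r (\<lambda>r' u. Q r' (Suc u))"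
  shows "wp (IfLt i j c1 c2) r Q"
proof (cases "r i < r j")
  case True
  with assms(1) obtain r' u where Q: "Q r' (Suc u)"
    and 1: "\<And>P off t. embed P off (compile off c1) \<Longrightarrow> reach P (off, r, t) (off + clen c1, r', t + u)"
    unfolding wp_def by blast
  have "reach P (off, r, t) (off + clen (IfLt i j c1 c2), r', t + Suc u)"
    if "embed P off (compile off (IfLt i j c1 c2))" for P off t
  proof -
    from embed_Cons[OF that[unfolded compile.simps]]
    have a: "off < length P" "P ! off = JmpLe j i (off + clen c1 + 2)"
      and b: "embed P (Suc off) (compile (off + 1) c1 @ Jmp (off + clen c1 + clen c2 + 2) # compile (off + clen c1 + 2) c2)"
      by auto
    from embed_append[OF b] have c: "embed P (Suc off) (compile (Suc off) c1)"
      and d: "embed P (Suc off + clen c1) (Jmp (off + clen c1 + clen c2 + 2) # compile (off + clen c1 + 2) c2)" by auto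
    have s1: "reach P (off, r, t) (Suc off, r, Suc t)"
      using a True by (intro reach_step) auto
    have s2: "reach P (Suc off, r, Suc t) (Suc off + clen c1, r', Suc t + u)" by (rule 1[OF c])
    have s3: "reach P (Suc off + clen c1, r', Suc t + u) (off + clen c1 + clen c2 + 2, r', Suc t + u)"
      using embed_Cons[OF d] by (intro reach_step) auto
    show ?thesis using reach_trans[OF s1 reach_trans[OF s2 s3]] by (simp add: add.assoc)
  qed
  with Q show ?thesis unfolding wp_def by blast
next
  case False
  with assms(2) obtain r' u where Q: "Q r' (Suc u)"
    and 1: "\<And>P off t. embed P off (compile off c2) \<Longrightarrow> reach P (off, r, t) (off + clen c2, r', t + u)"
    unfolding wp_def by blast
  have "reach P (off, r, t) (off + clen (IfLt i j c1 c2), r', t + Suc u)"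
    if "embed P off (compile off (IfLt i j c1 c2))" for P off t
  proof -
    from embed_Cons[OF that[unfolded compile.simps]]
    have a: "off < length P" "P ! off = JmpLe j i (off + clen c1 + 2)"
      and b: "embed P (Suc off) (compile (off + 1) c1 @ Jmp (off + clen c1 + clen c2 + 2) # compile (off + clen c1 + 2) c2)"
      by auto
    from embed_append[OF b] have
      d: "embed P (Suc off + clen c1) (Jmp (off + clen c1 + clen c2 + 2) # compile (off + clen c1 + 2) c2)" by auto
    have e: "embed P (off + clen c1 + 2) (compile (off + clen c1 + 2) c2)"
      using embed_Cons(3)[OF d] by simp
    have s1: "reach P (off, r, t) (off + clen c1 + 2, r, Suc t)"
      using a False by (intro reach_step) auto
    show ?thesis using reach_trans[OF s1 1[OF e]] by (simp add: ac_simps)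
  qed
  with Q show ?thesis unfolding wp_def by blast
qed

lemma wp_While_unfold:
  assumes "r i < r j \<Longrightarrow> wp c r (\<lambda>r' u. wp (WhileLt i j c) r' (\<lambda>r'' u'. Q r'' (Suc (u + u'))))"
    and "\<not> r i < r j \<Longrightarrow> Q r 1"
  shows "wp (WhileLt i j c) r Q"
proof (cases "r i < r j")
  case True
  with assms(1) obtain r1 u1 r2 u2 where Q: "Q r2 (Suc (u1 + u2))"
    and 1: "\<And>P off t. embed P off (compile off c) \<Longrightarrow> reach P (off, r, t) (off + clen c, r1, t + u1)"
    and 2: "\<And>P off t. embed P off (compile off (WhileLt i j c)) \<Longrightarrow>
       reach P (off, r1, t) (off + clen (WhileLt i j c), r2, t + u2)"
    unfolding wp_def by blast
  have "reach P (off, r, t) (off + clen (WhileLt i j c), r2, t + Suc (u1 + u2))"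
    if em: "embed P off (compile off (WhileLt i j c))" for P off t
  proof -
    from embed_Cons[OF that[unfolded compile.simps]]
    have a: "off < length P" "P ! off = JmpLe j i (off + clen c + 2)"
      and b: "embed P (Suc off) (compile (off + 1) c @ [Jmp off])" by auto
    from embed_append[OF b] have c: "embed P (Suc off) (compile (Suc off) c)"
      and d: "embed P (Suc off + clen c) [Jmp off]" by auto
    have s1: "reach P (off, r, t) (Suc off, r, Suc t)"
      using a True by (intro reach_step) auto
    have s2: "reach P (Suc off, r, Suc t) (Suc off + clen c, r1, Suc t + u1)" by (rule 1[OF c])
    have s3: "reach P (Suc off + clen c, r1, Suc t + u1) (off, r1, Suc t + u1)"
      using embed_Cons[OF d] by (intro reach_step) auto
    show ?thesis
      using reach_trans[OF s1 reach_trans[OF s2 reach_trans[OF s3 2[OF em]]]]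
      by (simp add: add.assoc)
  qed
  with Q show ?thesis unfolding wp_def by blast
next
  case False
  have "reach P (off, r, t) (off + clen (WhileLt i j c), r, t + 1)"
    if em: "embed P off (compile off (WhileLt i j c))" for P off t
    using embed_Cons[OF em[unfolded compile.simps]] False by (intro reach_step) auto
  with assms(2)[OF False] show ?thesis unfolding wp_def by blast
qed

text \<open>\<open>g\<close> is a ghost state and \<open>\<phi> g\<close> a budget of operations.
  Each iteration pays for its test and its body out of the budget, which therefore strictly drops; a
  single inequality thus gives both termination and the cost bound. The \<open>Suc\<close> in
  \<open>post\<close> pays for the last, failing test.\<close>

lemma wp_While:
  fixes I :: "'g \<Rightarrow> mem \<Rightarrow> bool" and \<phi> :: "'g \<Rightarrow> nat"
  assumes "I g r"
    and body: "\<And>g r. I g r \<Longrightarrow> r i < r j \<Longrightarrow>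
       wp c r (\<lambda>r' u. \<exists>g'. I g' r' \<and> Suc u + \<phi> g' \<le> \<phi> g)"
    and post: "\<And>g' r' u. I g' r' \<Longrightarrow> \<not> r' i < r' j \<Longrightarrow> u + \<phi> g' \<le> Suc (\<phi> g) \<Longrightarrow> Q r' u"
  shows "wp (WhileLt i j c) r Q"
  using assms(1) post
proof (induction "\<phi> g" arbitrary: g r Q rule: less_induct)
  case less
  show ?case
  proof (rule wp_While_unfold)
    assume "r i < r j"
    from body[OF less.prems(1) this]
    show "wp c r (\<lambda>r' u. wp (WhileLt i j c) r' (\<lambda>r'' u'. Q r'' (Suc (u + u'))))"
    proof (rule wp_mono)
      fix r' u
      assume "\<exists>g'. I g' r' \<and> Suc u + \<phi> g' \<le> \<phi> g"
      then obtain g' where g': "I g' r'" "Suc u + \<phi> g' \<le> \<phi> g" by auto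
      show "wp (WhileLt i j c) r' (\<lambda>r'' u'. Q r'' (Suc (u + u')))"
        using g' by (intro less.hyps[of g']) (auto intro!: less.prems(2))
    qed
  next
    assume "\<not> r i < r j"
    then show "Q r 1" using less.prems by simp
  qed
qed

lemma wp_program:
  assumes "wp c r Q"
  shows "\<exists>t r' u. (step (compile 0 c) ^^ t) (0, r, 0) = (length (compile 0 c), r', u) \<and> Q r' u"
proof -
  from assms obtain r' u where Q: "Q r' u"
    and 1: "\<And>P off t. embed P off (compile off c) \<Longrightarrow> reach P (off, r, t) (off + clen c, r', t + u)"
    unfolding wp_def by blast
  have "embed (compile 0 c) 0 (compile 0 c)" unfolding embed_def by simp
  from 1[OF this, of 0] Q show ?thesis unfolding reach_def by auto
qed

section \<open>Marginal costs, best responses at fixed prices, and their repair after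
  halving\<close>

section \<open>Equilibria and best responses to prices\<close>

text \<open>With \<open>o'\<close> the load of the others, the cost on one resource is a convex
  quadratic in the own amount. \<open>up\<close> and \<open>dn\<close> place \<open>l\<close>
  between the marginal costs per unit of adding and of removing a packet at \<open>z\<close>, so the
  line of slope \<open>l\<close> through \<open>z\<close> supports the cost on the whole
  grid.\<close>

lemma quadratic_cost_diff_ge:
  fixes A o' B k :: rat
  assumes "A > 0" "k > 0"
    and up: "l \<le> A * (o' + 2 * of_nat z * k + k) + B"
    and dn: "0 < z \<Longrightarrow> A * (o' + 2 * of_nat z * k - k) + B \<le> l"
  shows "(A * (o' + of_nat w * k) + B) * (of_nat w * k) - (A * (o' + of_nat z * k) + B) * (of_nat z * k)
     \<ge> l * (of_nat w * k - of_nat z * k)"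
proof -
  let ?w = "of_nat w * k" and ?z = "of_nat z * k"
  \<comment> \<open>The chord slope depends only on the sum of the two amounts, so comparing
    \<open>w\<close> with the grid neighbour of \<open>z\<close> suffices.\<close>
  have eq: "(A * (o' + ?w) + B) * ?w - (A * (o' + ?z) + B) * ?z
     = (A * (o' + ?w + ?z) + B) * (?w - ?z)" by algebra
  show ?thesis
  proof (cases w z rule: linorder_cases)
    case less
    then obtain q where q: "z = Suc (w + q)" using less_iff_Suc_add by auto
    then have "?w \<le> ?z - k" using \<open>k > 0\<close> by (simp add: algebra_simps)
    then have "A * (o' + ?w + ?z) + B \<le> A * (o' + 2 * of_nat z * k - k) + B"
      using \<open>A > 0\<close> by (intro add_right_mono mult_left_mono) (auto simp: algebra_simps)
    also have "\<dots> \<le> l" using dn less by simp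
    finally have "A * (o' + ?w + ?z) + B \<le> l" .
    moreover have "?w - ?z \<le> 0" using less \<open>k > 0\<close> by simp
    ultimately show ?thesis unfolding eq by (rule mult_right_mono_neg)
  next
    case equal
    then show ?thesis by simp
  next
    case greater
    then obtain q where q: "w = Suc (z + q)" using less_iff_Suc_add by auto
    then have "?w \<ge> ?z + k" using \<open>k > 0\<close> by (simp add: algebra_simps)
    then have "A * (o' + ?w + ?z) + B \<ge> A * (o' + 2 * of_nat z * k + k) + B"
      using \<open>A > 0\<close> by (intro add_right_mono mult_left_mono) (auto simp: algebra_simps)
    then have "A * (o' + ?w + ?z) + B \<ge> l" using up by linarith
    moreover have "?w - ?z \<ge> 0" using greater \<open>k > 0\<close> by simp
    ultimately show ?thesis unfolding eq by (rule mult_right_mono)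
  qed
qed

text \<open>One slope, the cheapest marginal cost of adding a packet, supports the costs on all
  resources at once. Both strategies sum to \<open>d i\<close>, so the linear lower bounds cancel.
  The term \<open>load n x e + x i e\<close> is the load of the others plus twice the own amount, as
  in a marginal cost.\<close>

lemma equilibriumI:
  assumes "k > 0" "m \<ge> 1"
    and pos: "\<And>i e. i < n \<Longrightarrow> e < m \<Longrightarrow> a i e > 0"
    and xz: "\<And>i e. i < n \<Longrightarrow> e < m \<Longrightarrow> x i e = of_nat (X i e) * k"
    and demand_left: "\<And>i. i < n \<Longrightarrow> (\<Sum>e<m. x i e) = d i"
    and exch: "\<And>i e f. i < n \<Longrightarrow> e < m \<Longrightarrow> f < m \<Longrightarrow> 0 < X i e \<Longrightarrow>
       a i e * (load n x e + x i e - k) + b i e \<le> a i f * (load n x f + x i f + k) + b i f"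
  shows "is_equilibrium n m k d a b x"
  unfolding is_equilibrium_def
proof (intro conjI allI impI)
  fix i assume i: "i < n"
  show "is_strategy m k d (d i) (x i)" unfolding is_strategy_def using xz demand_left i by blast
next
  fix i y assume i: "i < n" and y: "is_strategy m k d (d i) y"
  obtain w where w: "\<And>e. e < m \<Longrightarrow> y e = of_nat (w e) * k" and sy: "(\<Sum>e<m. y e) = d i"
    using y unfolding is_strategy_def by metis
  define up where "up f = a i f * (load n x f + x i f + k) + b i f" for f
  define l where "l = Min (up ` {..<m})"
  have l_le: "l \<le> up f" if "f < m" for f unfolding l_def using that by auto
  have "l \<in> up ` {..<m}" unfolding l_def using \<open>m \<ge> 1\<close> by (intro Min_in) (auto simp: lessThan_empty_iff)
  then obtain f0 where f0: "f0 < m" "l = up f0" by auto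
  define o' where "o' e = load n x e - x i e" for e
  have ld: "load n (x(i := y)) e = o' e + y e" for e
    unfolding load_def o'_def using i by (simp add: sum.remove[of "{..<n}" i])
  have key: "(a i e * (o' e + y e) + b i e) * y e - (a i e * (o' e + x i e) + b i e) * x i e
      \<ge> l * (y e - x i e)" if e: "e < m" for e
    unfolding w[OF e] xz[OF i e]
  proof (rule quadratic_cost_diff_ge)
    show "a i e > 0" "k > 0" using pos i e \<open>k > 0\<close> by auto
    show "l \<le> a i e * (o' e + 2 * of_nat (X i e) * k + k) + b i e"
      using l_le[OF e] xz[OF i e] unfolding up_def o'_def by (simp add: algebra_simps)
    assume "0 < X i e"
    then show "a i e * (o' e + 2 * of_nat (X i e) * k - k) + b i e \<le> l"
      using exch[OF i e f0(1)] xz[OF i e] unfolding f0(2) up_def o'_def by (simp add: algebra_simps)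
  qed
  have "player_cost n m a b (x(i := y)) i - player_cost n m a b x i
     = (\<Sum>e<m. (a i e * (o' e + y e) + b i e) * y e - (a i e * (o' e + x i e) + b i e) * x i e)"
    unfolding player_cost_def sum_subtractf[symmetric] ld by (simp add: o'_def)
  also have "\<dots> \<ge> (\<Sum>e<m. l * (y e - x i e))" by (rule sum_mono) (use key in auto)
  also have "(\<Sum>e<m. l * (y e - x i e)) = l * ((\<Sum>e<m. y e) - (\<Sum>e<m. x i e))"
    by (simp add: sum_distrib_left[symmetric] sum_subtractf)
  also have "\<dots> = 0" using sy demand_left[OF i] by simp
  finally show "player_cost n m a b x i \<le> player_cost n m a b (x(i := y)) i" by linarith
qed

text \<open>Only the exchange condition is demanded, not a total amount: the notion also serves
  players whose demand is placed only in part.\<close>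

definition best_response :: "nat \<Rightarrow> (nat \<Rightarrow> rat) \<Rightarrow> (nat \<Rightarrow> nat) \<Rightarrow> (nat \<Rightarrow> rat) \<Rightarrow> bool" where
  "best_response m ak Xi Ki \<longleftrightarrow> (\<forall>e<m. \<forall>f<m. 0 < Xi e \<longrightarrow> Ki e \<le> Ki f + ak f)"

definition greedy_choice :: "nat \<Rightarrow> (nat \<Rightarrow> rat) \<Rightarrow> (nat \<Rightarrow> rat) \<Rightarrow> nat \<Rightarrow> bool" where
  "greedy_choice m ak Ki f \<longleftrightarrow> f < m \<and> (\<forall>f'<m. Ki f + ak f \<le> Ki f' + ak f')"

text \<open>The new key of \<open>f\<close> is the smallest next key, the other used keys were below
  all next keys before, and next keys only grow.\<close>

lemma best_response_add:
  assumes "best_response m ak Xi Ki" "greedy_choice m ak Ki f" "\<And>e. e < m \<Longrightarrow> 0 < ak e"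
  shows "best_response m ak (Xi(f := Suc (Xi f))) (Ki(f := Ki f + ak f))"
  unfolding best_response_def
proof (intro allI impI)
  fix e g assume e: "e < m" and g: "g < m" and s: "0 < (Xi(f := Suc (Xi f))) e"
  let ?K = "Ki(f := Ki f + ak f)"
  have f: "f < m" "Ki f + ak f \<le> Ki g + ak g" and pos: "0 < ak f"
    using assms g unfolding greedy_choice_def by auto
  have g': "Ki g + ak g \<le> ?K g + ak g" using pos by simp
  have "?K e \<le> Ki g + ak g"
  proof (cases "e = f")
    case True
    then show ?thesis using f by simp
  next
    case False
    then show ?thesis using s assms(1) e g unfolding best_response_def by simp
  qed
  then show "?K e \<le> ?K g + ak g" using g' by linarith
qed

text \<open>Halving the packet size leaves every used key within two (new) steps of every other key. Below,
  \<open>l\<close> is the largest key at that moment and \<open>j\<close> counts the greedy additions made since; while some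
  next key is below \<open>l\<close>, each addition lifts one resource above it for good.\<close>

definition near_response :: "nat \<Rightarrow> (nat \<Rightarrow> rat) \<Rightarrow> (nat \<Rightarrow> nat) \<Rightarrow> (nat \<Rightarrow> rat) \<Rightarrow> nat \<Rightarrow> bool" where
  "near_response m ak Xi Ki j \<longleftrightarrow> best_response m ak Xi Ki \<or>
     (\<exists>l. (\<forall>e<m. 0 < Xi e \<longrightarrow> Ki e \<le> l) \<and> (\<forall>f<m. l \<le> Ki f + 2 * ak f)
        \<and> card {f. f < m \<and> Ki f + ak f < l} + j \<le> m)"

text \<open>At \<open>j = m\<close> no resource is left whose next key is below \<open>l\<close>, so
  \<open>l\<close> separates the used keys from all next keys.\<close>

lemma near_response_exact: "near_response m ak Xi Ki m \<Longrightarrow> best_response m ak Xi Ki"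
  unfolding near_response_def best_response_def by (auto; meson leI order_trans)

lemma near_response_add:
  assumes n: "near_response m ak Xi Ki j" and am: "greedy_choice m ak Ki f" and pos: "\<And>e. e < m \<Longrightarrow> 0 < ak e"
  shows "near_response m ak (Xi(f := Suc (Xi f))) (Ki(f := Ki f + ak f)) (Suc j)"
proof (cases "best_response m ak Xi Ki")
  case True
  then show ?thesis using best_response_add[OF True am] pos unfolding near_response_def by blast
next
  case False
  then obtain l where l1: "\<And>e. e < m \<Longrightarrow> 0 < Xi e \<Longrightarrow> Ki e \<le> l"
    and l2: "\<And>f. f < m \<Longrightarrow> l \<le> Ki f + 2 * ak f"
    and l3: "card {f. f < m \<and> Ki f + ak f < l} + j \<le> m"
    using n unfolding near_response_def by blast
  have f: "f < m" "\<And>f'. f' < m \<Longrightarrow> Ki f + ak f \<le> Ki f' + ak f'"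
    using am unfolding greedy_choice_def by auto
  \<comment> \<open>If even the smallest next key reached \<open>l\<close>, then \<open>l\<close>
    would already separate used keys from next keys.\<close>
  have less: "Ki f + ak f < l"
  proof (rule ccontr)
    assume "\<not> ?thesis"
    then have "best_response m ak Xi Ki" unfolding best_response_def using l1 f
      by (meson leI order_trans)
    with False show False by simp
  qed
  let ?K = "Ki(f := Ki f + ak f)"
  \<comment> \<open>The next key of \<open>f\<close> is now two steps above its old key, hence at
    least \<open>l\<close>; no other key moves.\<close>
  have "{f'. f' < m \<and> ?K f' + ak f' < l} \<subseteq> {f. f < m \<and> Ki f + ak f < l} - {f}"
    using l2[OF f(1)] by auto
  then have "card {f'. f' < m \<and> ?K f' + ak f' < l} \<le> card ({f. f < m \<and> Ki f + ak f < l} - {f})"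
    by (intro card_mono) auto
  also have "\<dots> < card {f. f < m \<and> Ki f + ak f < l}"
    using less f(1) by (intro psubset_card_mono) auto
  finally have "card {f'. f' < m \<and> ?K f' + ak f' < l} + Suc j \<le> m" using l3 by simp
  moreover have "l \<le> ?K f' + 2 * ak f'" if "f' < m" for f'
    using l2[OF that] pos[OF that] by auto
  moreover have "?K e \<le> l" if "e < m" "0 < (Xi(f := Suc (Xi f))) e" for e
    using that l1 less by (auto split: if_splits)
  ultimately show ?thesis unfolding near_response_def by blast
qed

lemma near_response_halve:
  assumes r: "best_response m (\<lambda>e. 2 * ak e) Xi Ki" and m: "m \<ge> 1"
  shows "near_response m ak (\<lambda>e. 2 * Xi e) Ki 0"
proof (cases "\<exists>e<m. 0 < Xi e")
  case False
  then show ?thesis unfolding near_response_def best_response_def by auto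
next
  case True
  define l where "l = Max (Ki ` {e. e < m \<and> 0 < Xi e})"
  have "l \<in> Ki ` {e. e < m \<and> 0 < Xi e}" unfolding l_def using True by (intro Max_in) auto
  then have "\<forall>f<m. l \<le> Ki f + 2 * ak f" using r unfolding best_response_def by auto
  moreover have "\<forall>e<m. 0 < 2 * Xi e \<longrightarrow> Ki e \<le> l" unfolding l_def by auto
  moreover have "card {f. f < m \<and> Ki f + ak f < l} \<le> card {..<m}"
    by (intro card_mono) auto
  ultimately show ?thesis unfolding near_response_def by force
qed

lemma near_response_ge: "near_response m ak Xi Ki j \<Longrightarrow> m \<le> j \<Longrightarrow> best_response m ak Xi Ki"
proof (rule ccontr)
  assume n: "near_response m ak Xi Ki j" "m \<le> j" and r: "\<not> best_response m ak Xi Ki"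
  then obtain l where l: "\<forall>e<m. 0 < Xi e \<longrightarrow> Ki e \<le> l" "\<forall>f<m. l \<le> Ki f + 2 * ak f"
      "card {f. f < m \<and> Ki f + ak f < l} + j \<le> m"
    unfolding near_response_def by blast
  then have "card {f. f < m \<and> Ki f + ak f < l} + m \<le> m" using n(2) by linarith
  with l have "near_response m ak Xi Ki m" unfolding near_response_def by blast
  with near_response_exact r show False by blast
qed

text \<open>Profiles are total functions, whereas memory fixes only the entries with
  \<open>i < n\<close> and \<open>e < m\<close>.\<close>

lemma is_equilibrium_cong:
  assumes "\<And>i e. i < n \<Longrightarrow> e < m \<Longrightarrow> x i e = y i e" and eq: "is_equilibrium n m k d a b x"
  shows "is_equilibrium n m k d a b y"
proof -
  have st: "is_strategy m k d D (x i) = is_strategy m k d D (y i)" if "i < n" for i D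
    using assms(1)[OF that] unfolding is_strategy_def by simp
  have pc: "player_cost n m a b (x(i := z)) i = player_cost n m a b (y(i := z)) i" for i z
  proof -
    have "load n (x(i := z)) e = load n (y(i := z)) e" if "e < m" for e
      using assms(1)[OF _ that] unfolding load_def by (intro sum.cong) auto
    then show ?thesis unfolding player_cost_def by simp
  qed
  have pc0: "player_cost n m a b x i = player_cost n m a b y i" if "i < n" for i
  proof -
    have "load n x e = load n y e" if "e < m" for e
      using assms(1)[OF _ that] unfolding load_def by (intro sum.cong) auto
    then show ?thesis using assms(1)[OF that] unfolding player_cost_def by simp
  qed
  show ?thesis using eq unfolding is_equilibrium_def using st pc pc0 by simp
qed

lemma nat_floor_eq: "v = of_nat x \<Longrightarrow> nat \<lfloor>v :: rat\<rfloor> = x"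
  by simp

section \<open>The auction as machine code\<close>

section \<open>The program\<close>

text \<open>Unrolled, with literal source cells: while the input occupies the low cells, only cell 0
  (the moving target address) and cell 2 (the constant 1) are available, too few for a copying
  loop.\<close>

primrec save_cells :: "nat \<Rightarrow> instr list" where
  "save_cells 0 = []"
| "save_cells (Suc t) = save_cells t @ [Add 0 0 2, Store (3 + t) 0]"

primrec load_cells :: "nat \<Rightarrow> instr list" where
  "load_cells 0 = []"
| "load_cells (Suc t) = load_cells t @ [Load (3 + t) 0, Add 0 0 1]"

lemma straight_cells: "\<forall>ins\<in>set (save_cells t). straight ins" "\<forall>ins\<in>set (load_cells t). straight ins"
  by (induction t) auto

lemma costs_cells: "costs (save_cells t) = t" "costs (load_cells t) = t"
  by (induction t) auto

text \<open>The address advances before each store, so cell 3 goes to \<open>W + 1\<close> and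
  address \<open>W\<close> stays reserved for \<open>k0\<close>. The bound
  \<open>3 + t \<le> W\<close> keeps the targets clear of unread sources.\<close>

lemma effects_save_cells:
  assumes "r 0 = of_nat W" "r 2 = 1" "3 + t \<le> W"
  shows "effects (save_cells t) r =
    (\<lambda>p. if p = 0 then of_nat (W + t) else if W < p \<and> p \<le> W + t then r (p - W + 2) else r p)"
  using assms(3)
proof (induction t)
  case 0
  then show ?case using assms by auto
next
  case (Suc t)
  let ?r = "\<lambda>p. if p = 0 then of_nat (W + t) else if W < p \<and> p \<le> W + t then r (p - W + 2) else r p"
  have "effects (save_cells (Suc t)) r = effects [Add 0 0 2, Store (3 + t) 0] ?r"
    using Suc by simp
  also have "\<dots> = ?r(0 := of_nat (W + Suc t), W + Suc t := r (3 + t))"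
  proof -
    have "(of_nat (W + t) + 1 :: rat) = of_nat (W + Suc t)" by simp
    moreover have "?r 2 = 1" "?r (3 + t) = r (3 + t)" using Suc.prems assms(2) by auto
    ultimately show ?thesis
      unfolding effects.simps effect.simps by (auto simp: fun_eq_iff nat_floor_eq simp del: of_nat_add of_nat_Suc)
  qed
  also have "\<dots> = (\<lambda>p. if p = 0 then of_nat (W + Suc t) else if W < p \<and> p \<le> W + Suc t then r (p - W + 2) else r p)"
    by (rule ext) (auto simp: le_Suc_eq numeral_eq_Suc)
  finally show ?case .
qed

lemma effects_load_cells:
  assumes "r 0 = of_nat Y" "r 1 = 1" "3 + t \<le> Y"
  shows "effects (load_cells t) r =
    (\<lambda>p. if p = 0 then of_nat (Y + t) else if 3 \<le> p \<and> p < 3 + t then r (Y + (p - 3)) else r p)"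
  using assms(3)
proof (induction t)
  case 0
  then show ?case using assms by auto
next
  case (Suc t)
  let ?r = "\<lambda>p. if p = 0 then of_nat (Y + t) else if 3 \<le> p \<and> p < 3 + t then r (Y + (p - 3)) else r p"
  have "effects (load_cells (Suc t)) r = effects [Load (3 + t) 0, Add 0 0 1] ?r"
    using Suc by simp
  also have "\<dots> = ?r(3 + t := r (Y + t), 0 := of_nat (Y + Suc t))"
  proof -
    have "(of_nat (Y + t) + 1 :: rat) = of_nat (Y + Suc t)" by simp
    moreover have "?r 1 = 1" "?r (Y + t) = r (Y + t)" using Suc.prems assms(2) by auto
    ultimately show ?thesis
      unfolding effects.simps effect.simps by (auto simp: fun_eq_iff nat_floor_eq simp del: of_nat_add of_nat_Suc)
  qed
  also have "\<dots> = (\<lambda>p. if p = 0 then of_nat (Y + Suc t) else if 3 \<le> p \<and> p < 3 + Suc t then r (Y + (p - 3)) else r p)"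
    by (rule ext) (auto simp: less_Suc_eq)
  finally show ?case .
qed

text \<open>
  Registers 3 to 13 hold \<open>n\<close>, \<open>m\<close>, \<open>n * m\<close>, \<open>k0\<close>, 1, 0, the base addresses \<open>bD\<close>, \<open>bA\<close>, \<open>bG\<close>, \<open>bS\<close>
  and the packet size; register 14 holds the withheld margin, register 15 the gap beyond which prices are raised,
  register 16 the address of the current row of \<open>a\<close>, and the registers up to 34 are scratch.
  The arrays are the remaining demands at \<open>bD\<close>, then (each of size \<open>n * m\<close>) the coefficients \<open>a\<close>,
  the keys and the strategies from \<open>bA\<close> on, the gaps load minus price at \<open>bG\<close>, and at \<open>bS\<close> the number of
  players who already face the next price of the resource.
\<close>

definition greedy :: com where
  "greedy =
     Blk [Const 19 0, Add 20 16 8, Add 21 16 8, Const 22 0, Load 24 20, Mul 24 24 13,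
          Add 25 20 5, Load 25 25, Add 23 25 24] ;;
     WhileLt 19 4 (
       Blk [Load 24 20, Mul 24 24 13, Add 25 20 5, Load 25 25, Add 24 25 24] ;;
       IfLt 24 23 (Blk [Add 23 24 8, Add 21 20 8, Add 22 19 8]) (Blk []) ;;
       Blk [Add 19 19 7, Add 20 20 7]) ;;
     Blk [Add 25 21 5, Store 23 25, Add 25 25 5, Load 24 25, Add 24 24 13, Store 24 25,
          Add 25 11 22, Load 24 25, Add 24 24 13, Store 24 25]"

definition fill_player :: com where
  "fill_player = WhileLt 14 18 (greedy ;; Blk [Sub 18 18 13])"

definition fill :: com where
  "fill = Blk [Const 17 0, Add 16 10 8] ;;
     WhileLt 17 3 (
       Blk [Add 26 9 17, Load 18 26] ;;
       fill_player ;;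
       Blk [Store 18 26, Add 16 16 4, Add 17 17 7])"

text \<open>Raising the price seen by a player and taking one of her packets away cancel in her key, so a
  raise on a used resource is a removal followed by a greedy addition.\<close>

definition raise_step :: com where
  "raise_step =
     Blk [Mul 16 29 4, Add 16 16 10, Add 30 16 17, Add 31 30 5, Add 32 31 5, Load 34 32,
          Add 29 29 7, Store 29 28] ;;
     IfLt 8 34
       (Blk [Sub 34 34 13, Store 34 32, Sub 27 27 13, Store 27 26] ;; greedy)
       (Blk [Load 33 30, Mul 33 33 13, Load 34 31, Add 34 34 33, Store 34 31])"

text \<open>When the counter of the resource reaches \<open>n\<close>, everyone faces the raised
  price, which now becomes the price: the gap drops by a packet and the counter restarts at 0. The
  scan begins anew because a re-inserted packet may have widened a gap already checked.\<close>

definition raise :: com where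
  "raise = raise_step ;;
     IfLt 29 3 (Blk []) (Blk [Store 8 28, Load 27 26, Sub 27 27 13, Store 27 26]) ;;
     Blk [Const 17 0]"

text \<open>A round of raises starts only at a gap above register 15, but once begun it goes on
  until the gap is a single packet or all players have been served.\<close>

definition ascend :: com where
  "ascend = Blk [Const 17 0] ;;
     WhileLt 17 4 (
       Blk [Add 26 11 17, Load 27 26, Add 28 12 17, Load 29 28, Add 33 15 8] ;;
       IfLt 8 29 (Blk [Add 33 13 8]) (Blk []) ;;
       IfLt 33 27 raise (Blk [Add 17 17 7]))"

definition phase :: com where "phase = fill ;; ascend"

definition solve :: com where
  "solve = WhileLt 6 13 (phase ;; Blk [Const 33 (1 / 2), Mul 13 13 33, Mul 14 14 33, Mul 15 15 33]) ;;
     phase ;; Blk [Const 14 0, Add 15 6 8] ;; phase"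

definition init_packet :: com where
  "init_packet = Blk [Const 17 0] ;;
     WhileLt 17 3 (
       Blk [Add 26 9 17, Load 18 26] ;;
       WhileLt 13 18 (Blk [Add 13 13 13]) ;;
       Blk [Add 17 17 7]) ;;
     Blk [Add 14 4 7, Add 14 14 7, Mul 14 14 13, Mul 15 3 13]"

text \<open>Initially only cells 0, 1, 2 are known to be outside the arrays. Cell 0 is therefore
  turned into the address \<open>64 * n * m\<close>, which lies beyond the input and from which \<open>n\<close> is recovered by
  division; \<open>k0\<close> and the cells 3 to 34 are moved there before these cells serve as registers, and the
  rest of the input follows.\<close>

definition boot :: com where
  "boot =
     Blk ([Mul 0 0 1, Add 0 0 0, Add 0 0 0, Add 0 0 0, Add 0 0 0, Add 0 0 0, Add 0 0 0,
           Store 2 0, Const 2 1] @ save_cells 32) ;;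
     Blk [Const 3 32, Sub 0 0 3, Load 6 0, Const 3 64, Div 5 0 3, Div 3 5 1, Const 8 0, Const 7 1,
          Add 4 1 8, Add 9 0 7, Add 10 9 3, Add 11 10 5, Add 11 11 5, Add 11 11 5, Add 12 11 4,
          Add 13 6 8, Const 17 35, Const 20 33, Add 18 0 20, Const 20 3, Add 19 3 20, Add 19 19 5,
          Add 19 19 5] ;;
     WhileLt 17 19 (Blk [Load 21 17, Store 21 18, Add 17 17 7, Add 18 18 7])"

text \<open>The first 32 output cells coincide with registers and are written last, by straight-line code
  that needs only registers 0 and 1.\<close>

definition write_profile :: com where
  "write_profile =
     Blk [Const 17 32, Add 18 10 5, Add 18 18 5, Add 18 18 17, Const 20 3, Add 19 17 20] ;;
     WhileLt 17 5 (Blk [Load 21 18, Store 21 19, Add 17 17 7, Add 18 18 7, Add 19 19 7]) ;;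
     Blk ([Add 0 10 5, Add 0 0 5, Const 1 1] @ load_cells 32)"

definition program :: com where
  "program = boot ;; init_packet ;; solve ;; write_profile"

lemma idx_less: "i < n \<Longrightarrow> e < m \<Longrightarrow> i * m + e < n * (m::nat)"
proof -
  assume "i < n" "e < m"
  then have "i * m + e < Suc i * m" by simp
  also have "\<dots> \<le> n * m" using \<open>i < n\<close> by (intro mult_le_mono1) simp
  finally show ?thesis .
qed

lemma idx_less': "i < n \<Longrightarrow> e < m \<Longrightarrow> i * m + e < m * (n::nat)"
  using idx_less[of i n e m] by (simp add: mult.commute)

section \<open>Memory layout, and relocation of input and output\<close>

section \<open>Correctness and running time\<close>

locale layout =
  fixes n m :: nat and k0 :: rat and a :: "nat \<Rightarrow> nat \<Rightarrow> rat"
  assumes n_pos: "n \<ge> 1" and m_pos: "m \<ge> 1"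
begin

text \<open>Input cell \<open>p\<close> moves to \<open>64 * (n * m) + p - 2\<close>, and the
  demands begin in cell 3.\<close>

definition bD :: nat where "bD = 64 * (n * m) + 1"
definition bA :: nat where "bA = bD + n"
definition bG :: nat where "bG = bA + 3 * (n * m)"
definition bS :: nat where "bS = bG + m"

lemma nm_pos: "n * m \<ge> 1"
  using n_pos m_pos by (simp add: Suc_le_eq)

lemma bD_ge: "bD > 64"
  using nm_pos unfolding bD_def by linarith

lemmas bases = bA_def bG_def bS_def

definition const_regs :: "rat \<Rightarrow> mem \<Rightarrow> bool" where
  "const_regs k r \<longleftrightarrow> r 3 = of_nat n \<and> r 4 = of_nat m \<and> r 5 = of_nat (n * m) \<and> r 6 = k0 \<and>
     r 7 = 1 \<and> r 8 = 0 \<and> r 9 = of_nat bD \<and> r 10 = of_nat bA \<and> r 11 = of_nat bG \<and>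
     r 12 = of_nat bS \<and> r 13 = k"

text \<open>Strategies and gaps are stored as amounts, while the packet counts \<open>X\<close> and
  \<open>G\<close> are ghost values: halving \<open>k\<close> and doubling the counts leaves these
  cells untouched. Loads and prices are not stored, since keys and gaps suffice to run the
  auction.\<close>

definition heap :: "rat \<Rightarrow> (nat \<Rightarrow> nat \<Rightarrow> nat) \<Rightarrow> (nat \<Rightarrow> nat \<Rightarrow> rat) \<Rightarrow> (nat \<Rightarrow> nat) \<Rightarrow>
    (nat \<Rightarrow> nat) \<Rightarrow> (nat \<Rightarrow> rat) \<Rightarrow> mem \<Rightarrow> bool" where
  "heap k X K G S Q r \<longleftrightarrow>
     (\<forall>i<n. r (bD + i) = Q i) \<and>
     (\<forall>j<n * m. r (bA + j) = a (j div m) (j mod m)) \<and>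
     (\<forall>j<n * m. r (bA + n * m + j) = K (j div m) (j mod m)) \<and>
     (\<forall>j<n * m. r (bA + 2 * (n * m) + j) = of_nat (X (j div m) (j mod m)) * k) \<and>
     (\<forall>e<m. r (bG + e) = of_nat (G e) * k) \<and>
     (\<forall>e<m. r (bS + e) = of_nat (S e))"

lemma const_regs_upd [simp]: "p > 13 \<Longrightarrow> const_regs k (r(p := v)) = const_regs k r"
  unfolding const_regs_def by simp

lemma heap_reg [simp]: "p < 64 \<Longrightarrow> heap k X K G S Q (r(p := v)) = heap k X K G S Q r"
  using bD_ge unfolding heap_def bases by auto

lemma div_mod_idx: "e < m \<Longrightarrow> j div m = i \<and> j mod m = e \<longleftrightarrow> j = i * m + e"
  by auto

lemma fun_upd_div_mod: "e < m \<Longrightarrow> (F(i := (F i)(e := v))) (j div m) (j mod m)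
    = (if j = i * m + e then v else F (j div m) (j mod m))"
  using div_mod_idx[of e j i] by auto

lemma heap_read:
  assumes "heap k X K G S Q r" "i < n" "e < m"
  shows "r (bA + (i * m + e)) = a i e" "r (bA + n * m + (i * m + e)) = K i e"
    "r (bA + 2 * (n * m) + (i * m + e)) = of_nat (X i e) * k"
    "r (bG + e) = of_nat (G e) * k" "r (bS + e) = of_nat (S e)" "r (bD + i) = Q i"
  using assms idx_less[OF assms(2,3)] unfolding heap_def by auto

lemma heap_K:
  assumes h: "heap k X K G S Q r" and i: "i < n" and e: "e < m"
  shows "heap k X (K(i := (K i)(e := v))) G S Q (r(bA + n * m + (i * m + e) := v))"
  using h idx_less[OF i e] idx_less'[OF i e] unfolding heap_def bases fun_upd_div_mod[OF e] by auto

lemma heap_X: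
  assumes h: "heap k X K G S Q r" and i: "i < n" and e: "e < m" and v: "v = of_nat z * k"
  shows "heap k (X(i := (X i)(e := z))) K G S Q (r(bA + 2 * (n * m) + (i * m + e) := v))"
  using h idx_less[OF i e] idx_less'[OF i e] unfolding heap_def bases fun_upd_div_mod[OF e] v by auto

lemma heap_G:
  assumes h: "heap k X K G S Q r" and e: "e < m" and v: "v = of_nat z * k"
  shows "heap k X K (G(e := z)) S Q (r(bG + e := v))"
  using h e unfolding heap_def bases v by auto

lemma heap_S:
  assumes h: "heap k X K G S Q r" and e: "e < m" and v: "v = of_nat z"
  shows "heap k X K G (S(e := z)) Q (r(bS + e := v))"
  using h e unfolding heap_def bases v by auto

lemma heap_Q:
  assumes h: "heap k X K G S Q r" and i: "i < n"
  shows "heap k X K G S (Q(i := v)) (r(bD + i := v))"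
  using h i unfolding heap_def bases by auto


text \<open>Scanning a resource costs at most 10 operations, the loop test included. Resource 0 is
  the provisional choice and is scanned once more.\<close>

lemma greedy_wp:
  assumes c0: "const_regs k r" and h0: "heap k X K G S Q r" and i: "i < n"
    and row: "r 16 = of_nat (bA + i * m)"
  shows "wp greedy r (\<lambda>r' u. u \<le> 10 * m + 20 \<and>
    (\<exists>f. greedy_choice m (\<lambda>e. a i e * k) (K i) f \<and> const_regs k r' \<and>
      heap k (X(i := (X i)(f := Suc (X i f)))) (K(i := (K i)(f := K i f + a i f * k)))
        (G(f := Suc (G f))) S Q r' \<and>
      (\<forall>p<64. p < 19 \<or> 25 < p \<longrightarrow> r' p = r p)))"
proof -
  define val where "val f = K i f + a i f * k" for f
  define I where "I = (\<lambda>(f, bf) r'. const_regs k r' \<and> heap k X K G S Q r' \<and>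
     (\<forall>p<64. p < 19 \<or> 25 < p \<longrightarrow> r' p = r p) \<and> f \<le> m \<and> bf < m \<and> r' 19 = of_nat f \<and>
     r' 20 = of_nat (bA + i * m + f) \<and> r' 21 = of_nat (bA + i * m + bf) \<and>
     r' 22 = of_nat bf \<and> r' 23 = val bf \<and> (\<forall>f'<f. val bf \<le> val f'))"
  have rd: "r' (bA + i * m + f) = a i f" "r' (bA + i * m + f + n * m) = K i f"
     "r' (bA + i * m + f + n * m + n * m) = of_nat (X i f) * k"
     "r' (bG + f) = of_nat (G f) * k"
    if "heap k X K G S Q r'" "f < m" for r' f
    using heap_read[OF that(1) i that(2)] unfolding mult_2 by (simp_all add: ac_simps)
  have m0: "0 < m" using m_pos by simp
  have main: "wp (
       Blk [Load 24 20, Mul 24 24 13, Add 25 20 5, Load 25 25, Add 24 25 24] ;;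
       IfLt 24 23 (Blk [Add 23 24 8, Add 21 20 8, Add 22 19 8]) (Blk []) ;;
       Blk [Add 19 19 7, Add 20 20 7]) s
     (\<lambda>r' u. \<exists>g'. I g' r' \<and> Suc u + (case g' of (f, bf) \<Rightarrow> 10 * (m - f)) \<le> (case g of (f, bf) \<Rightarrow> 10 * (m - f)))"
    if Ig: "I g s" and lt: "s 19 < s 4" for g s
  proof -
    obtain f bf where g: "g = (f, bf)" by force
    note J = Ig[unfolded g I_def prod.case]
    have cs: "const_regs k s" and hs: "heap k X K G S Q s" using J by auto
    have f: "f < m" using lt J by (auto simp: const_regs_def)
    have l1: "nat \<lfloor>s 20\<rfloor> = bA + i * m + f" using J by (intro nat_floor_eq) simp
    have l2: "nat \<lfloor>s 20 + s 5\<rfloor> = bA + i * m + f + n * m"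
      using J by (intro nat_floor_eq) (simp add: const_regs_def)
    have v: "K i f + a i f * s 13 = val f" using cs by (simp add: val_def const_regs_def)
    have s78: "s 7 = 1" "s 8 = 0" using cs by (auto simp: const_regs_def)
    have ne: "bA + i * m + f + n * m \<noteq> 24" "bA + i * m + f + n * m \<noteq> 25"
      using bD_ge unfolding bases by auto
    show ?thesis
      unfolding g
      apply (intro wp_Seq wp_Blk wp_IfLt)
          apply (simp_all add: l1 l2 rd[OF hs f] v s78 ne)
      subgoal
        using J f by (intro exI[of _ "Suc f"] exI[of _ f]) (auto simp: I_def less_Suc_eq)
      subgoal
        using J f by (intro exI[of _ "Suc f"] exI[of _ bf]) (auto simp: I_def less_Suc_eq)
      done
  qed
  have l1: "nat \<lfloor>r 16 + r 8\<rfloor> = bA + i * m + 0" using row c0 by (intro nat_floor_eq) (simp add: const_regs_def)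
  have l2: "nat \<lfloor>r 16 + r 8 + r 5\<rfloor> = bA + i * m + 0 + n * m"
    using row c0 by (intro nat_floor_eq) (simp add: const_regs_def)
  have ne: "bA + i * m + n * m \<noteq> p" "bA + i * m \<noteq> p" if "p < 64" for p
    using bD_ge that unfolding bases by auto
  show ?thesis unfolding greedy_def
    apply (intro wp_Seq wp_Blk)
     apply simp
    apply (rule wp_While[where I = I and g = "(0, 0)" and \<phi> = "\<lambda>(f, bf). 10 * (m - f)"])
    subgoal
    proof -
      have e: "effects [Const 19 0, Add 20 16 8, Add 21 16 8, Const 22 0, Load 24 20, Mul 24 24 13,
          Add 25 20 5, Load 25 25, Add 23 25 24] r
        = r(19 := 0, 20 := r 16 + r 8, 21 := r 16 + r 8, 22 := 0, 24 := a i 0 * r 13,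
            25 := K i 0, 23 := K i 0 + a i 0 * r 13)"
        by (simp add: l1 l2 ne rd[OF h0 m0, simplified])
      have cr: "r 13 = k" "r 8 = 0" using c0 by (auto simp: const_regs_def)
      show ?thesis unfolding e I_def prod.case using c0 h0 row m0 cr by (simp add: val_def)
    qed
    subgoal by (rule main)
    subgoal premises p for g s u
    proof -
      obtain f bf where g: "g = (f, bf)" by force
      note J = p(1)[unfolded g I_def prod.case]
      have cs: "const_regs k s" and hs: "heap k X K G S Q s" and bf: "bf < m" using J by auto
      have f: "f = m" using p(2) J by (auto simp: const_regs_def)
      have am: "greedy_choice m (\<lambda>e. a i e * k) (K i) bf" using J f unfolding greedy_choice_def val_def by auto
      have pres: "\<And>p. p < 64 \<Longrightarrow> p < 19 \<or> 25 < p \<Longrightarrow> s p = r p" using J by auto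
      have idx: "bA + (n * m + (i * m + bf)) > 64" "bA + (2 * (n * m) + (i * m + bf)) > 64" "bG + bf > 64"
        using bD_ge unfolding bases by auto
      have ne: "bA + 2 * (n * m) + (i * m + bf) \<noteq> 25" "bG + bf \<noteq> 25"
        using bD_ge unfolding bases by auto
      define s1 where "s1 = effects [Add 25 21 5, Store 23 25] s"
      have s1: "s1 = s(25 := s 21 + s 5, bA + n * m + (i * m + bf) := K i bf + a i bf * k)"
      proof -
        have "nat \<lfloor>s 21 + s 5\<rfloor> = bA + n * m + (i * m + bf)"
          using J by (intro nat_floor_eq) (simp add: const_regs_def)
        then show ?thesis using J by (simp add: s1_def val_def)
      qed
      have h1: "heap k X (K(i := (K i)(bf := K i bf + a i bf * k))) G S Q s1"
        unfolding s1 using hs i bf by (intro heap_K) auto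
      have c1: "const_regs k s1" unfolding s1 using cs idx by simp
      define s2 where "s2 = effects [Add 25 25 5, Load 24 25, Add 24 24 13, Store 24 25] s1"
      have s2: "s2 = s1(25 := s1 25 + s1 5, 24 := of_nat (Suc (X i bf)) * k,
          bA + 2 * (n * m) + (i * m + bf) := of_nat (Suc (X i bf)) * k)"
      proof -
        have l: "nat \<lfloor>s1 25 + s1 5\<rfloor> = bA + 2 * (n * m) + (i * m + bf)"
          using J idx by (intro nat_floor_eq) (simp add: const_regs_def s1)
        have "s1 13 = k" using c1 by (simp add: const_regs_def)
        then have "s1 (bA + 2 * (n * m) + (i * m + bf)) + s1 13 = of_nat (Suc (X i bf)) * k"
          unfolding heap_read(3)[OF h1 i bf] by (simp add: algebra_simps)
        then show ?thesis unfolding s2_def by (simp add: l ne del: of_nat_Suc)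
      qed
      have h2: "heap k (X(i := (X i)(bf := Suc (X i bf)))) (K(i := (K i)(bf := K i bf + a i bf * k))) G S Q s2"
        unfolding s2 using h1 i bf by (intro heap_X) auto
      have c2: "const_regs k s2" unfolding s2 using c1 idx by simp
      define s3 where "s3 = effects [Add 25 11 22, Load 24 25, Add 24 24 13, Store 24 25] s2"
      have s3: "s3 = s2(25 := s2 11 + s2 22, 24 := of_nat (Suc (G bf)) * k,
          bG + bf := of_nat (Suc (G bf)) * k)"
      proof -
        have "s2 22 = of_nat bf" using J idx by (simp add: s2 s1)
        then have l: "nat \<lfloor>s2 11 + s2 22\<rfloor> = bG + bf"
          using c2 by (intro nat_floor_eq) (simp add: const_regs_def)
        have "s2 13 = k" using c2 by (simp add: const_regs_def)
        then have "s2 (bG + bf) + s2 13 = of_nat (Suc (G bf)) * k"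
          unfolding heap_read(4)[OF h2 i bf] by (simp add: algebra_simps)
        then show ?thesis unfolding s3_def by (simp add: l ne del: of_nat_Suc)
      qed
      have h3: "heap k (X(i := (X i)(bf := Suc (X i bf)))) (K(i := (K i)(bf := K i bf + a i bf * k)))
          (G(bf := Suc (G bf))) S Q s3"
        unfolding s3 using h2 bf by (intro heap_G) auto
      have c3: "const_regs k s3" unfolding s3 using c2 idx by simp
      have pr: "s3 p = r p" if "p < 64" "p < 19 \<or> 25 < p" for p
        using that pres[OF that] idx by (auto simp: s3 s2 s1)
      have e3: "effects [Add 25 21 5, Store 23 25, Add 25 25 5, Load 24 25, Add 24 24 13, Store 24 25,
          Add 25 11 22, Load 24 25, Add 24 24 13, Store 24 25] s = s3"
        unfolding s3_def s2_def s1_def by (simp only: effects.simps)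
      show ?thesis
        apply (rule wp_Blk)
         apply simp
        unfolding e3 using am c3 h3 pr p(3) by auto
    qed
    done
qed

text \<open>The input ends before \<open>64 * n * m\<close> and all targets lie at or beyond it, so
  copying never destroys unread cells. The loop starts at 35, the first cell not saved by the
  unrolled code. The conclusion also covers the cells behind the input: their zeros are needed
  later.\<close>

lemma boot_wp:
  assumes r: "r 0 = of_nat n" "r 1 = of_nat m" "r 2 = k0"
    and z: "\<And>p. 3 + n + 2 * (n * m) \<le> p \<Longrightarrow> r p = 0"
  shows "wp boot r (\<lambda>r' u. u \<le> 3 * (3 + n + 2 * (n * m)) + 100 \<and> const_regs k0 r' \<and>
    (\<forall>p\<ge>3. r' (64 * (n * m) + p - 2) = r p))"
proof -
  define W where "W = 64 * (n * m)"
  define B where "B = 3 + n + 2 * (n * m)"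
  have nnm: "n \<le> n * m" using m_pos by simp
  have W: "64 \<le> W" "B \<le> W" unfolding W_def B_def using nm_pos nnm by linarith+
  let ?ini = "[Mul 0 0 1, Add 0 0 0, Add 0 0 0, Add 0 0 0, Add 0 0 0, Add 0 0 0, Add 0 0 0,
           Store 2 0, Const 2 1]"
  have Wr: "(of_nat W :: rat) = 64 * (of_nat n * of_nat m)" unfolding W_def by simp
  have e0: "effects ?ini r = r(0 := of_nat W, W := k0, 2 := 1)"
  proof -
    have Wr': "of_nat W = (64 * (of_nat m * of_nat n) :: rat)" unfolding W_def by simp
    have "nat \<lfloor>64 * (of_nat m * of_nat n :: rat)\<rfloor> = W" by (rule nat_floor_eq) (simp add: Wr')
    then show ?thesis using W(1) by (simp add: r r[unfolded One_nat_def] Wr' fun_eq_iff)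
  qed
  define s where "s = effects (?ini @ save_cells 32) r"
  have s: "s p = (if p = 0 then of_nat (W + 32) else if W < p \<and> p \<le> W + 32 then r (p - W + 2)
     else if p = W then k0 else if p = 2 then 1 else r p)" for p
  proof -
    have "s = effects (save_cells 32) (r(0 := of_nat W, W := k0, 2 := 1))"
      unfolding s_def effects_append e0 ..
    also have "\<dots> = (\<lambda>p. if p = 0 then of_nat (W + 32) else if W < p \<and> p \<le> W + 32
        then (r(0 := of_nat W, W := k0, 2 := 1)) (p - W + 2) else (r(0 := of_nat W, W := k0, 2 := 1)) p)"
      by (rule effects_save_cells) (use W in auto)
    finally show ?thesis using W by auto
  qed
  let ?blk = "[Const 3 32, Sub 0 0 3, Load 6 0, Const 3 64, Div 5 0 3, Div 3 5 1, Const 8 0, Const 7 1,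
          Add 4 1 8, Add 9 0 7, Add 10 9 3, Add 11 10 5, Add 11 11 5, Add 11 11 5, Add 12 11 4,
          Add 13 6 8, Const 17 35, Const 20 33, Add 18 0 20, Const 20 3, Add 19 3 20, Add 19 19 5,
          Add 19 19 5]"
  define s1 where "s1 = effects ?blk s"
  have s1: "s1 0 = of_nat W" "s1 3 = of_nat n" "s1 4 = of_nat m" "s1 5 = of_nat (n * m)" "s1 6 = k0"
    "s1 7 = 1" "s1 8 = 0" "s1 9 = of_nat bD" "s1 10 = of_nat bA" "s1 11 = of_nat bG" "s1 12 = of_nat bS"
    "s1 13 = k0" "s1 17 = of_nat 35" "s1 18 = of_nat (W + 33)" "s1 19 = of_nat B"
    "\<And>p. 35 \<le> p \<Longrightarrow> s1 p = s p"
  proof -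
    have s01: "s 0 = of_nat W + 32" "s 1 = of_nat m" "s W = k0" using W r by (simp_all add: s)
    have s1': "s (Suc 0) = of_nat m" using s01(2) by simp
    have ne: "W \<noteq> 0" "W \<noteq> 3" using W by auto
    have m0: "m \<noteq> 0" using m_pos by simp
    have d: "of_nat W / 64 = (of_nat n * of_nat m :: rat)" by (simp add: Wr)
    have e: "s1 = s(0 := of_nat W, 6 := k0, 5 := of_nat n * of_nat m, 3 := of_nat n, 8 := 0, 7 := 1,
        4 := of_nat m, 9 := of_nat W + 1, 10 := of_nat W + 1 + of_nat n,
        11 := of_nat W + 1 + of_nat n + of_nat n * of_nat m + of_nat n * of_nat m + of_nat n * of_nat m,
        12 := of_nat W + 1 + of_nat n + of_nat n * of_nat m + of_nat n * of_nat m + of_nat n * of_nat m + of_nat m,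
        13 := k0, 17 := 35, 18 := of_nat W + 33, 20 := 3,
        19 := of_nat n + 3 + of_nat n * of_nat m + of_nat n * of_nat m)"
      unfolding s1_def by (simp add: s01 s1' ne m0 d fun_eq_iff)
    show "s1 0 = of_nat W" "s1 3 = of_nat n" "s1 4 = of_nat m" "s1 5 = of_nat (n * m)" "s1 6 = k0"
      "s1 7 = 1" "s1 8 = 0" "s1 9 = of_nat bD" "s1 10 = of_nat bA" "s1 11 = of_nat bG" "s1 12 = of_nat bS"
      "s1 13 = k0" "s1 17 = of_nat 35" "s1 18 = of_nat (W + 33)" "s1 19 = of_nat B"
      "\<And>p. 35 \<le> p \<Longrightarrow> s1 p = s p"
      unfolding e bases bD_def B_def W_def[symmetric] by simp_all
  qed
  define I where "I = (\<lambda>q s'. (\<forall>p<17. s' p = s1 p) \<and> s' 17 = of_nat q \<and> s' 18 = of_nat (W + q - 2) \<and>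
     s' 19 = of_nat B \<and> 35 \<le> q \<and> q \<le> max 35 B \<and>
     (\<forall>p\<ge>35. p < W \<longrightarrow> s' p = r p) \<and> (\<forall>p\<ge>3. p < q \<longrightarrow> s' (W + p - 2) = r p) \<and> (\<forall>p\<ge>q. s' (W + p - 2) = 0))"
  show ?thesis unfolding boot_def
  proof (rule wp_Seq, rule wp_Blk, use straight_cells in force, fold s_def, rule wp_Seq, rule wp_Blk, force, fold s1_def,
      rule wp_While[where I = I and g = 35 and \<phi> = "\<lambda>q. 3 * (B - q)"])
    show "I 35 s1" unfolding I_def
    proof (intro conjI allI impI)
      fix p assume p: "35 \<le> p" "p < W" then show "s1 p = r p" using s1(16) s by simp
    next
      fix p assume p: "3 \<le> p" "p < (35 :: nat)"
      then have "35 \<le> W + p - 2" "W < W + p - 2" "W + p - 2 \<le> W + 32" "W + p - 2 - W + 2 = p" using W by auto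
      then show "s1 (W + p - 2) = r p" using s1(16) s by simp
    next
      fix p assume p: "35 \<le> (p :: nat)"
      then have "35 \<le> W + p - 2" "\<not> W + p - 2 \<le> W + 32" "W < W + p - 2" "B \<le> W + p - 2" using W by auto
      then show "s1 (W + p - 2) = 0" using s1(16) s z unfolding B_def by simp
    qed (use s1 in auto)
  next
    fix q s' assume J: "I q s'" and lt: "s' 17 < s' 19"
    have q: "35 \<le> q" "q < B" using J lt unfolding I_def by auto
    have v: "s' q = r q" "s' 7 = 1" using J q W s1 unfolding I_def by auto
    let ?s = "s'(21 := r q, W + q - 2 := r q, 17 := of_nat (Suc q), 18 := of_nat (W + Suc q - 2))"
    have e: "effects [Load 21 17, Store 21 18, Add 17 17 7, Add 18 18 7] s' = ?s"
    proof -
      have f: "nat \<lfloor>s' 17\<rfloor> = q" "nat \<lfloor>s' 18\<rfloor> = W + q - 2" using J unfolding I_def by (auto intro: nat_floor_eq)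
      have g: "s' 17 + 1 = of_nat (Suc q)" "s' 18 + 1 = of_nat (W + Suc q - 2)"
      proof -
        have "W + Suc q - 2 = Suc (W + q - 2)" using W by simp
        then show "s' 17 + 1 = of_nat (Suc q)" "s' 18 + 1 = of_nat (W + Suc q - 2)"
          using J unfolding I_def by simp_all
      qed
      have h: "W + q - 2 \<noteq> 17" "W + q - 2 \<noteq> 7" "W + q - 2 \<noteq> 18" "W + q - 2 \<noteq> 21" using W q by auto
      show ?thesis by (simp add: f g h v del: of_nat_Suc)
    qed
    have "I (Suc q) ?s" unfolding I_def
    proof (intro conjI allI impI)
      fix p assume p: "p < (17 :: nat)"
      then have "p \<noteq> W + q - 2" using W by auto
      then show "?s p = s1 p" using J p unfolding I_def by simp
    next
      show "?s 19 = of_nat B" using J W unfolding I_def by auto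
    next
      fix p assume p: "35 \<le> p" "p < W"
      then have "p \<noteq> W + q - 2" using q by auto
      then show "?s p = r p" using J p unfolding I_def by simp
    next
      fix p assume p: "3 \<le> p" "p < Suc q"
      show "?s (W + p - 2) = r p"
      proof (cases "p = q")
        case True
        moreover have "W + q - 2 \<noteq> 17" "W + q - 2 \<noteq> 18" using W q by auto
        ultimately show ?thesis by simp
      next
        case False
        then have "W + p - 2 \<noteq> W + q - 2" "W + p - 2 > 21" using W q p by auto
        then show ?thesis using J p False unfolding I_def by simp
      qed
    next
      fix p assume p: "Suc q \<le> p"
      then have "W + p - 2 \<noteq> W + q - 2" "W + p - 2 > 21" using W q p by auto
      then show "?s (W + p - 2) = 0" using J p unfolding I_def by simp
    qed (use q W in auto)
    moreover have "B - q = Suc (B - Suc q)" using q by simp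
    ultimately show "wp (Blk [Load 21 17, Store 21 18, Add 17 17 7, Add 18 18 7]) s'
        (\<lambda>r' u. \<exists>g'. I g' r' \<and> Suc u + 3 * (B - g') \<le> 3 * (B - q))"
      by (intro wp_Blk, simp, unfold e, intro exI[of _ "Suc q"]) simp
  next
    fix q s' u assume J: "I q s'" and lt: "\<not> s' 17 < s' 19" and u: "u + 3 * (B - q) \<le> Suc (3 * (B - 35))"
    have q: "B \<le> q" using J lt unfolding I_def by auto
    have "\<forall>p\<ge>3. s' (64 * (n * m) + p - 2) = r p"
    proof (intro allI impI)
      fix p assume p: "3 \<le> (p :: nat)"
      show "s' (64 * (n * m) + p - 2) = r p"
      proof (cases "p < q")
        case True
        then show ?thesis using J p unfolding I_def W_def by blast
      next
        case False
        then have "s' (64 * (n * m) + p - 2) = 0" using J p unfolding I_def W_def by simp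
        moreover have "r p = 0" using z[of p] False q unfolding B_def by simp
        ultimately show ?thesis by simp
      qed
    qed
    moreover have "const_regs k0 s'" using J s1 unfolding const_regs_def I_def by simp
    moreover have "costs (?ini @ save_cells 32) + (costs ?blk + u) \<le> 3 * (3 + n + 2 * (n * m)) + 100"
      using u unfolding B_def by (simp add: costs_cells)
    ultimately show "costs (?ini @ save_cells 32) + (costs ?blk + u) \<le> 3 * (3 + n + 2 * (n * m)) + 100 \<and>
        const_regs k0 s' \<and> (\<forall>p\<ge>3. s' (64 * (n * m) + p - 2) = r p)" by blast
  qed
qed

text \<open>Starting the loop at 32 keeps its targets \<open>3 + j\<close> above the registers in
  use, and the source array lies above all targets, so nothing is overwritten before it is
  read.\<close>

lemma write_profile_wp:
  assumes c: "const_regs k r"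
  shows "wp write_profile r (\<lambda>r' u. u \<le> 4 * (n * m) + 50 \<and>
    (\<forall>j<n * m. r' (3 + j) = r (bA + 2 * (n * m) + j)))"
proof -
  define Y where "Y = bA + 2 * (n * m)"
  have Y: "64 * (n * m) + 1 \<le> Y" "64 < Y" using bD_ge unfolding Y_def bA_def bD_def by linarith+
  let ?blk = "[Const 17 32, Add 18 10 5, Add 18 18 5, Add 18 18 17, Const 20 3, Add 19 17 20]"
  define s where "s = effects ?blk r"
  have cr: "r 10 = of_nat bA" "r 5 = of_nat (n * m)" "r 7 = 1" using c by (simp_all add: const_regs_def)
  have s: "s = r(17 := of_nat 32, 18 := of_nat (Y + 32), 20 := 3, 19 := of_nat 35)"
    unfolding s_def Y_def by (simp add: cr fun_eq_iff)
  define I where "I = (\<lambda>j s'. (\<forall>p<17. s' p = r p) \<and> s' 17 = of_nat j \<and> s' 18 = of_nat (Y + j) \<and>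
     s' 19 = of_nat (3 + j) \<and> 32 \<le> j \<and> (\<forall>p\<ge>Y. s' p = r p) \<and> (\<forall>i<j. 32 \<le> i \<longrightarrow> s' (3 + i) = r (Y + i)))"
  show ?thesis unfolding write_profile_def
  proof (rule wp_Seq, rule wp_Blk, force, fold s_def, rule wp_Seq,
      rule wp_While[where I = I and g = 32 and \<phi> = "\<lambda>j. 4 * (n * m - j)"])
    show "I 32 s" unfolding I_def s using Y by simp
  next
    fix j s' assume J: "I j s'" and lt: "s' 17 < s' 5"
    have "s' 5 = of_nat (n * m)" "s' 17 = of_nat j" using J cr unfolding I_def by simp_all
    then have j: "32 \<le> j" "j < n * m" using J lt unfolding I_def by (simp_all del: of_nat_mult)
    have v: "s' (Y + j) = r (Y + j)" "s' 7 = 1" using J cr unfolding I_def by auto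
    let ?s = "s'(21 := r (Y + j), 3 + j := r (Y + j), 17 := of_nat (Suc j), 18 := of_nat (Y + Suc j),
      19 := of_nat (3 + Suc j))"
    have e: "effects [Load 21 18, Store 21 19, Add 17 17 7, Add 18 18 7, Add 19 19 7] s' = ?s"
    proof -
      have f: "nat \<lfloor>s' 18\<rfloor> = Y + j" "nat \<lfloor>s' 19\<rfloor> = 3 + j" using J unfolding I_def by (auto intro: nat_floor_eq)
      have g: "s' 17 + 1 = of_nat (Suc j)" "s' 18 + 1 = of_nat (Y + Suc j)" "s' 19 + 1 = of_nat (3 + Suc j)"
        using J unfolding I_def by simp_all
      have h: "3 + j \<noteq> 17" "3 + j \<noteq> 7" "3 + j \<noteq> 18" "3 + j \<noteq> 19" "3 + j \<noteq> 21" using j by auto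
      show ?thesis using f g h v by (simp del: of_nat_Suc of_nat_add add_Suc_right)
    qed
    have "I (Suc j) ?s" unfolding I_def
    proof (intro conjI allI impI)
      fix p assume p: "Y \<le> p"
      then have "p \<noteq> 3 + j" "p > 21" using j Y by linarith+
      then show "?s p = r p" using J p unfolding I_def by simp
    next
      fix i assume i: "i < Suc j" "32 \<le> i"
      then show "?s (3 + i) = r (Y + i)" using J unfolding I_def by (cases "i = j") simp_all
    qed (use J j in \<open>auto simp: I_def\<close>)
    moreover have "n * m - j = Suc (n * m - Suc j)" using j by simp
    ultimately show "wp (Blk [Load 21 18, Store 21 19, Add 17 17 7, Add 18 18 7, Add 19 19 7]) s'
        (\<lambda>r' u. \<exists>g'. I g' r' \<and> Suc u + 4 * (n * m - g') \<le> 4 * (n * m - j))"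
      by (intro wp_Blk, simp, unfold e, intro exI[of _ "Suc j"]) simp
  next
    fix j s' u assume J: "I j s'" and lt: "\<not> s' 17 < s' 5" and u: "u + 4 * (n * m - j) \<le> Suc (4 * (n * m - 32))"
    have "s' 5 = of_nat (n * m)" "s' 17 = of_nat j" using J cr unfolding I_def by simp_all
    then have j: "n * m \<le> j" using lt by (simp del: of_nat_mult)
    let ?ini = "[Add 0 10 5, Add 0 0 5, Const 1 1]"
    have e0: "effects ?ini s' = s'(0 := of_nat Y, 1 := 1)"
    proof -
      have "s' 10 = of_nat bA" "s' 5 = of_nat (n * m)" using J cr unfolding I_def by auto
      then show ?thesis unfolding Y_def by (simp add: ac_simps)
    qed
    have e: "effects (?ini @ load_cells 32) s' = (\<lambda>p. if p = 0 then of_nat (Y + 32)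
        else if 3 \<le> p \<and> p < 3 + 32 then (s'(0 := of_nat Y, 1 := 1)) (Y + (p - 3)) else (s'(0 := of_nat Y, 1 := 1)) p)"
      unfolding effects_append e0 by (rule effects_load_cells) (use Y in auto)
    have main: "effects (?ini @ load_cells 32) s' (3 + i) = r (Y + i)" if i: "i < n * m" for i
    proof (cases "i < 32")
      case True
      then show ?thesis unfolding e using J Y unfolding I_def by simp
    next
      case False
      then show ?thesis unfolding e using J j i unfolding I_def by simp
    qed
    \<comment> \<open>For \<open>n * m < 32\<close> this also copies cells behind the strategies;
      they land outside the output profile.\<close>
    show "wp (Blk (?ini @ load_cells 32)) s' (\<lambda>r2 u2. costs ?blk + (u + u2) \<le> 4 * (n * m) + 50 \<and>
       (\<forall>j<n * m. r2 (3 + j) = r (bA + 2 * (n * m) + j)))"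
    proof (rule wp_Blk, use straight_cells in force, rule conjI, goal_cases)
      case 1 show ?case using u by (simp add: costs_cells)
    next
      case 2 show ?case using main unfolding Y_def by blast
    qed
  qed
qed

end

section \<open>Keys at given prices, and the greedy placement of demands\<close>

locale game = layout +
  fixes d :: "nat \<Rightarrow> rat" and b :: "nat \<Rightarrow> nat \<Rightarrow> rat"
  assumes k0_pos: "k0 > 0"
    and dem_mult: "\<And>i. i < n \<Longrightarrow> \<exists>z::nat. d i = of_nat z * k0"
    and a_pos: "\<And>i e. i < n \<Longrightarrow> e < m \<Longrightarrow> a i e > 0"
begin

text \<open>Here \<open>X\<close> and \<open>G\<close> count packets of size \<open>k\<close>: load minus \<open>G e\<close> is the price of \<open>e\<close>, and the players
  \<open>i < S e\<close> face that price plus one packet.\<close>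

definition key :: "rat \<Rightarrow> (nat \<Rightarrow> nat \<Rightarrow> nat) \<Rightarrow> (nat \<Rightarrow> nat) \<Rightarrow> (nat \<Rightarrow> nat) \<Rightarrow> nat \<Rightarrow> nat \<Rightarrow> rat" where
  "key k X G S i e = a i e * (k * (of_nat (\<Sum>i<n. X i e) - of_nat (G e)
     + (if i < S e then 1 else 0) + of_nat (X i e))) + b i e"

definition keys_ok :: "rat \<Rightarrow> (nat \<Rightarrow> nat \<Rightarrow> nat) \<Rightarrow> (nat \<Rightarrow> nat \<Rightarrow> rat) \<Rightarrow> (nat \<Rightarrow> nat) \<Rightarrow> (nat \<Rightarrow> nat) \<Rightarrow> bool" where
  "keys_ok k X K G S \<longleftrightarrow> (\<forall>i<n. \<forall>e<m. K i e = key k X G S i e)"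

lemma sum_upd_row:
  assumes "i < n"
  shows "(\<Sum>i'<n. (X(i := Xi)) i' e) + X i e = (\<Sum>i'<n. X i' e) + (Xi e :: nat)"
  using assms by (simp add: sum.remove[of "{..<n}" i])

text \<open>A new packet raises load and gap together. The price stays, so only the key of the
  moving player at \<open>f\<close> changes.\<close>

lemma keys_add:
  assumes ks: "keys_ok k X K G S" and i: "i < n" and f: "f < m"
  shows "keys_ok k (X(i := (X i)(f := Suc (X i f)))) (K(i := (K i)(f := K i f + a i f * k))) (G(f := Suc (G f))) S"
  unfolding keys_ok_def
proof (intro allI impI)
  fix i' e assume i': "i' < n" and e: "e < m"
  let ?X = "X(i := (X i)(f := Suc (X i f)))"
  have K: "K i' e = key k X G S i' e" using ks i' e unfolding keys_ok_def by blast
  have s: "(\<Sum>i<n. ?X i e) = (\<Sum>i<n. X i e) + (if e = f then 1 else 0)"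
    using sum_upd_row[OF i, of X "(X i)(f := Suc (X i f))" e] by (auto split: if_splits)
  show "(K(i := (K i)(f := K i f + a i f * k))) i' e = key k ?X (G(f := Suc (G f))) S i' e"
    using K unfolding key_def s by (auto simp: algebra_simps)
qed

text \<open>\<open>rs\<close> makes the result exact: either the player starts with a best response,
  or at least \<open>m\<close> packets fit above the margin \<open>M\<close>, enough to repair a
  near-best response. The last packet may undercut \<open>M\<close>, but by less than
  \<open>k\<close>.\<close>

lemma fill_player_wp:
  assumes kp: "k > 0" and c0: "const_regs k r" and h0: "heap k X K G S Q r" and i: "i < n"
    and row: "r 16 = of_nat (bA + i * m)" and q: "r 18 = q" and M: "r 14 = M"
    and nr: "near_response m (\<lambda>e. a i e * k) (X i) (K i) 0"
    and rs: "best_response m (\<lambda>e. a i e * k) (X i) (K i) \<or> M + of_nat m * k \<le> q"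
    and qb: "q \<le> M + of_nat B * k"
  shows "wp fill_player r (\<lambda>r' u. u \<le> B * (10 * m + 22) + 1 \<and>
    (\<exists>Xi Ki G' j. const_regs k r' \<and> heap k (X(i := Xi)) (K(i := Ki)) G' S Q r' \<and>
      (\<forall>p<64. p < 18 \<or> 25 < p \<longrightarrow> r' p = r p) \<and> r' 18 = q - of_nat j * k \<and> r' 18 \<le> M \<and>
      j \<le> B \<and> best_response m (\<lambda>e. a i e * k) Xi Ki \<and> (\<Sum>e<m. Xi e) = (\<Sum>e<m. X i e) + j \<and>
      (j = 0 \<longrightarrow> Xi = X i) \<and> (0 < j \<longrightarrow> M - k < r' 18) \<and>
      (\<Sum>e<m. G' e) = (\<Sum>e<m. G e) + j \<and>
      (keys_ok k X K G S \<longrightarrow> keys_ok k (X(i := Xi)) (K(i := Ki)) G' S)))"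
proof -
  define I where "I = (\<lambda>(Xi, Ki, G', j) r'. const_regs k r' \<and> heap k (X(i := Xi)) (K(i := Ki)) G' S Q r' \<and>
      (\<forall>p<64. p < 18 \<or> 25 < p \<longrightarrow> r' p = r p) \<and> r' 18 = q - of_nat j * k \<and>
      j \<le> B \<and> near_response m (\<lambda>e. a i e * k) Xi Ki j \<and> (\<Sum>e<m. Xi e) = (\<Sum>e<m. X i e) + j \<and>
      (best_response m (\<lambda>e. a i e * k) Xi Ki \<or> M + of_nat m * k \<le> q) \<and>
      (j = 0 \<longrightarrow> Xi = X i) \<and> (0 < j \<longrightarrow> M - k < r' 18) \<and>
      (\<Sum>e<m. G' e) = (\<Sum>e<m. G e) + j \<and>
      (keys_ok k X K G S \<longrightarrow> keys_ok k (X(i := Xi)) (K(i := Ki)) G' S))"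
  have ap: "0 < a i e * k" if "e < m" for e using a_pos[OF i that] kp by simp
  show ?thesis unfolding fill_player_def
  proof (rule wp_While[where I = I and g = "(X i, K i, G, 0)" and
        \<phi> = "\<lambda>(Xi, Ki, G', j). (10 * m + 22) * (B - j)"])
    show "I (X i, K i, G, 0) r" unfolding I_def using c0 h0 q nr rs by simp
  next
    fix g s assume Ig: "I g s" and lt: "s 14 < s 18"
    obtain Xi Ki G' j where g: "g = (Xi, Ki, G', j)" by (cases g) auto
    note J = Ig[unfolded g I_def prod.case]
    let ?X = "X(i := Xi)" and ?K = "K(i := Ki)"
    have cs: "const_regs k s" and hs: "heap k ?X ?K G' S Q s" and nj: "near_response m (\<lambda>e. a i e * k) Xi Ki j"
      and s18: "s 18 = q - of_nat j * k"
      and rj: "best_response m (\<lambda>e. a i e * k) Xi Ki \<or> M + of_nat m * k \<le> q"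
      and kj: "keys_ok k X K G S \<longrightarrow> keys_ok k ?X ?K G' S"
      using J by simp_all
    have s: "s 14 = M" "s 16 = of_nat (bA + i * m)" using J M row by auto
    have "of_nat j * k < of_nat B * k" using qb lt s s18 by linarith
    then have jB: "j < B" using kp by simp
    show "wp (greedy ;; Blk [Sub 18 18 13]) s (\<lambda>r' u. \<exists>g'. I g' r' \<and>
        Suc u + (case g' of (Xi, Ki, G', j) \<Rightarrow> (10 * m + 22) * (B - j))
        \<le> (case g of (Xi, Ki, G', j) \<Rightarrow> (10 * m + 22) * (B - j)))"
    proof (rule wp_Seq, rule wp_mono[OF greedy_wp[OF cs hs i s(2)]], elim conjE exE)
      fix r1 u f
      assume u: "u \<le> 10 * m + 20" and am: "greedy_choice m (\<lambda>e. a i e * k) (?K i) f" and c1: "const_regs k r1"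
        and h1: "heap k (?X(i := (?X i)(f := Suc (?X i f)))) (?K(i := (?K i)(f := ?K i f + a i f * k)))
          (G'(f := Suc (G' f))) S Q r1"
        and pr: "\<forall>p<64. p < 19 \<or> 25 < p \<longrightarrow> r1 p = s p"
      have f: "f < m" using am unfolding greedy_choice_def by simp
      let ?Xi = "Xi(f := Suc (Xi f))" and ?Ki = "Ki(f := Ki f + a i f * k)"
      have am': "greedy_choice m (\<lambda>e. a i e * k) Ki f" using am by simp
      have n1: "near_response m (\<lambda>e. a i e * k) ?Xi ?Ki (Suc j)"
        by (rule near_response_add[OF nj am' ap])
      have r1: "best_response m (\<lambda>e. a i e * k) ?Xi ?Ki \<or> M + of_nat m * k \<le> q"
        using rj best_response_add[OF _ am' ap] by metis
      have sX: "(\<Sum>e<m. ?Xi e) = (\<Sum>e<m. Xi e) + 1"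
        using f by (simp add: sum.remove[of "{..<m}" f])
      have sG: "(\<Sum>e<m. (G'(f := Suc (G' f))) e) = (\<Sum>e<m. G' e) + 1"
        using f by (simp add: sum.remove[of "{..<m}" f])
      have k1: "keys_ok k X K G S \<longrightarrow> keys_ok k (X(i := ?Xi)) (K(i := ?Ki)) (G'(f := Suc (G' f))) S"
        using kj keys_add[OF _ i f, of k ?X ?K G' S] by simp
      have "r1 13 = k" using c1 by (simp add: const_regs_def)
      have B: "B - j = Suc (B - Suc j)" using jB by simp
      show "wp (Blk [Sub 18 18 13]) r1 (\<lambda>r2 u2. \<exists>g'. I g' r2 \<and>
        Suc (u + u2) + (case g' of (Xi, Ki, G', j) \<Rightarrow> (10 * m + 22) * (B - j))
        \<le> (case g of (Xi, Ki, G', j) \<Rightarrow> (10 * m + 22) * (B - j)))"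
      proof (rule wp_Blk)
        let ?r = "effects [Sub 18 18 13] r1"
        have r: "?r = r1(18 := s 18 - k)" using \<open>r1 13 = k\<close> pr by simp
        have "I (?Xi, ?Ki, G'(f := Suc (G' f)), Suc j) ?r" unfolding I_def prod.case r
        proof (intro conjI)
          show "const_regs k (r1(18 := s 18 - k))" using c1 by simp
          show "heap k (X(i := ?Xi)) (K(i := ?Ki)) (G'(f := Suc (G' f))) S Q (r1(18 := s 18 - k))"
            using h1 by simp
          show "\<forall>p<64. p < 18 \<or> 25 < p \<longrightarrow> (r1(18 := s 18 - k)) p = r p" using J pr by simp
          show "(r1(18 := s 18 - k)) 18 = q - of_nat (Suc j) * k" using s18 by (simp add: algebra_simps)
          show "(\<Sum>e<m. ?Xi e) = (\<Sum>e<m. X i e) + Suc j" using sX J by simp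
          show "(\<Sum>e<m. (G'(f := Suc (G' f))) e) = (\<Sum>e<m. G e) + Suc j" using sG J by simp
          show "0 < Suc j \<longrightarrow> M - k < (r1(18 := s 18 - k)) 18" using lt s by simp
        qed (use jB n1 r1 k1 in simp_all)
        then show "\<exists>g'. I g' ?r \<and>
            Suc (u + costs [Sub 18 18 13]) + (case g' of (Xi, Ki, G', j) \<Rightarrow> (10 * m + 22) * (B - j))
            \<le> (case g of (Xi, Ki, G', j) \<Rightarrow> (10 * m + 22) * (B - j))"
          using u unfolding g prod.case B
          by (intro exI[of _ "(?Xi, ?Ki, G'(f := Suc (G' f)), Suc j)"]) simp
      qed simp
    qed
  next
    fix g s u assume Ig: "I g s" and lt: "\<not> s 14 < s 18"
      and u: "u + (case g of (Xi, Ki, G', j) \<Rightarrow> (10 * m + 22) * (B - j))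
        \<le> Suc (case (X i, K i, G, 0) of (Xi, Ki, G', j) \<Rightarrow> (10 * m + 22) * (B - j))"
    obtain Xi Ki G' j where g: "g = (Xi, Ki, G', j)" by (cases g) auto
    note J = Ig[unfolded g I_def prod.case]
    have s18: "s 18 \<le> M" using lt J M by auto
    have "best_response m (\<lambda>e. a i e * k) Xi Ki"
    proof (rule ccontr)
      assume n: "\<not> ?thesis"
      then have "of_nat m * k \<le> of_nat j * k" using J s18 by auto
      then have "m \<le> j" using kp by simp
      then show False using n near_response_ge[of m _ Xi Ki j] J by simp
    qed
    moreover have "u \<le> B * (10 * m + 22) + 1" using u unfolding g prod.case by (simp add: mult.commute)
    ultimately show "u \<le> B * (10 * m + 22) + 1 \<and>
    (\<exists>Xi Ki G' j. const_regs k s \<and> heap k (X(i := Xi)) (K(i := Ki)) G' S Q s \<and>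
      (\<forall>p<64. p < 18 \<or> 25 < p \<longrightarrow> s p = r p) \<and> s 18 = q - of_nat j * k \<and> s 18 \<le> M \<and>
      j \<le> B \<and> best_response m (\<lambda>e. a i e * k) Xi Ki \<and> (\<Sum>e<m. Xi e) = (\<Sum>e<m. X i e) + j \<and>
      (j = 0 \<longrightarrow> Xi = X i) \<and> (0 < j \<longrightarrow> M - k < s 18) \<and>
      (\<Sum>e<m. G' e) = (\<Sum>e<m. G e) + j \<and>
      (keys_ok k X K G S \<longrightarrow> keys_ok k (X(i := Xi)) (K(i := Ki)) G' S))"
      apply -
      apply (rule conjI, assumption)
      apply (rule exI[of _ Xi], rule exI[of _ Ki], rule exI[of _ G'], rule exI[of _ j])
      by (insert J s18, elim conjE, intro conjI; assumption)
  qed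
qed


definition filled :: "rat \<Rightarrow> rat \<Rightarrow> (nat \<Rightarrow> nat \<Rightarrow> nat) \<Rightarrow> (nat \<Rightarrow> rat) \<Rightarrow>
    (nat \<Rightarrow> nat \<Rightarrow> nat) \<Rightarrow> (nat \<Rightarrow> nat \<Rightarrow> rat) \<Rightarrow> (nat \<Rightarrow> rat) \<Rightarrow> nat \<Rightarrow> bool" where
  "filled k M X Q X' K' Q' i \<longleftrightarrow> best_response m (\<lambda>e. a i e * k) (X' i) (K' i) \<and> Q' i \<le> M \<and>
     (X' i = X i \<and> Q' i = Q i \<or> M - k < Q' i)"

definition demand_left :: "rat \<Rightarrow> (nat \<Rightarrow> nat \<Rightarrow> nat) \<Rightarrow> (nat \<Rightarrow> rat) \<Rightarrow> bool" where
  "demand_left k X Q \<longleftrightarrow> (\<forall>i<n. Q i = d i - of_nat (\<Sum>e<m. X i e) * k)"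

lemma fill_wp:
  assumes kp: "k > 0" and c0: "const_regs k r" and h0: "heap k X K G S Q r" and M: "r 14 = M"
    and ks: "keys_ok k X K G S" and dm: "demand_left k X Q"
    and nr: "\<And>i. i < n \<Longrightarrow> near_response m (\<lambda>e. a i e * k) (X i) (K i) 0"
    and rs: "\<And>i. i < n \<Longrightarrow> best_response m (\<lambda>e. a i e * k) (X i) (K i) \<or> M + of_nat m * k \<le> Q i"
    and qb: "\<And>i. i < n \<Longrightarrow> Q i \<le> M + of_nat B * k"
  shows "wp fill r (\<lambda>r' u. u \<le> n * (B * (10 * m + 22) + 6) + 2 \<and>
    (\<exists>X' K' G' Q'. const_regs k r' \<and> heap k X' K' G' S Q' r' \<and> r' 14 = r 14 \<and> r' 15 = r 15 \<and>
      keys_ok k X' K' G' S \<and> demand_left k X' Q' \<and> (\<forall>i<n. filled k M X Q X' K' Q' i) \<and>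
      (\<Sum>e<m. G' e) \<le> (\<Sum>e<m. G e) + n * B))"
proof -
  define I where "I = (\<lambda>(i, X', K', G', Q') r'. const_regs k r' \<and> heap k X' K' G' S Q' r' \<and>
      r' 14 = r 14 \<and> r' 15 = r 15 \<and> r' 17 = of_nat i \<and> r' 16 = of_nat (bA + i * m) \<and> i \<le> n \<and>
      keys_ok k X' K' G' S \<and> demand_left k X' Q' \<and> (\<forall>i'<i. filled k M X Q X' K' Q' i') \<and>
      (\<forall>i'\<ge>i. X' i' = X i' \<and> K' i' = K i' \<and> Q' i' = Q i') \<and>
      (\<Sum>e<m. G' e) \<le> (\<Sum>e<m. G e) + i * B)"
  let ?C = "B * (10 * m + 22) + 6"
  let ?\<phi> = "\<lambda>(i, X', K', G', Q'). ?C * (n - i)"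
  show ?thesis unfolding fill_def
  proof (rule wp_Seq, rule wp_Blk, simp, rule wp_While[where I = I and g = "(0, X, K, G, Q)" and \<phi> = ?\<phi>])
    show "I (0, X, K, G, Q) (effects [Const 17 0, Add 16 10 8] r)"
      unfolding I_def prod.case using c0 h0 ks dm by (simp add: const_regs_def)
  next
    fix g s assume Ig: "I g s" and lt: "s 17 < s 3"
    obtain i X' K' G' Q' where g: "g = (i, X', K', G', Q')" by (cases g) auto
    note J = Ig[unfolded g I_def prod.case]
    have cs: "const_regs k s" and hs: "heap k X' K' G' S Q' s" and same: "X' i = X i" "K' i = K i" "Q' i = Q i"
      and s16: "s 16 = of_nat (bA + i * m)" and s17: "s 17 = of_nat i"
      using J by simp_all
    have i: "i < n" using lt J by (simp add: const_regs_def)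
    have l: "nat \<lfloor>s 9 + s 17\<rfloor> = bD + i" using cs s17 by (intro nat_floor_eq) (simp add: const_regs_def)
    have rd: "s (bD + i) = Q i" using heap_read(6)[OF hs i, of 0] m_pos same by simp
    have ne: "bD + i \<noteq> 26" "bD + i \<noteq> 18" "bD + i > 63" using bD_ge by auto
    let ?s = "s(26 := s 9 + s 17, 18 := Q i)"
    have e: "effects [Add 26 9 17, Load 18 26] s = ?s" by (simp add: l rd ne)
    have c1: "const_regs k ?s" and h1: "heap k X' K' G' S Q' ?s" using cs hs by simp_all
    show "wp (Blk [Add 26 9 17, Load 18 26] ;; fill_player ;; Blk [Store 18 26, Add 16 16 4, Add 17 17 7]) s
        (\<lambda>r' u. \<exists>g'. I g' r' \<and> Suc u + ?\<phi> g' \<le> ?\<phi> g)"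
    proof (rule wp_Seq, rule wp_Blk, simp, unfold e, rule wp_Seq, rule wp_mono[OF fill_player_wp[OF kp c1 h1 i, of "Q i" M B]],
        goal_cases)
      case 1 then show ?case using s16 by simp
    next
      case 2 then show ?case by simp
    next
      case 3 then show ?case using J M by simp
    next
      case 4 then show ?case using nr[OF i] same by simp
    next
      case 5 then show ?case using rs[OF i] same by simp
    next
      case 6 then show ?case using qb[OF i] .
    next
      case (7 r1 u)
      then obtain Xi Ki G1 j where u: "u \<le> B * (10 * m + 22) + 1" and c2: "const_regs k r1"
        and h2: "heap k (X'(i := Xi)) (K'(i := Ki)) G1 S Q' r1"
        and pr: "\<forall>p<64. p < 18 \<or> 25 < p \<longrightarrow> r1 p = ?s p" and q: "r1 18 = Q i - of_nat j * k" "r1 18 \<le> M"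
        and j: "j \<le> B" and rp: "best_response m (\<lambda>e. a i e * k) Xi Ki"
        and sX: "(\<Sum>e<m. Xi e) = (\<Sum>e<m. X' i e) + j"
        and j0: "j = 0 \<longrightarrow> Xi = X' i" "0 < j \<longrightarrow> M - k < r1 18"
        and sG: "(\<Sum>e<m. G1 e) = (\<Sum>e<m. G' e) + j"
        and k1: "keys_ok k (X'(i := Xi)) (K'(i := Ki)) G1 S"
        using J by blast
      have r1v: "r1 26 = s 9 + s 17" "r1 16 = s 16" "r1 17 = s 17" "r1 14 = s 14" "r1 15 = s 15"
        using pr by simp_all
      have r1c: "r1 4 = of_nat m" "r1 7 = 1" using c2 by (simp_all add: const_regs_def)
      let ?q = "r1 18"
      let ?r = "r1(bD + i := ?q, 16 := s 16 + of_nat m, 17 := s 17 + 1)"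
      have e2: "effects [Store 18 26, Add 16 16 4, Add 17 17 7] r1 = ?r"
        using ne by (simp add: r1v l r1c)
      have "I (Suc i, X'(i := Xi), K'(i := Ki), G1, Q'(i := ?q)) ?r"
        unfolding I_def prod.case
      proof (intro conjI)
        show "const_regs k ?r" using c2 ne by simp
        show "heap k (X'(i := Xi)) (K'(i := Ki)) G1 S (Q'(i := ?q)) ?r"
          using heap_Q[OF h2 i, of ?q] by simp
        show "?r 14 = r 14" "?r 15 = r 15" using r1v J ne by simp_all
        show "?r 17 = of_nat (Suc i)" using s17 by simp
        show "?r 16 = of_nat (bA + Suc i * m)" using s16 by simp
        show "keys_ok k (X'(i := Xi)) (K'(i := Ki)) G1 S" by (rule k1)
        have "Q i = d i - of_nat (\<Sum>e<m. X' i e) * k" using J i same unfolding demand_left_def by metis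
        then have "?q = d i - of_nat (\<Sum>e<m. Xi e) * k" unfolding q sX by (simp add: algebra_simps)
        then show "demand_left k (X'(i := Xi)) (Q'(i := ?q))" using J unfolding demand_left_def by simp
        show "\<forall>i'<Suc i. filled k M X Q (X'(i := Xi)) (K'(i := Ki)) (Q'(i := ?q)) i'"
        proof (intro allI impI)
          fix i' assume i': "i' < Suc i"
          show "filled k M X Q (X'(i := Xi)) (K'(i := Ki)) (Q'(i := ?q)) i'"
          proof (cases "i' = i")
            case True
            then show ?thesis using rp q j0 same unfolding filled_def by (cases "j = 0") simp_all
          next
            case False
            then have "filled k M X Q X' K' Q' i'" using J i' by simp
            with False show ?thesis unfolding filled_def by simp
          qed
        qed
        show "\<forall>i'\<ge>Suc i. (X'(i := Xi)) i' = X i' \<and> (K'(i := Ki)) i' = K i' \<and> (Q'(i := ?q)) i' = Q i'"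
          using J by simp
        show "(\<Sum>e<m. G1 e) \<le> (\<Sum>e<m. G e) + Suc i * B" using J j unfolding sG by simp
      qed (use i in simp)
      then have I': "I (Suc i, X'(i := Xi), K'(i := Ki), G1, Q'(i := ?q))
          (effects [Store 18 26, Add 16 16 4, Add 17 17 7] r1)" unfolding e2 .
      have ni: "n - i = Suc (n - Suc i)" using i by simp
      show ?case
        apply (rule wp_Blk)
         apply simp
        apply (rule exI, rule conjI, rule I')
        using u unfolding g prod.case ni by simp
    qed
  next
    fix g s u assume Ig: "I g s" and lt: "\<not> s 17 < s 3"
      and u: "u + ?\<phi> g \<le> Suc (?\<phi> (0, X, K, G, Q))"
    obtain i X' K' G' Q' where g: "g = (i, X', K', G', Q')" by (cases g) auto
    note J = Ig[unfolded g I_def prod.case]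
    have i: "i = n" using lt J by (simp add: const_regs_def)
    have u': "costs [Const 17 0, Add 16 10 8] + u \<le> n * ?C + 2" using u i unfolding g prod.case by (simp add: mult.commute)
    show "costs [Const 17 0, Add 16 10 8] + u \<le> n * ?C + 2 \<and>
    (\<exists>X' K' G' Q'. const_regs k s \<and> heap k X' K' G' S Q' s \<and> s 14 = r 14 \<and> s 15 = r 15 \<and>
      keys_ok k X' K' G' S \<and> demand_left k X' Q' \<and> (\<forall>i<n. filled k M X Q X' K' Q' i) \<and>
      (\<Sum>e<m. G' e) \<le> (\<Sum>e<m. G e) + n * B)"
      apply (rule conjI, rule u')
      apply (rule exI[of _ X'], rule exI[of _ K'], rule exI[of _ G'], rule exI[of _ Q'])
      using J unfolding i by simp
  qed
qed

section \<open>Raising prices: keys, invariant, and the number of raises\<close>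

lemma keys_remove:
  assumes ks: "keys_ok k X K G S" and i: "i < n" and e: "e < m"
    and S: "S e = i" and X: "X i e = Suc z" and G: "G e = Suc g"
  shows "keys_ok k (X(i := (X i)(e := z))) K (G(e := g)) (S(e := Suc i))"
  unfolding keys_ok_def
proof (intro allI impI)
  fix i' e' assume i': "i' < n" and e': "e' < m"
  let ?X = "X(i := (X i)(e := z))"
  have K: "K i' e' = key k X G S i' e'" using ks i' e' unfolding keys_ok_def by blast
  have "(\<Sum>i<n. ?X i e') + X i e' = (\<Sum>i<n. X i e') + ((X i)(e := z)) e'"
    by (rule sum_upd_row[OF i])
  then have s: "(\<Sum>i<n. X i e') = (\<Sum>i<n. ?X i e') + (if e' = e then 1 else 0)"
    using X by (auto split: if_splits)
  show "K i' e' = key k ?X (G(e := g)) (S(e := Suc i)) i' e'"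
    unfolding K unfolding key_def s using S X G by (auto simp: less_Suc_eq)
qed

lemma keys_raise:
  assumes ks: "keys_ok k X K G S" and i: "i < n" and e: "e < m" and S: "S e = i"
  shows "keys_ok k X (K(i := (K i)(e := K i e + a i e * k))) G (S(e := Suc i))"
  unfolding keys_ok_def
proof (intro allI impI)
  fix i' e' assume i': "i' < n" and e': "e' < m"
  have K: "K i' e' = key k X G S i' e'" using ks i' e' unfolding keys_ok_def by blast
  show "(K(i := (K i)(e := K i e + a i e * k))) i' e' = key k X G (S(e := Suc i)) i' e'"
    using K S unfolding key_def by (auto simp: less_Suc_eq algebra_simps)
qed

text \<open>An offset of one packet shown to all players is the same as a price higher by one
  packet.\<close>

lemma keys_wrap:
  assumes ks: "keys_ok k X K G S" and S: "S e = n" and G: "G e = Suc g"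
  shows "keys_ok k X K (G(e := g)) (S(e := 0))"
  using ks S G unfolding keys_ok_def key_def by simp

definition best_responses :: "rat \<Rightarrow> (nat \<Rightarrow> nat \<Rightarrow> nat) \<Rightarrow> (nat \<Rightarrow> nat \<Rightarrow> rat) \<Rightarrow> bool" where
  "best_responses k X K \<longleftrightarrow> (\<forall>i<n. best_response m (\<lambda>e. a i e * k) (X i) (K i))"

text \<open>A removed packet is re-inserted, so the sum of the gaps is kept and only the gap of
  \<open>e\<close> can shrink, by at most one. If the player does not use \<open>e\<close>, her key
  there grows, which merely relaxes the exchange condition.\<close>

lemma raise_step_wp:
  assumes kp: "k > 0" and c0: "const_regs k r" and h0: "heap k X K G S Q r" and e: "e < m"
    and r17: "r 17 = of_nat e" and r26: "r 26 = of_nat (bG + e)" and r27: "r 27 = of_nat (G e) * k"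
    and r28: "r 28 = of_nat (bS + e)" and r29: "r 29 = of_nat (S e)"
    and ks: "keys_ok k X K G S" and rs: "best_responses k X K" and dm: "demand_left k X Q"
    and i: "S e < n" and G: "0 < G e"
  shows "wp raise_step r (\<lambda>r' u. u \<le> 10 * m + 30 \<and>
    (\<exists>X' K' G'. const_regs k r' \<and> heap k X' K' G' (S(e := Suc (S e))) Q r' \<and>
      (\<forall>p\<in>{14, 15, 26, 28}. r' p = r p) \<and> r' 29 = of_nat (Suc (S e)) \<and>
      keys_ok k X' K' G' (S(e := Suc (S e))) \<and> best_responses k X' K' \<and> demand_left k X' Q \<and>
      (\<Sum>e<m. G' e) = (\<Sum>e<m. G e) \<and> G e \<le> Suc (G' e) \<and> (\<forall>f. f \<noteq> e \<longrightarrow> G f \<le> G' f)))"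
proof -
  define i where "i = S e"
  have i: "i < n" using assms i_def by simp
  have S: "S e = i" by (simp add: i_def)
  have cr: "r 3 = of_nat n" "r 4 = of_nat m" "r 5 = of_nat (n * m)" "r 7 = 1" "r 8 = 0"
    "r 10 = of_nat bA" "r 13 = k"
    using c0 by (simp_all add: const_regs_def)
  define pa where "pa = bA + (i * m + e)"
  define pk where "pk = bA + n * m + (i * m + e)"
  define px where "px = bA + 2 * (n * m) + (i * m + e)"
  define ps where "ps = bS + e"
  define pg where "pg = bG + e"
  have big: "pa > 63" "pk > 63" "px > 63" "ps > 63" "pg > 63"
    using bD_ge unfolding pa_def pk_def px_def ps_def pg_def bases by auto
  have dis: "px \<noteq> ps" "pg \<noteq> ps" "pa \<noteq> ps" "pk \<noteq> ps" "px \<noteq> pg"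
    using idx_less[OF i e] idx_less'[OF i e] m_pos unfolding pa_def pk_def px_def ps_def pg_def bases by auto
  have rd: "r pa = a i e" "r pk = K i e" "r px = of_nat (X i e) * k"
    using heap_read[OF h0 i e] unfolding pa_def pk_def px_def by auto
  let ?r1 = "r(16 := of_nat (bA + i * m), 30 := of_nat pa, 31 := of_nat pk, 32 := of_nat px,
      34 := of_nat (X i e) * k, 29 := of_nat (Suc i), ps := of_nat (Suc i))"
  have e1: "effects [Mul 16 29 4, Add 16 16 10, Add 30 16 17, Add 31 30 5, Add 32 31 5, Load 34 32,
          Add 29 29 7, Store 29 28] r = ?r1"
  proof -
    have v: "of_nat i * of_nat m + of_nat bA = (of_nat (bA + i * m) :: rat)"
      "of_nat (bA + i * m) + of_nat e = (of_nat pa :: rat)"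
      "of_nat pa + of_nat (n * m) = (of_nat pk :: rat)"
      "of_nat pk + of_nat (n * m) = (of_nat px :: rat)"
      "of_nat i + 1 = (of_nat (Suc i) :: rat)"
      unfolding pa_def pk_def px_def by simp_all
    have f: "nat \<lfloor>r 28\<rfloor> = ps" unfolding r28 ps_def by (rule nat_floor_eq) simp
    have r29': "r 29 = of_nat i" using r29 S by simp
    have b: "px \<noteq> 16" "px \<noteq> 30" "px \<noteq> 31" "px \<noteq> 32" using big by auto
    show ?thesis
      by (simp add: v f cr r29' r17 b rd del: of_nat_add of_nat_mult of_nat_Suc)
  qed
  have c1: "const_regs k ?r1" using c0 big by simp
  let ?S = "S(e := Suc i)"
  have h1: "heap k X K G ?S Q ?r1"
    unfolding ps_def using h0 e by (intro heap_S) auto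
  have r1: "?r1 8 = 0" "?r1 34 = of_nat (X i e) * k" using cr big by simp_all
  show ?thesis
    unfolding raise_step_def
  proof (rule wp_Seq, rule wp_Blk, simp, unfold e1, rule wp_IfLt)
    assume "?r1 8 < ?r1 34"
    then have "0 < X i e" unfolding r1 using kp by (simp add: zero_less_mult_iff)
    then obtain z where z: "X i e = Suc z" using gr0_implies_Suc by blast
    obtain g where g: "G e = Suc g" using G gr0_implies_Suc by blast
    let ?X = "X(i := (X i)(e := z))" and ?G = "G(e := g)"
    let ?r2 = "?r1(34 := of_nat z * k, px := of_nat z * k, 27 := of_nat g * k, pg := of_nat g * k)"
    have e2: "effects [Sub 34 34 13, Store 34 32, Sub 27 27 13, Store 27 26] ?r1 = ?r2"
    proof -
      have v: "of_nat (X i e) * k - k = of_nat z * k" "of_nat (G e) * k - k = of_nat g * k"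
        unfolding z g by (simp_all add: algebra_simps)
      have f: "nat \<lfloor>r 26\<rfloor> = pg" unfolding r26 pg_def by (rule nat_floor_eq) simp
      have b: "ps \<noteq> 34" "ps \<noteq> 32" "ps \<noteq> 27" "ps \<noteq> 26" "ps \<noteq> 13" "px \<noteq> 34" "px \<noteq> 13" "px \<noteq> 26" "px \<noteq> 27"
          "pg \<noteq> 27" using big by auto
      show ?thesis
        by (simp add: v f cr r27 b)
    qed
    have c2: "const_regs k ?r2" using c1 big by simp
    have h2: "heap k ?X K ?G ?S Q ?r2"
    proof -
      have "heap k X K G ?S Q (?r1(34 := of_nat z * k))"
        by (rule heap_reg[THEN iffD2, OF _ h1]) simp
      from heap_X[OF this i e refl, folded px_def]
      have h: "heap k ?X K G ?S Q (?r1(34 := of_nat z * k, px := of_nat z * k))" .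
      have "heap k ?X K G ?S Q (?r1(34 := of_nat z * k, px := of_nat z * k, 27 := of_nat g * k))"
        by (rule heap_reg[THEN iffD2, OF _ h]) simp
      from heap_G[OF this e refl, folded pg_def] show ?thesis .
    qed
    have row: "?r2 16 = of_nat (bA + i * m)" using big by simp
    show "wp (Blk [Sub 34 34 13, Store 34 32, Sub 27 27 13, Store 27 26] ;; greedy) ?r1
      (\<lambda>r' u. costs [Mul 16 29 4, Add 16 16 10, Add 30 16 17, Add 31 30 5, Add 32 31 5, Load 34 32,
          Add 29 29 7, Store 29 28] + Suc u \<le> 10 * m + 30 \<and>
    (\<exists>X' K' G'. const_regs k r' \<and> heap k X' K' G' (S(e := Suc (S e))) Q r' \<and>
      (\<forall>p\<in>{14, 15, 26, 28}. r' p = r p) \<and> r' 29 = of_nat (Suc (S e)) \<and>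
      keys_ok k X' K' G' (S(e := Suc (S e))) \<and> best_responses k X' K' \<and> demand_left k X' Q \<and>
      (\<Sum>e<m. G' e) = (\<Sum>e<m. G e) \<and> G e \<le> Suc (G' e) \<and> (\<forall>f. f \<noteq> e \<longrightarrow> G f \<le> G' f)))"
    proof (rule wp_Seq, rule wp_Blk, simp, unfold e2, rule wp_mono[OF greedy_wp[OF c2 h2 i row]], elim conjE exE)
      fix r3 u f
      assume u: "u \<le> 10 * m + 20" and am: "greedy_choice m (\<lambda>e. a i e * k) (K i) f"
        and c3: "const_regs k r3"
        and h3: "heap k (?X(i := (?X i)(f := Suc (?X i f)))) (K(i := (K i)(f := K i f + a i f * k)))
          (?G(f := Suc (?G f))) ?S Q r3"
        and pr: "\<forall>p<64. p < 19 \<or> 25 < p \<longrightarrow> r3 p = ?r2 p"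
      have f: "f < m" using am unfolding greedy_choice_def by simp
      let ?X3 = "?X(i := (?X i)(f := Suc (?X i f)))" and ?K3 = "K(i := (K i)(f := K i f + a i f * k))"
        and ?G3 = "?G(f := Suc (?G f))"
      have k2: "keys_ok k ?X K ?G ?S" by (rule keys_remove[OF ks i e S z g])
      have k3: "keys_ok k ?X3 ?K3 ?G3 ?S" by (rule keys_add[OF k2 i f])
      have ap: "0 < a i e * k" if "e < m" for e using a_pos[OF i that] kp by simp
      have rsi: "best_response m (\<lambda>e. a i e * k) (X i) (K i)" using rs i unfolding best_responses_def by blast
      \<comment> \<open>The keys are those of before the removal, and fewer packets mean fewer used
        keys to bound.\<close>
      then have "best_response m (\<lambda>e. a i e * k) (?X i) (K i)"
        using z unfolding best_response_def by auto
      from best_response_add[OF this am ap] have rsi': "best_response m (\<lambda>e. a i e * k) (?X3 i) (?K3 i)"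
        by simp
      have rs3: "best_responses k ?X3 ?K3" unfolding best_responses_def
      proof (intro allI impI)
        fix i' assume "i' < n"
        then show "best_response m (\<lambda>e. a i' e * k) (?X3 i') (?K3 i')"
          using rs rsi' unfolding best_responses_def by (cases "i' = i") simp_all
      qed
      have "(\<Sum>e<m. ?X i e) + 1 = (\<Sum>e<m. X i e)"
        using e z by (simp add: sum.remove[of "{..<m}" e])
      moreover have "(\<Sum>e<m. ?X3 i e) = (\<Sum>e<m. ?X i e) + 1"
        using f by (simp add: sum.remove[of "{..<m}" f])
      ultimately have sx: "(\<Sum>e<m. ?X3 i e) = (\<Sum>e<m. X i e)" by linarith
      have dm3: "demand_left k ?X3 Q" unfolding demand_left_def
      proof (intro allI impI)
        fix i' assume i': "i' < n"
        have "(\<Sum>e<m. ?X3 i' e) = (\<Sum>e<m. X i' e)" using sx by (cases "i' = i") simp_all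
        then show "Q i' = d i' - of_nat (\<Sum>e<m. ?X3 i' e) * k" using dm i' unfolding demand_left_def by presburger
      qed
      have "(\<Sum>e<m. ?G e) + 1 = (\<Sum>e<m. G e)"
        using e g by (simp add: sum.remove[of "{..<m}" e])
      moreover have "(\<Sum>e<m. ?G3 e) = (\<Sum>e<m. ?G e) + 1"
        using f by (simp add: sum.remove[of "{..<m}" f])
      ultimately have sg: "(\<Sum>e<m. ?G3 e) = (\<Sum>e<m. G e)" by linarith
      have gm: "G e \<le> Suc (?G3 e)" "\<forall>f. f \<noteq> e \<longrightarrow> G f \<le> ?G3 f" using g by auto
      have p3: "\<forall>p\<in>{14, 15, 26, 28}. r3 p = r p" "r3 29 = of_nat (Suc i)"
        using pr big by simp_all
      show "costs [Mul 16 29 4, Add 16 16 10, Add 30 16 17, Add 31 30 5, Add 32 31 5, Load 34 32,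
          Add 29 29 7, Store 29 28] + Suc (costs [Sub 34 34 13, Store 34 32, Sub 27 27 13, Store 27 26] + u)
          \<le> 10 * m + 30 \<and>
        (\<exists>X' K' G'. const_regs k r3 \<and> heap k X' K' G' (S(e := Suc (S e))) Q r3 \<and>
        (\<forall>p\<in>{14, 15, 26, 28}. r3 p = r p) \<and> r3 29 = of_nat (Suc (S e)) \<and>
        keys_ok k X' K' G' (S(e := Suc (S e))) \<and> best_responses k X' K' \<and> demand_left k X' Q \<and>
        (\<Sum>e<m. G' e) = (\<Sum>e<m. G e) \<and> G e \<le> Suc (G' e) \<and> (\<forall>f. f \<noteq> e \<longrightarrow> G f \<le> G' f))"
        apply (rule conjI)
        subgoal using u by simp
        apply (rule exI[of _ ?X3], rule exI[of _ ?K3], rule exI[of _ ?G3])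
        unfolding S by (intro conjI c3 h3 p3 k3 rs3 dm3 sg gm)
    qed
  next
    assume "\<not> ?r1 8 < ?r1 34"
    then have z: "X i e = 0" unfolding r1 using kp by (simp add: zero_less_mult_iff)
    let ?v = "K i e + a i e * k"
    let ?K = "K(i := (K i)(e := ?v))"
    let ?r2 = "?r1(33 := a i e * k, 34 := ?v, pk := ?v)"
    have e2: "effects [Load 33 30, Mul 33 33 13, Load 34 31, Add 34 34 33, Store 34 31] ?r1 = ?r2"
    proof -
      have b: "ps \<noteq> 30" "ps \<noteq> 31" "ps \<noteq> 33" "ps \<noteq> 34" "ps \<noteq> 13"
        "pa \<noteq> 16" "pa \<noteq> 29" "pa \<noteq> 30" "pa \<noteq> 31" "pa \<noteq> 32" "pa \<noteq> 33" "pa \<noteq> 34"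
        "pk \<noteq> 16" "pk \<noteq> 29" "pk \<noteq> 30" "pk \<noteq> 31" "pk \<noteq> 32" "pk \<noteq> 33" "pk \<noteq> 34"
        using big by auto
      show ?thesis by (simp add: cr b dis rd)
    qed
    have c2: "const_regs k ?r2" using c1 big by simp
    have h2: "heap k X ?K G ?S Q ?r2"
    proof -
      have "heap k X K G ?S Q (?r1(33 := a i e * k))"
        by (rule heap_reg[THEN iffD2, OF _ h1]) simp
      then have "heap k X K G ?S Q (?r1(33 := a i e * k, 34 := ?v))"
        by (rule heap_reg[THEN iffD2, rotated]) simp
      from heap_K[OF this i e, folded pk_def] show ?thesis .
    qed
    have k2: "keys_ok k X ?K G ?S" by (rule keys_raise[OF ks i e S])
    have rs2: "best_responses k X ?K" unfolding best_responses_def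
    proof (intro allI impI)
      fix i' assume i': "i' < n"
      have ri: "best_response m (\<lambda>e. a i' e * k) (X i') (K i')" using rs i' unfolding best_responses_def by blast
      show "best_response m (\<lambda>e. a i' e * k) (X i') (?K i')"
      proof (cases "i' = i")
        case True
        have "0 < a i e * k" using a_pos[OF i e] kp by simp
        then have up: "K i f \<le> ?K i f" for f by simp
        show ?thesis unfolding best_response_def
        proof (intro allI impI)
          fix e' f assume *: "e' < m" "f < m" "0 < X i' e'"
          then have "K i e' \<le> K i f + a i f * k" using ri True unfolding best_response_def by blast
          moreover have "?K i e' = K i e'" using * z True by auto
          ultimately show "?K i' e' \<le> ?K i' f + a i' f * k" using up[of f] unfolding True by linarith
        qed
      qed (use ri in simp)
    qed
    have p2: "\<forall>p\<in>{14, 15, 26, 28}. ?r2 p = r p" "?r2 29 = of_nat (Suc i)"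
      using big by simp_all
    show "wp (Blk [Load 33 30, Mul 33 33 13, Load 34 31, Add 34 34 33, Store 34 31]) ?r1
      (\<lambda>r' u. costs [Mul 16 29 4, Add 16 16 10, Add 30 16 17, Add 31 30 5, Add 32 31 5, Load 34 32,
          Add 29 29 7, Store 29 28] + Suc u \<le> 10 * m + 30 \<and>
    (\<exists>X' K' G'. const_regs k r' \<and> heap k X' K' G' (S(e := Suc (S e))) Q r' \<and>
      (\<forall>p\<in>{14, 15, 26, 28}. r' p = r p) \<and> r' 29 = of_nat (Suc (S e)) \<and>
      keys_ok k X' K' G' (S(e := Suc (S e))) \<and> best_responses k X' K' \<and> demand_left k X' Q \<and>
      (\<Sum>e<m. G' e) = (\<Sum>e<m. G e) \<and> G e \<le> Suc (G' e) \<and> (\<forall>f. f \<noteq> e \<longrightarrow> G f \<le> G' f)))"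
    proof (rule wp_Blk, simp, unfold e2, rule conjI, goal_cases)
      case 1 show ?case by simp
    next
      case 2 show ?case
        apply (rule exI[of _ X], rule exI[of _ ?K], rule exI[of _ G])
        unfolding S by (intro conjI c2 h2 p2 k2 rs2 dm) simp_all
    qed
  qed
qed


text \<open>\<open>0 < S e\<close> marks a round in progress. It began at a gap above
  \<open>N\<close> and lost at most one packet per raise, whence
  \<open>N + 1 \<le> G e + S e\<close>. For \<open>N = n\<close> this and \<open>S e < n\<close>
  force a gap of at least 2, so the round cannot get stuck; for \<open>N = 1\<close> it may rest at
  gap 1.\<close>

definition ascend_inv :: "nat \<Rightarrow> rat \<Rightarrow> (nat \<Rightarrow> nat \<Rightarrow> nat) \<Rightarrow> (nat \<Rightarrow> nat \<Rightarrow> rat) \<Rightarrow> (nat \<Rightarrow> nat) \<Rightarrow>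
    (nat \<Rightarrow> nat) \<Rightarrow> bool" where
  "ascend_inv N k X K G S \<longleftrightarrow> keys_ok k X K G S \<and> best_responses k X K \<and>
     (\<forall>e<m. S e < n \<and> (0 < S e \<longrightarrow> 1 \<le> G e \<and> N + 1 \<le> G e + S e))"

text \<open>The number of raises still possible. A raise keeps the sum of the gaps and advances one
  counter; completing a round exchanges \<open>n\<close> counter steps for one packet of gap, at no
  change of the potential.\<close>

definition potential :: "(nat \<Rightarrow> nat) \<Rightarrow> (nat \<Rightarrow> nat) \<Rightarrow> nat" where
  "potential G S = n * (\<Sum>e<m. G e) - (\<Sum>e<m. S e)"

lemma raise_wp:
  assumes kp: "k > 0" and c0: "const_regs k r" and h0: "heap k X K G S Q r" and e: "e < m"
    and r17: "r 17 = of_nat e" and r26: "r 26 = of_nat (bG + e)" and r27: "r 27 = of_nat (G e) * k"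
    and r28: "r 28 = of_nat (bS + e)" and r29: "r 29 = of_nat (S e)"
    and ai: "ascend_inv N k X K G S" and dm: "demand_left k X Q" and N: "1 \<le> N"
    and el: "(if S e = 0 then N else 1) < G e"
  shows "wp raise r (\<lambda>r' u. u \<le> 10 * m + 32 \<and>
    (\<exists>X' K' G' S'. const_regs k r' \<and> heap k X' K' G' S' Q r' \<and> r' 14 = r 14 \<and> r' 15 = r 15 \<and>
      r' 17 = 0 \<and> ascend_inv N k X' K' G' S' \<and> demand_left k X' Q \<and> Suc (potential G' S') \<le> potential G S))"
proof -
  have ks: "keys_ok k X K G S" and rs: "best_responses k X K" and
    sp: "\<And>e. e < m \<Longrightarrow> S e < n" and sg: "\<And>e. e < m \<Longrightarrow> 0 < S e \<Longrightarrow> 1 \<le> G e"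
    "\<And>e. e < m \<Longrightarrow> 0 < S e \<Longrightarrow> N + 1 \<le> G e + S e"
    using ai unfolding ascend_inv_def by auto
  have i: "S e < n" using sp[OF e] .
  \<comment> \<open>One packet of the gap may go with the raise and another when the round
    completes; a gap of 2 thus keeps the price at most the load.\<close>
  have Ge: "2 \<le> G e" using el N by (auto split: if_splits)
  then have G0: "0 < G e" by simp
  let ?S = "S(e := Suc (S e))"
  let ?Post = "\<lambda>r' u. u \<le> 10 * m + 32 \<and>
    (\<exists>X' K' G' S'. const_regs k r' \<and> heap k X' K' G' S' Q r' \<and> r' 14 = r 14 \<and> r' 15 = r 15 \<and>
      r' 17 = 0 \<and> ascend_inv N k X' K' G' S' \<and> demand_left k X' Q \<and> Suc (potential G' S') \<le> potential G S)"
  show ?thesis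
    unfolding raise_def
  proof (rule wp_Seq, rule wp_mono[OF raise_step_wp[OF kp c0 h0 e r17 r26 r27 r28 r29 ks rs dm i G0]],
      elim conjE exE)
    fix r1 u1 X1 K1 G1
    assume u1: "u1 \<le> 10 * m + 30" and c1: "const_regs k r1" and h1: "heap k X1 K1 G1 ?S Q r1"
      and p1: "\<forall>p\<in>{14, 15, 26, 28}. r1 p = r p" and r29: "r1 29 = of_nat (Suc (S e))"
      and k1: "keys_ok k X1 K1 G1 ?S" and rs1: "best_responses k X1 K1" and dm1: "demand_left k X1 Q"
      and sG: "(\<Sum>e<m. G1 e) = (\<Sum>e<m. G e)" and Ge1: "G e \<le> Suc (G1 e)"
      and Gf: "\<forall>f. f \<noteq> e \<longrightarrow> G f \<le> G1 f"
    have G1e: "1 \<le> G1 e" using Ge Ge1 by simp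
    have cr: "r1 3 = of_nat n" "r1 8 = 0" "r1 13 = k" using c1 by (simp_all add: const_regs_def)
    have sS: "(\<Sum>e<m. ?S e) = Suc (\<Sum>e<m. S e)"
      using e by (simp add: sum.remove[of "{..<m}" e])
    \<comment> \<open>The truncated subtraction in \<open>potential\<close> is faithful only while
      the counters sum to at most \<open>n\<close> times the gaps.\<close>
    have pw: "?S f \<le> n * G1 f" if f: "f < m" for f
    proof (cases "f = e")
      case True
      have "n \<le> n * G1 e" using G1e by simp
      with i have "Suc (S e) \<le> n * G1 e" by linarith
      then show ?thesis using True by simp
    next
      case False
      show ?thesis
      proof (cases "S f = 0")
        case S: False
        then have "1 \<le> G1 f" using sg(1)[OF f] Gf False by (metis gr0I order_trans)
        then have "n \<le> n * G1 f" by simp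
        with sp[OF f] have "S f \<le> n * G1 f" by linarith
        then show ?thesis using False by simp
      qed (use False in simp)
    qed
    have "(\<Sum>e<m. ?S e) \<le> (\<Sum>e<m. n * G1 e)" by (rule sum_mono) (use pw in auto)
    then have "Suc (\<Sum>e<m. S e) \<le> n * (\<Sum>e<m. G e)"
      unfolding sS sG[symmetric] sum_distrib_left .
    then have pot1: "Suc (potential G1 ?S) = potential G S" unfolding potential_def sS sG by simp
    have old: "S f < n \<and> (0 < S f \<longrightarrow> 1 \<le> G1 f \<and> N + 1 \<le> G1 f + S f)" if "f < m" "f \<noteq> e" for f
      using sp[OF that(1)] sg[OF that(1)] Gf that(2) by (meson add_le_mono1 order_trans)
    show "wp (IfLt 29 3 (Blk []) (Blk [Store 8 28, Load 27 26, Sub 27 27 13, Store 27 26]) ;;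
     Blk [Const 17 0]) r1 (\<lambda>r' u. ?Post r' (u1 + u))"
    proof (rule wp_Seq, rule wp_IfLt)
      assume "r1 29 < r1 3"
      then have lt: "Suc (S e) < n" unfolding r29 cr of_nat_less_iff .
      have ai1: "ascend_inv N k X1 K1 G1 ?S" unfolding ascend_inv_def
      proof (intro conjI k1 rs1 allI impI)
        fix f assume f: "f < m"
        show "?S f < n" using old[OF f] lt by (cases "f = e") simp_all
        assume S: "0 < ?S f"
        show "1 \<le> G1 f" using old[OF f] G1e S by (cases "f = e") simp_all
        show "N + 1 \<le> G1 f + ?S f"
        proof (cases "f = e")
          case True
          show ?thesis
          proof (cases "S e = 0")
            case T: True
            then show ?thesis using el Ge1 True by simp
          next
            case False
            then show ?thesis using sg(2)[OF e] Ge1 True by simp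
          qed
        next
          case False
          then show ?thesis using old[OF f] S by simp
        qed
      qed
      show "wp (Blk []) r1 (\<lambda>r' u. wp (Blk [Const 17 0]) r' (\<lambda>r2 u2. ?Post r2 (u1 + (Suc u + u2))))"
      proof (rule wp_Blk, simp, rule wp_Blk, simp, rule conjI, goal_cases)
        case 1 show ?case using u1 by simp
      next
        case 2 show ?case
          apply (rule exI[of _ X1], rule exI[of _ K1], rule exI[of _ G1], rule exI[of _ ?S])
          using c1 h1 p1 ai1 dm1 pot1 by simp
      qed
    next
      assume "\<not> r1 29 < r1 3"
      then have "\<not> Suc (S e) < n" unfolding r29 cr of_nat_less_iff .
      with i have Sn: "Suc (S e) = n" by simp
      obtain g where g: "G1 e = Suc g" using G1e by (cases "G1 e") auto
      let ?S2 = "?S(e := 0)" and ?G2 = "G1(e := g)"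
      have k2: "keys_ok k X1 K1 ?G2 ?S2" by (rule keys_wrap[OF k1 _ g]) (simp add: Sn)
      have S2: "?S2 f = (if f = e then 0 else S f)" for f by simp
      have ai2: "ascend_inv N k X1 K1 ?G2 ?S2" unfolding ascend_inv_def
      proof (intro conjI k2 rs1 allI impI)
        fix f assume f: "f < m"
        show "?S2 f < n" using old[OF f] i by (cases "f = e") simp_all
        assume S: "0 < ?S2 f"
        then have "f \<noteq> e" by auto
        then show "1 \<le> ?G2 f" "N + 1 \<le> ?G2 f + ?S2 f" using old[OF f] S by simp_all
      qed
      have "(\<Sum>e<m. ?S2 e) + n = (\<Sum>e<m. ?S e)" "(\<Sum>e<m. ?G2 e) + 1 = (\<Sum>e<m. G1 e)"
        using e Sn g by (simp_all add: sum.remove[of "{..<m}" e])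
      then have "potential ?G2 ?S2 = potential G1 ?S" unfolding potential_def
        by (metis Nat.add_diff_assoc2 add.commute add_diff_cancel_right distrib_left mult.right_neutral)
      then have pot2: "Suc (potential ?G2 ?S2) \<le> potential G S" using pot1 by simp
      let ?r = "r1(bS + e := 0, 27 := of_nat g * k, bG + e := of_nat g * k)"
      have big: "bS + e > 63" "bG + e > 63" "bG \<noteq> bS"
        using bD_ge e unfolding bases by auto
      have e2: "effects [Store 8 28, Load 27 26, Sub 27 27 13, Store 27 26] r1 = ?r"
      proof -
        have "r1 26 = of_nat (bG + e)" "r1 28 = of_nat (bS + e)" using p1 r26 r28 by simp_all
        then have f: "nat \<lfloor>r1 26\<rfloor> = bG + e" "nat \<lfloor>r1 28\<rfloor> = bS + e"
          by (metis nat_floor_eq)+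
        have "r1 (bG + e) = of_nat (Suc g) * k" using heap_read(4)[OF h1 i e] g by simp
        then have v: "r1 (bG + e) - k = of_nat g * k" by (simp add: algebra_simps)
        have b: "bS + e \<noteq> 26" "bS + e \<noteq> 27" "bS + e \<noteq> 13" "bG + e \<noteq> 27" using big by auto
        show ?thesis by (simp add: f b cr v big(3))
      qed
      have c2: "const_regs k ?r" using c1 big by simp
      have hS: "heap k X1 K1 G1 ?S2 Q (r1(bS + e := 0))" by (rule heap_S[OF h1 e]) simp
      have "heap k X1 K1 G1 ?S2 Q (r1(bS + e := 0, 27 := of_nat g * k))"
        by (rule heap_reg[THEN iffD2, OF _ hS]) simp
      from heap_G[OF this e refl] have h2: "heap k X1 K1 ?G2 ?S2 Q ?r" .
      have p2: "?r 14 = r 14" "?r 15 = r 15" using p1 big by simp_all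
      show "wp (Blk [Store 8 28, Load 27 26, Sub 27 27 13, Store 27 26]) r1
        (\<lambda>r' u. wp (Blk [Const 17 0]) r' (\<lambda>r2 u2. ?Post r2 (u1 + (Suc u + u2))))"
      proof (rule wp_Blk, simp, unfold e2, rule wp_Blk, simp, rule conjI, goal_cases)
        case 1 show ?case using u1 by simp
      next
        case 2 show ?case
          apply (rule exI[of _ X1], rule exI[of _ K1], rule exI[of _ ?G2], rule exI[of _ ?S2])
          using c2 h2 p2 ai2 dm1 pot2 by simp
      qed
    qed
  qed
qed

lemma ascend_wp:
  assumes kp: "k > 0" and c0: "const_regs k r" and h0: "heap k X K G S Q r"
    and r15: "r 15 = of_nat N * k" and ai: "ascend_inv N k X K G S" and dm: "demand_left k X Q" and N: "1 \<le> N"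
  shows "wp ascend r (\<lambda>r' u. u \<le> (20 * m + 50) * potential G S + 10 * m + 2 \<and>
    (\<exists>X' K' G' S'. const_regs k r' \<and> heap k X' K' G' S' Q r' \<and> r' 14 = r 14 \<and> r' 15 = r 15 \<and>
      ascend_inv N k X' K' G' S' \<and> demand_left k X' Q \<and> (\<forall>e<m. G' e \<le> (if S' e = 0 then N else 1))))"
proof -
  define I where "I = (\<lambda>(e, X', K', G', S') r'. const_regs k r' \<and> heap k X' K' G' S' Q r' \<and>
      r' 14 = r 14 \<and> r' 15 = r 15 \<and> r' 17 = of_nat e \<and> e \<le> m \<and>
      ascend_inv N k X' K' G' S' \<and> demand_left k X' Q \<and> (\<forall>e'<e. G' e' \<le> (if S' e' = 0 then N else 1)))"
  \<comment> \<open>A raise costs at most \<open>10 * m + 32\<close> and sends the scan back to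
    resource 0, worth up to another \<open>10 * m\<close>; the rest of \<open>20 * m + 50\<close>
    covers the tests around it.\<close>
  let ?\<phi> = "\<lambda>(e, X' :: nat \<Rightarrow> nat \<Rightarrow> nat, K' :: nat \<Rightarrow> nat \<Rightarrow> rat, G', S').
      (20 * m + 50) * potential G' S' + 10 * (m - e)"
  show ?thesis unfolding ascend_def
  proof (rule wp_Seq, rule wp_Blk, simp, rule wp_While[where I = I and g = "(0, X, K, G, S)" and \<phi> = ?\<phi>])
    show "I (0, X, K, G, S) (effects [Const 17 0] r)"
      unfolding I_def prod.case using c0 h0 ai dm by simp
  next
    fix g s assume Ig: "I g s" and lt: "s 17 < s 4"
    obtain e X' K' G' S' where g: "g = (e, X', K', G', S')" by (cases g) auto
    note J = Ig[unfolded g I_def prod.case]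
    have cs: "const_regs k s" and hs: "heap k X' K' G' S' Q s" and s17: "s 17 = of_nat e"
      and ai': "ascend_inv N k X' K' G' S'" and dm': "demand_left k X' Q" and s15: "s 15 = of_nat N * k"
      using J r15 by simp_all
    have e: "e < m" using lt J by (simp add: const_regs_def)
    have cr: "s 8 = 0" "s 13 = k" "s 7 = 1" using cs by (simp_all add: const_regs_def)
    let ?v = "(of_nat N :: rat) * k"
    let ?s = "s(26 := of_nat (bG + e), 27 := of_nat (G' e) * k, 28 := of_nat (bS + e), 29 := of_nat (S' e), 33 := ?v)"
    have e1: "effects [Add 26 11 17, Load 27 26, Add 28 12 17, Load 29 28, Add 33 15 8] s = ?s"
    proof -
      have v: "s 11 + s 17 = of_nat (bG + e)" "s 12 + s 17 = of_nat (bS + e)"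
        using cs s17 by (simp_all add: const_regs_def)
      have rd: "s (bG + e) = of_nat (G' e) * k" "s (bS + e) = of_nat (S' e)"
        using heap_read(4,5)[OF hs _ e, of 0] n_pos by simp_all
      have b: "bG + e \<noteq> 26" "bS + e \<noteq> 26" "bS + e \<noteq> 27" "bS + e \<noteq> 28"
        using bD_ge unfolding bases by auto
      show ?thesis by (simp add: v rd b s15 cr del: of_nat_add)
    qed
    let ?t = "of_nat (if S' e = 0 then N else 1) * k"
    let ?s' = "?s(33 := ?t)"
    let ?body = "IfLt 33 27 raise (Blk [Add 17 17 7])"
    have main: "wp ?body ?s' (\<lambda>r' u. \<exists>g'. I g' r' \<and> u + 7 + ?\<phi> g' \<le> ?\<phi> g)"
    proof (rule wp_IfLt)
      assume "?s' 33 < ?s' 27"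
      then have el: "(if S' e = 0 then N else 1) < G' e" using kp by simp
      have c1: "const_regs k ?s'" and h1: "heap k X' K' G' S' Q ?s'" using cs hs by simp_all
      show "wp raise ?s' (\<lambda>r' u. \<exists>g'. I g' r' \<and> Suc u + 7 + ?\<phi> g' \<le> ?\<phi> g)"
      proof (rule wp_mono[OF raise_wp[OF kp c1 h1 e _ _ _ _ _ ai' dm' N el]], goal_cases)
        case (6 r' u)
        then obtain X1 K1 G1 S1 where u: "u \<le> 10 * m + 32" and c: "const_regs k r'" "heap k X1 K1 G1 S1 Q r'"
          "r' 14 = ?s' 14" "r' 15 = ?s' 15" "r' 17 = 0" "ascend_inv N k X1 K1 G1 S1" "demand_left k X1 Q"
          and p: "Suc (potential G1 S1) \<le> potential G' S'" by blast
        have "(20 * m + 50) * Suc (potential G1 S1) \<le> (20 * m + 50) * potential G' S'"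
          by (rule mult_le_mono2[OF p])
        then have "Suc u + 7 + ((20 * m + 50) * potential G1 S1 + 10 * m) \<le> (20 * m + 50) * potential G' S'"
          using u by simp
        moreover have "I (0, X1, K1, G1, S1) r'" unfolding I_def prod.case using c J by simp
        ultimately show ?case unfolding g prod.case
          by (intro exI[of _ "(0, X1, K1, G1, S1)"]) simp
      qed (use s17 in simp_all)
    next
      assume "\<not> ?s' 33 < ?s' 27"
      then have el: "G' e \<le> (if S' e = 0 then N else 1)" using kp by (auto split: if_splits)
      let ?r = "effects [Add 17 17 7] ?s'"
      have "I (Suc e, X', K', G', S') ?r"
        unfolding I_def prod.case using J e el cr by (auto simp: less_Suc_eq)
      moreover have "m - e = Suc (m - Suc e)" using e by simp
      ultimately show "wp (Blk [Add 17 17 7]) ?s' (\<lambda>r' u. \<exists>g'. I g' r' \<and> Suc u + 7 + ?\<phi> g' \<le> ?\<phi> g)"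
        by (intro wp_Blk exI[of _ "(Suc e, X', K', G', S')"]) (simp_all add: g)
    qed
    show "wp (Blk [Add 26 11 17, Load 27 26, Add 28 12 17, Load 29 28, Add 33 15 8] ;;
       IfLt 8 29 (Blk [Add 33 13 8]) (Blk []) ;; ?body) s
        (\<lambda>r' u. \<exists>g'. I g' r' \<and> Suc u + ?\<phi> g' \<le> ?\<phi> g)"
    proof (rule wp_Seq, rule wp_Blk, simp, unfold e1, rule wp_Seq, rule wp_IfLt)
      assume "?s 8 < ?s 29"
      then have "0 < S' e" using cr by simp
      then have e2: "effects [Add 33 13 8] ?s = ?s'" using cr by simp
      show "wp (Blk [Add 33 13 8]) ?s (\<lambda>r1 u1. wp ?body r1 (\<lambda>r' u2. \<exists>g'. I g' r' \<and>
          Suc (costs [Add 26 11 17, Load 27 26, Add 28 12 17, Load 29 28, Add 33 15 8] + (Suc u1 + u2)) + ?\<phi> g' \<le> ?\<phi> g))"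
      proof (rule wp_Blk, simp, unfold e2, rule wp_mono[OF main])
        fix r' u assume "\<exists>g'. I g' r' \<and> u + 7 + ?\<phi> g' \<le> ?\<phi> g"
        then obtain g' where "I g' r'" "u + 7 + ?\<phi> g' \<le> ?\<phi> g" by blast
        then show "\<exists>g'. I g' r' \<and>
          Suc (costs [Add 26 11 17, Load 27 26, Add 28 12 17, Load 29 28, Add 33 15 8] + (Suc (costs [Add 33 13 8]) + u)) + ?\<phi> g' \<le> ?\<phi> g"
          by (intro exI[of _ g']) simp
      qed
    next
      assume "\<not> ?s 8 < ?s 29"
      then have "S' e = 0" using cr by simp
      then have e2: "effects [] ?s = ?s'" by simp
      show "wp (Blk []) ?s (\<lambda>r1 u1. wp ?body r1 (\<lambda>r' u2. \<exists>g'. I g' r' \<and>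
          Suc (costs [Add 26 11 17, Load 27 26, Add 28 12 17, Load 29 28, Add 33 15 8] + (Suc u1 + u2)) + ?\<phi> g' \<le> ?\<phi> g))"
      proof (rule wp_Blk, simp, unfold e2, rule wp_mono[OF main])
        fix r' u assume "\<exists>g'. I g' r' \<and> u + 7 + ?\<phi> g' \<le> ?\<phi> g"
        then obtain g' where "I g' r'" "u + 7 + ?\<phi> g' \<le> ?\<phi> g" by blast
        then show "\<exists>g'. I g' r' \<and>
          Suc (costs [Add 26 11 17, Load 27 26, Add 28 12 17, Load 29 28, Add 33 15 8] + (Suc (costs []) + u)) + ?\<phi> g' \<le> ?\<phi> g"
          by (intro exI[of _ g']) simp
      qed
    qed
  next
    fix g s u assume Ig: "I g s" and lt: "\<not> s 17 < s 4"
      and u: "u + ?\<phi> g \<le> Suc (?\<phi> (0, X, K, G, S))"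
    obtain e X' K' G' S' where g: "g = (e, X', K', G', S')" by (cases g) auto
    note J = Ig[unfolded g I_def prod.case]
    have e: "e = m" using lt J by (simp add: const_regs_def)
    have u': "costs [Const 17 0] + u \<le> (20 * m + 50) * potential G S + 10 * m + 2"
      using u unfolding g prod.case by simp
    show "costs [Const 17 0] + u \<le> (20 * m + 50) * potential G S + 10 * m + 2 \<and>
      (\<exists>X' K' G' S'. const_regs k s \<and> heap k X' K' G' S' Q s \<and> s 14 = r 14 \<and> s 15 = r 15 \<and>
      ascend_inv N k X' K' G' S' \<and> demand_left k X' Q \<and> (\<forall>e<m. G' e \<le> (if S' e = 0 then N else 1)))"
      apply (rule conjI, rule u')
      apply (rule exI[of _ X'], rule exI[of _ K'], rule exI[of _ G'], rule exI[of _ S'])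
      using J unfolding e by blast
  qed
qed

section \<open>A whole phase, the passage to half the packet size, and the final phase\<close>

lemma phase_wp:
  assumes kp: "k > 0" and c0: "const_regs k r" and h0: "heap k X K G (\<lambda>_. 0) Q r" and M: "r 14 = M"
    and r15: "r 15 = of_nat N * k" and N: "1 \<le> N"
    and ks: "keys_ok k X K G (\<lambda>_. 0)" and dm: "demand_left k X Q"
    and nr: "\<And>i. i < n \<Longrightarrow> near_response m (\<lambda>e. a i e * k) (X i) (K i) 0"
    and rs: "\<And>i. i < n \<Longrightarrow> best_response m (\<lambda>e. a i e * k) (X i) (K i) \<or> M + of_nat m * k \<le> Q i"
    and qb: "\<And>i. i < n \<Longrightarrow> Q i \<le> M + of_nat (m + 2) * k"
    and sG: "(\<Sum>e<m. G e) \<le> 2 * (n * m)"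
  shows "wp phase r (\<lambda>r' u. u \<le> 500 * (n * m)\<^sup>2 \<and>
    (\<exists>X' K' G' S' Q'. const_regs k r' \<and> heap k X' K' G' S' Q' r' \<and> r' 14 = r 14 \<and> r' 15 = r 15 \<and>
      ascend_inv N k X' K' G' S' \<and> demand_left k X' Q' \<and> (\<forall>e<m. G' e \<le> (if S' e = 0 then N else 1)) \<and>
      (\<forall>i<n. Q' i \<le> M \<and> (Q' i = Q i \<or> M - k < Q' i))))"
  unfolding phase_def
proof (rule wp_Seq, rule wp_mono[OF fill_wp[OF kp c0 h0 M ks dm nr rs qb]], assumption, assumption, assumption,
    elim conjE exE)
  fix r1 u1 X1 K1 G1 Q1
  assume u1: "u1 \<le> n * ((m + 2) * (10 * m + 22) + 6) + 2" and c1: "const_regs k r1"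
    and h1: "heap k X1 K1 G1 (\<lambda>_. 0) Q1 r1" and p1: "r1 14 = r 14" "r1 15 = r 15"
    and k1: "keys_ok k X1 K1 G1 (\<lambda>_. 0)" and d1: "demand_left k X1 Q1" and f1: "\<forall>i<n. filled k M X Q X1 K1 Q1 i"
    and sG1: "(\<Sum>e<m. G1 e) \<le> (\<Sum>e<m. G e) + n * (m + 2)"
  have r15': "r1 15 = of_nat N * k" using p1 r15 by simp
  have ai: "ascend_inv N k X1 K1 G1 (\<lambda>_. 0)"
    unfolding ascend_inv_def best_responses_def using k1 f1 n_pos unfolding filled_def by auto
  have Q1: "\<forall>i<n. Q1 i \<le> M \<and> (Q1 i = Q i \<or> M - k < Q1 i)"
    using f1 unfolding filled_def by auto
  have nm: "1 \<le> n" "1 \<le> m" using n_pos m_pos by auto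
  \<comment> \<open>\<open>2 * (n * m)\<close> bounds the gaps inherited from the previous phase,
    and \<open>n * (m + 2)\<close> the packets just placed.\<close>
  have "potential G1 (\<lambda>_. 0) \<le> n * (2 * (n * m) + n * (m + 2))"
  proof -
    have "(\<Sum>e<m. G1 e) \<le> 2 * (n * m) + n * (m + 2)" using sG sG1 by linarith
    then show ?thesis unfolding potential_def using mult_le_mono2 by simp
  qed
  then have pt: "potential G1 (\<lambda>_. 0) \<le> 5 * (n * n * m)"
  proof -
    have 1: "n * n \<le> n * n * m" using nm by simp
    have "n * (2 * (n * m) + n * (m + 2)) = 3 * (n * n * m) + 2 * (n * n)"
      by (simp add: algebra_simps)
    then show ?thesis using 1 \<open>potential G1 (\<lambda>_. 0) \<le> n * (2 * (n * m) + n * (m + 2))\<close> by linarith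
  qed
  have bnd: "u1 + ((20 * m + 50) * potential G1 (\<lambda>_. 0) + 10 * m + 2) \<le> 500 * (n * m)\<^sup>2"
  proof -
    define Z where "Z = n * n * (m * m)"
    define P where "P = (20 * m + 50) * potential G1 (\<lambda>_. 0)"
    define F where "F = n * ((m + 2) * (10 * m + 22) + 6)"
    have "P \<le> (70 * m) * (5 * (n * n * m))"
      unfolding P_def using pt nm by (intro mult_le_mono) auto
    then have P: "P \<le> 350 * Z" unfolding Z_def by (simp add: algebra_simps)
    have "(m + 2) * (10 * m + 22) \<le> (3 * m) * (32 * m)" using nm by (intro mult_le_mono) auto
    moreover have "1 \<le> m * m" using nm by (simp add: Suc_le_eq)
    ultimately have "(m + 2) * (10 * m + 22) + 6 \<le> 102 * (m * m)" by linarith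
    then have "F \<le> (n * n) * (102 * (m * m))"
      unfolding F_def using nm by (intro mult_le_mono) auto
    then have F: "F \<le> 102 * Z" unfolding Z_def by simp
    have mZ: "m \<le> Z"
    proof -
      have "1 * 1 * (1 * m) \<le> Z" unfolding Z_def using nm by (intro mult_le_mono) auto
      then show ?thesis by simp
    qed
    have "u1 + (P + 10 * m + 2) \<le> 500 * Z"
      using P F mZ u1[folded F_def] nm by linarith
    moreover have "(n * m)\<^sup>2 = Z" unfolding Z_def power2_eq_square by simp
    ultimately show ?thesis unfolding P_def by simp
  qed
  show "wp ascend r1 (\<lambda>r2 u2. u1 + u2 \<le> 500 * (n * m)\<^sup>2 \<and>
    (\<exists>X' K' G' S' Q'. const_regs k r2 \<and> heap k X' K' G' S' Q' r2 \<and> r2 14 = r 14 \<and> r2 15 = r 15 \<and>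
      ascend_inv N k X' K' G' S' \<and> demand_left k X' Q' \<and> (\<forall>e<m. G' e \<le> (if S' e = 0 then N else 1)) \<and>
      (\<forall>i<n. Q' i \<le> M \<and> (Q' i = Q i \<or> M - k < Q' i))))"
  proof (rule wp_mono[OF ascend_wp[OF kp c1 h1 r15' ai d1 N]], elim conjE exE)
    fix r2 u2 X2 K2 G2 S2
    assume u2: "u2 \<le> (20 * m + 50) * potential G1 (\<lambda>_. 0) + 10 * m + 2"
      and *: "const_regs k r2" "heap k X2 K2 G2 S2 Q1 r2" "r2 14 = r1 14" "r2 15 = r1 15"
        "ascend_inv N k X2 K2 G2 S2" "demand_left k X2 Q1" "\<forall>e<m. G2 e \<le> (if S2 e = 0 then N else 1)"
    show "u1 + u2 \<le> 500 * (n * m)\<^sup>2 \<and>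
    (\<exists>X' K' G' S' Q'. const_regs k r2 \<and> heap k X' K' G' S' Q' r2 \<and> r2 14 = r 14 \<and> r2 15 = r 15 \<and>
      ascend_inv N k X' K' G' S' \<and> demand_left k X' Q' \<and> (\<forall>e<m. G' e \<le> (if S' e = 0 then N else 1)) \<and>
      (\<forall>i<n. Q' i \<le> M \<and> (Q' i = Q i \<or> M - k < Q' i)))"
      apply (rule conjI)
      subgoal using u2 bnd by linarith
      apply (rule exI[of _ X2], rule exI[of _ K2], rule exI[of _ G2], rule exI[of _ S2], rule exI[of _ Q1])
      using * Q1 p1 by simp
  qed
qed

lemma heap_pointer_zero: "heap k X K G S Q r \<Longrightarrow> (\<forall>e<m. S e = 0) \<Longrightarrow> heap k X K G (\<lambda>_. 0) Q r"
  unfolding heap_def by simp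

lemma keys_pointer_zero: "keys_ok k X K G S \<Longrightarrow> (\<forall>e<m. S e = 0) \<Longrightarrow> keys_ok k X K G (\<lambda>_. 0)"
  unfolding keys_ok_def key_def by simp

lemma heap_halve:
  "heap k X K G S Q r \<Longrightarrow> heap (k / 2) (\<lambda>i e. 2 * X i e) K (\<lambda>e. 2 * G e) S Q r"
  unfolding heap_def by simp

text \<open>The counters must be 0 here: an offset of one old packet shown to some of the players
  would be two new packets, which no counter can express.\<close>

lemma keys_halve:
  assumes "keys_ok k X K G (\<lambda>_. 0)"
  shows "keys_ok (k / 2) (\<lambda>i e. 2 * X i e) K (\<lambda>e. 2 * G e) (\<lambda>_. 0)"
proof -
  have "key (k / 2) (\<lambda>i e. 2 * X i e) (\<lambda>e. 2 * G e) (\<lambda>_. 0) i e = key k X G (\<lambda>_. 0) i e" for i e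
    unfolding key_def sum_distrib_left[symmetric] by (simp add: algebra_simps)
  then show ?thesis using assms unfolding keys_ok_def by simp
qed

lemma demand_left_halve: "demand_left k X Q \<Longrightarrow> demand_left (k / 2) (\<lambda>i e. 2 * X i e) Q"
  unfolding demand_left_def sum_distrib_left[symmetric] by simp

text \<open>A player with \<open>Q i = d i\<close> holds no packets, so every profile is a best response for her. Any other
  player has at least \<open>(2 * m + 2) * k\<close> left, hence adds at least \<open>m\<close> packets before the margin
  \<open>(m + 2) * k\<close> is reached.\<close>

definition ready :: "rat \<Rightarrow> (nat \<Rightarrow> nat \<Rightarrow> nat) \<Rightarrow> (nat \<Rightarrow> nat \<Rightarrow> rat) \<Rightarrow> (nat \<Rightarrow> nat) \<Rightarrow> (nat \<Rightarrow> rat) \<Rightarrow> bool" where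
  "ready k X K G Q \<longleftrightarrow> keys_ok k X K G (\<lambda>_. 0) \<and> demand_left k X Q \<and>
     (\<forall>i<n. near_response m (\<lambda>e. a i e * k) (X i) (K i) 0 \<and> 0 \<le> Q i \<and> Q i \<le> of_nat (2 * m + 4) * k \<and>
        (Q i = d i \<or> of_nat (2 * m + 2) * k \<le> Q i)) \<and>
     (\<Sum>e<m. G e) \<le> 2 * (n * m)"

definition settled :: "rat \<Rightarrow> (nat \<Rightarrow> nat \<Rightarrow> nat) \<Rightarrow> (nat \<Rightarrow> nat \<Rightarrow> rat) \<Rightarrow> (nat \<Rightarrow> nat) \<Rightarrow> (nat \<Rightarrow> rat) \<Rightarrow> bool" where
  "settled k X K G Q \<longleftrightarrow> keys_ok k X K G (\<lambda>_. 0) \<and> best_responses k X K \<and> demand_left k X Q \<and>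
     (\<forall>i<n. 0 \<le> Q i \<and> Q i \<le> of_nat (m + 2) * k \<and> (Q i = d i \<or> of_nat (m + 1) * k \<le> Q i)) \<and>
     (\<forall>e<m. G e \<le> n)"

text \<open>Gaps of at most \<open>n\<close> old packets add up to at most \<open>2 * n * m\<close>
  new ones, and \<open>(m + 1) * k\<close> equals \<open>2 * m + 2\<close> new packets, exactly
  \<open>m\<close> above the new margin.\<close>

lemma settled_halve:
  assumes "settled k X K G Q"
  shows "ready (k / 2) (\<lambda>i e. 2 * X i e) K (\<lambda>e. 2 * G e) Q"
proof -
  have G: "(\<Sum>e<m. 2 * G e) \<le> 2 * (n * m)"
  proof -
    have "(\<Sum>e<m. 2 * G e) \<le> (\<Sum>e<m. 2 * n)"
      using assms unfolding settled_def by (intro sum_mono) simp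
    then show ?thesis by (simp add: algebra_simps)
  qed
  have "near_response m (\<lambda>e. a i e * (k / 2)) (\<lambda>e. 2 * X i e) (K i) 0" if "i < n" for i
    using assms that m_pos unfolding settled_def best_responses_def by (intro near_response_halve) simp_all
  moreover have "0 \<le> Q i \<and> Q i \<le> of_nat (2 * m + 4) * (k / 2) \<and>
      (Q i = d i \<or> of_nat (2 * m + 2) * (k / 2) \<le> Q i)" if "i < n" for i
  proof -
    have e: "of_nat (2 * m + 4) * (k / 2) = of_nat (m + 2) * k" "of_nat (2 * m + 2) * (k / 2) = of_nat (m + 1) * k"
      by (simp_all add: algebra_simps)
    show ?thesis using assms that unfolding e settled_def by blast
  qed
  moreover have "keys_ok k X K G (\<lambda>_. 0)" "demand_left k X Q" using assms unfolding settled_def by blast+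
  ultimately show ?thesis using G keys_halve demand_left_halve unfolding ready_def by blast
qed

lemma approx_phase_wp:
  assumes kp: "k > 0" and c0: "const_regs k r" and h0: "heap k X K G (\<lambda>_. 0) Q r"
    and r14: "r 14 = of_nat (m + 2) * k" and r15: "r 15 = of_nat n * k" and rd: "ready k X K G Q"
  shows "wp phase r (\<lambda>r' u. u \<le> 500 * (n * m)\<^sup>2 \<and>
    (\<exists>X' K' G' Q'. const_regs k r' \<and> heap k X' K' G' (\<lambda>_. 0) Q' r' \<and>
      r' 14 = of_nat (m + 2) * k \<and> r' 15 = of_nat n * k \<and> settled k X' K' G' Q'))"
proof -
  let ?M = "of_nat (m + 2) * k"
  note R = rd[unfolded ready_def]
  have resp_or: "best_response m (\<lambda>e. a i e * k) (X i) (K i) \<or> ?M + of_nat m * k \<le> Q i" if i: "i < n" for i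
  proof (cases "Q i = d i")
    case True
    have "Q i = d i - of_nat (\<Sum>e<m. X i e) * k" using R i unfolding demand_left_def by blast
    then have "of_nat (\<Sum>e<m. X i e) * k = 0" using True by linarith
    then have "(\<Sum>e<m. X i e) = 0" using kp of_nat_eq_0_iff[where 'a = rat] by (metis mult_eq_0_iff order_less_irrefl)
    then show ?thesis unfolding best_response_def by simp
  next
    case False
    then have "of_nat (2 * m + 2) * k \<le> Q i" using R i by blast
    then show ?thesis by (simp add: algebra_simps)
  qed
  have qb: "Q i \<le> ?M + of_nat (m + 2) * k" if "i < n" for i
  proof -
    have "Q i \<le> of_nat (2 * m + 4) * k" using R that by blast
    then show ?thesis by (simp add: algebra_simps)
  qed
  show ?thesis
  proof (rule wp_mono[OF phase_wp[OF kp c0 h0 r14 r15 n_pos _ _ _ resp_or qb]], goal_cases)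
    case 1 then show ?case using R by blast
  next
    case 2 then show ?case using R by blast
  next
    case (3 i) then show ?case using R by blast
  next
    case (4 i) then show ?case .
  next
    case (5 i) then show ?case .
  next
    case 6 then show ?case using R by blast
  next
    case (7 r' u)
    then obtain X' K' G' S' Q' where u: "u \<le> 500 * (n * m)\<^sup>2" and c: "const_regs k r'"
      and h: "heap k X' K' G' S' Q' r'" and p: "r' 14 = r 14" "r' 15 = r 15"
      and ai: "ascend_inv n k X' K' G' S'" and dm: "demand_left k X' Q'"
      and ex: "\<forall>e<m. G' e \<le> (if S' e = 0 then n else 1)"
      and Q: "\<forall>i<n. Q' i \<le> ?M \<and> (Q' i = Q i \<or> ?M - k < Q' i)" by blast
    \<comment> \<open>With \<open>N = n\<close> an unfinished round would have a gap of at least 2,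
      but the scan accepts an unfinished round only at gap at most 1.\<close>
    have S0: "\<forall>e<m. S' e = 0"
    proof (intro allI impI, rule ccontr)
      fix e assume e: "e < m" and "S' e \<noteq> 0"
      then have "n + 1 \<le> G' e + S' e" "S' e < n" "G' e \<le> 1" using ai ex unfolding ascend_inv_def by auto
      then show False by linarith
    qed
    have "settled k X' K' G' Q'" unfolding settled_def
    proof (intro conjI allI impI)
      show "keys_ok k X' K' G' (\<lambda>_. 0)" using ai S0 keys_pointer_zero unfolding ascend_inv_def by blast
      show "best_responses k X' K'" using ai unfolding ascend_inv_def by blast
      show "demand_left k X' Q'" by (rule dm)
      fix i assume i: "i < n"
      show "Q' i \<le> ?M" using Q i by blast
      define w where "w = of_nat (m + 1) * k"
      have w: "0 < w" unfolding w_def using kp by simp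
      have e: "?M - k = w" "of_nat (2 * m + 2) * k = 2 * w" unfolding w_def by (simp_all add: algebra_simps)
      have Qi: "Q' i = Q i \<or> w < Q' i" "0 \<le> Q i" "Q i = d i \<or> 2 * w \<le> Q i"
        using Q R i unfolding e by blast+
      show "0 \<le> Q' i" using Qi(1,2) w by linarith
      have "Q' i = d i \<or> w \<le> Q' i" using Qi w by linarith
      then show "Q' i = d i \<or> of_nat (m + 1) * k \<le> Q' i" unfolding w_def .
    next
      fix e assume "e < m"
      then show "G' e \<le> n" using ex S0 by simp
    qed
    then show ?case using u c heap_pointer_zero[OF h S0] p r14 r15 by metis
  qed
qed

text \<open>Prices at most one packet below the loads, and never above them, bracket the true
  marginal costs: the lower bound on the price is used on the resource a packet leaves, the upper
  bound on the one it enters.\<close>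

lemma final_equilibrium:
  assumes ai: "ascend_inv 1 k0 X K G S" and dm: "demand_left k0 X Q" and G: "\<forall>e<m. G e \<le> 1" and Q: "\<forall>i<n. Q i = 0"
    and x: "\<And>i e. i < n \<Longrightarrow> e < m \<Longrightarrow> x i e = of_nat (X i e) * k0"
  shows "is_equilibrium n m k0 d a b x"
proof (rule equilibriumI[where X = X])
  show "k0 > 0" "m \<ge> 1" by (rule k0_pos, rule m_pos)
  show "\<And>i e. i < n \<Longrightarrow> e < m \<Longrightarrow> a i e > 0" by (rule a_pos)
  show "\<And>i e. i < n \<Longrightarrow> e < m \<Longrightarrow> x i e = of_nat (X i e) * k0" by (rule x)
  show "(\<Sum>e<m. x i e) = d i" if i: "i < n" for i
  proof -
    have "(\<Sum>e<m. x i e) = (\<Sum>e<m. of_nat (X i e) * k0)" using x[OF i] by (intro sum.cong) auto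
    also have "\<dots> = of_nat (\<Sum>e<m. X i e) * k0" by (simp add: sum_distrib_right)
    also have "\<dots> = d i" using dm Q i unfolding demand_left_def by simp
    finally show ?thesis .
  qed
next
  fix i e f assume i: "i < n" and e: "e < m" and f: "f < m" and pos: "0 < X i e"
  define p where "p g = of_nat (\<Sum>i<n. X i g) - (of_nat (G g) :: rat) + (if i < S g then 1 else 0)" for g
  have ld: "load n x g = of_nat (\<Sum>i<n. X i g) * k0" if "g < m" for g
  proof -
    have "load n x g = (\<Sum>i<n. of_nat (X i g) * k0)"
      unfolding load_def using x[OF _ that] by (intro sum.cong) auto
    then show ?thesis by (simp add: sum_distrib_right)
  qed
  have pb: "of_nat (\<Sum>i<n. X i g) - 1 \<le> p g \<and> p g \<le> of_nat (\<Sum>i<n. X i g)" if g: "g < m" for g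
  proof -
    have "G g = 0 \<or> G g = 1" using G g by (cases "G g") auto
    \<comment> \<open>Without a gap no raise is pending, so the offset cannot lift the price above
      the load.\<close>
    moreover have "0 < S g \<longrightarrow> 1 \<le> G g" using ai g unfolding ascend_inv_def by blast
    ultimately show ?thesis unfolding p_def by auto
  qed
  have Kg: "K i g = a i g * (k0 * (p g + of_nat (X i g))) + b i g" if "g < m" for g
    using ai i that unfolding ascend_inv_def keys_ok_def key_def p_def by auto
  have "K i e \<le> K i f + a i f * k0"
    using ai i e f pos unfolding ascend_inv_def best_responses_def best_response_def by blast
  moreover have "a i e * (load n x e + x i e - k0) + b i e \<le> K i e"
  proof -
    have "load n x e + x i e - k0 = k0 * (of_nat (\<Sum>i<n. X i e) - 1 + of_nat (X i e))"
      unfolding ld[OF e] x[OF i e] by (simp add: algebra_simps)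
    also have "\<dots> \<le> k0 * (p e + of_nat (X i e))"
      using pb[OF e] k0_pos by (intro mult_left_mono) auto
    finally show ?thesis unfolding Kg[OF e] using a_pos[OF i e] by simp
  qed
  moreover have "K i f + a i f * k0 \<le> a i f * (load n x f + x i f + k0) + b i f"
  proof -
    have "k0 * (p f + of_nat (X i f)) \<le> k0 * (of_nat (\<Sum>i<n. X i f) + of_nat (X i f))"
      using pb[OF f] k0_pos by (intro mult_left_mono) auto
    also have "\<dots> = load n x f + x i f"
      unfolding ld[OF f] x[OF i f] by (simp add: algebra_simps)
    finally have "a i f * (k0 * (p f + of_nat (X i f))) \<le> a i f * (load n x f + x i f)"
      using a_pos[OF i f] by simp
    then show ?thesis unfolding Kg[OF f] by (simp add: algebra_simps)
  qed
  ultimately show "a i e * (load n x e + x i e - k0) + b i e \<le> a i f * (load n x f + x i f + k0) + b i f"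
    by linarith
qed

lemma final_phase_wp:
  assumes c0: "const_regs k0 r" and h0: "heap k0 X K G (\<lambda>_. 0) Q r"
    and r14: "r 14 = 0" and r15: "r 15 = k0" and st: "settled k0 X K G Q"
  shows "wp phase r (\<lambda>r' u. u \<le> 500 * (n * m)\<^sup>2 \<and> const_regs k0 r' \<and>
    is_equilibrium n m k0 d a b (\<lambda>i e. r' (bA + 2 * (n * m) + (i * m + e))))"
proof -
  note R = st[unfolded settled_def]
  have rs: "best_response m (\<lambda>e. a i e * k0) (X i) (K i)" if "i < n" for i
    using R that unfolding best_responses_def by blast
  have sG: "(\<Sum>e<m. G e) \<le> 2 * (n * m)"
  proof -
    have "(\<Sum>e<m. G e) \<le> (\<Sum>e<m. n)" using R by (intro sum_mono) simp
    also have "\<dots> \<le> 2 * (n * m)" by (simp add: mult.commute)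
    finally show ?thesis .
  qed
  have r15': "r 15 = of_nat 1 * k0" using r15 by simp
  show ?thesis
  proof (rule wp_mono[OF phase_wp[OF k0_pos c0 h0 r14 r15']], goal_cases)
    case (4 i) then show ?case using rs unfolding near_response_def by blast
  next
    case (5 i) then show ?case using rs by blast
  next
    case (8 r' u)
    then obtain X' K' G' S' Q' where u: "u \<le> 500 * (n * m)\<^sup>2" and c: "const_regs k0 r'"
      and h: "heap k0 X' K' G' S' Q' r'"
      and ai: "ascend_inv 1 k0 X' K' G' S'" and dm: "demand_left k0 X' Q'"
      and ex: "\<forall>e<m. G' e \<le> (if S' e = 0 then 1 else 1)"
      and Q: "\<forall>i<n. Q' i \<le> 0 \<and> (Q' i = Q i \<or> 0 - k0 < Q' i)" by blast
    \<comment> \<open>At margin 0 the remaining demand lies above \<open>- k0\<close> and is at most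
      0. It is also an integer multiple of \<open>k0\<close>, since the demand is one.\<close>
    have "Q' i = 0" if i: "i < n" for i
    proof -
      have "0 \<le> Q i" using R i by blast
      then have q: "- k0 < Q' i" "Q' i \<le> 0" using Q i k0_pos by fastforce+
      obtain z where "d i = of_nat z * k0" using dem_mult[OF i] by blast
      then have "Q' i = of_int (int z - int (\<Sum>e<m. X' i e)) * k0"
        using dm i unfolding demand_left_def by (simp add: algebra_simps)
      then obtain w :: int where w: "Q' i = of_int w * k0" by blast
      have "of_int (- 1) * k0 < of_int w * k0" "of_int w * k0 \<le> of_int 0 * k0" using q w by simp_all
      then have "of_int (- 1) < (of_int w :: rat)" "(of_int w :: rat) \<le> of_int 0"
        using k0_pos mult_less_cancel_right_pos mult_le_cancel_right_pos by blast+
      then have "w = 0" by simp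
      then show ?thesis using w by simp
    qed
    then have "is_equilibrium n m k0 d a b (\<lambda>i e. r' (bA + 2 * (n * m) + (i * m + e)))"
      using final_equilibrium[OF ai dm] ex heap_read(3)[OF h] by simp
    then show ?case using u c by blast
  qed (use R sG in auto)
qed

text \<open>\<open>q\<close> halvings lead to size \<open>k0\<close>, where one more phase with
  margin and one without follow: \<open>q + 2\<close> phases in all. The 4 covers the loop test and
  the three multiplications of a halving.\<close>

lemma solve_wp:
  assumes c0: "const_regs (2 ^ q * k0) r" and h0: "heap (2 ^ q * k0) X K G (\<lambda>_. 0) Q r"
    and r14: "r 14 = of_nat (m + 2) * (2 ^ q * k0)" and r15: "r 15 = of_nat n * (2 ^ q * k0)"
    and rd: "ready (2 ^ q * k0) X K G Q"
  shows "wp solve r (\<lambda>r' u. u \<le> (q + 2) * (500 * (n * m)\<^sup>2 + 4) \<and> const_regs k0 r' \<and>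
    is_equilibrium n m k0 d a b (\<lambda>i e. r' (bA + 2 * (n * m) + (i * m + e))))"
proof -
  define Z where "Z = 500 * (n * m)\<^sup>2"
  define I where "I = (\<lambda>(q, X, K, G, Q) s. const_regs (2 ^ q * k0) s \<and> heap (2 ^ q * k0) X K G (\<lambda>_. 0) Q s \<and>
    s 14 = of_nat (m + 2) * (2 ^ q * k0) \<and> s 15 = of_nat n * (2 ^ q * k0) \<and> ready (2 ^ q * k0) X K G Q)"
  let ?\<phi> = "\<lambda>(q :: nat, X :: nat \<Rightarrow> nat \<Rightarrow> nat, K :: nat \<Rightarrow> nat \<Rightarrow> rat, G :: nat \<Rightarrow> nat, Q :: nat \<Rightarrow> rat).
     (Z + 4) * q"
  have pos: "2 ^ q * k0 > 0" for q :: nat using k0_pos by simp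
  show ?thesis unfolding solve_def
  proof (rule wp_Seq, rule wp_While[where I = I and g = "(q, X, K, G, Q)" and \<phi> = ?\<phi>])
    show "I (q, X, K, G, Q) r" unfolding I_def prod.case using assms by blast
  next
    fix g s assume Ig: "I g s" and lt: "s 6 < s 13"
    obtain q X K G Q where g: "g = (q, X, K, G, Q)" by (cases g) auto
    note J = Ig[unfolded g I_def prod.case]
    have "q \<noteq> 0"
    proof
      assume "q = 0"
      then have "s 13 = k0" "s 6 = k0" using J by (simp_all add: const_regs_def)
      with lt show False by simp
    qed
    then obtain p where q: "q = Suc p" by (cases q) auto
    have half: "2 ^ q * k0 / 2 = 2 ^ p * k0" unfolding q by simp
    show "wp (phase ;; Blk [Const 33 (1 / 2), Mul 13 13 33, Mul 14 14 33, Mul 15 15 33]) s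
        (\<lambda>r' u. \<exists>g'. I g' r' \<and> Suc u + ?\<phi> g' \<le> ?\<phi> g)"
    proof (rule wp_Seq, rule wp_mono[OF approx_phase_wp[OF pos, of q s X K G Q]], goal_cases)
      case (6 r1 u)
      then obtain X1 K1 G1 Q1 where u: "u \<le> Z" and c1: "const_regs (2 ^ q * k0) r1"
        and h1: "heap (2 ^ q * k0) X1 K1 G1 (\<lambda>_. 0) Q1 r1"
        and r: "r1 14 = of_nat (m + 2) * (2 ^ q * k0)" "r1 15 = of_nat n * (2 ^ q * k0)"
        and st: "settled (2 ^ q * k0) X1 K1 G1 Q1" unfolding Z_def by blast
      let ?r = "r1(33 := 1 / 2, 13 := 2 ^ p * k0, 14 := of_nat (m + 2) * (2 ^ p * k0), 15 := of_nat n * (2 ^ p * k0))"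
      have "r1 13 = 2 ^ q * k0" using c1 by (simp add: const_regs_def)
      then have e: "effects [Const 33 (1 / 2), Mul 13 13 33, Mul 14 14 33, Mul 15 15 33] r1 = ?r"
        using r unfolding q by simp
      have "const_regs (2 ^ p * k0) ?r" using c1 unfolding const_regs_def by simp
      moreover have "heap (2 ^ p * k0) (\<lambda>i e. 2 * X1 i e) K1 (\<lambda>e. 2 * G1 e) (\<lambda>_. 0) Q1 ?r"
        using heap_halve[OF h1] unfolding half by simp
      moreover have "ready (2 ^ p * k0) (\<lambda>i e. 2 * X1 i e) K1 (\<lambda>e. 2 * G1 e) Q1"
        using settled_halve[OF st] unfolding half .
      ultimately have "I (p, \<lambda>i e. 2 * X1 i e, K1, \<lambda>e. 2 * G1 e, Q1) ?r"
        unfolding I_def prod.case by simp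
      then show ?case
        apply (intro wp_Blk)
         apply simp
        apply (unfold e)
        apply (rule exI[of _ "(p, \<lambda>i e. 2 * X1 i e, K1, \<lambda>e. 2 * G1 e, Q1)"])
        using u unfolding g q by simp
    qed (use J in blast)+
  next
    fix g s u assume Ig: "I g s" and lt: "\<not> s 6 < s 13" and u: "u + ?\<phi> g \<le> Suc (?\<phi> (q, X, K, G, Q))"
    obtain p X1 K1 G1 Q1 where g: "g = (p, X1, K1, G1, Q1)" by (cases g) auto
    note J = Ig[unfolded g I_def prod.case]
    have p: "p = 0"
    proof (rule ccontr)
      assume "p \<noteq> 0"
      then have "(1 :: rat) < 2 ^ p" by simp
      then have "1 * k0 < 2 ^ p * k0" using k0_pos by (intro mult_strict_right_mono)
      then show False using lt J by (simp add: const_regs_def)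
    qed
    have u': "u \<le> Suc ((Z + 4) * q)" using u by simp
    have pos0: "k0 > 0" by (rule k0_pos)
    show "wp (phase ;; Blk [Const 14 0, Add 15 6 8] ;; phase) s (\<lambda>r2 u2. u + u2 \<le> (q + 2) * (500 * (n * m)\<^sup>2 + 4) \<and>
       const_regs k0 r2 \<and> is_equilibrium n m k0 d a b (\<lambda>i e. r2 (bA + 2 * (n * m) + (i * m + e))))"
    proof (rule wp_Seq, rule wp_mono[OF approx_phase_wp[OF pos0, of s X1 K1 G1 Q1]], goal_cases)
      case (6 r1 u1)
      then obtain X2 K2 G2 Q2 where u1: "u1 \<le> Z" and c1: "const_regs k0 r1"
        and h1: "heap k0 X2 K2 G2 (\<lambda>_. 0) Q2 r1" and st: "settled k0 X2 K2 G2 Q2"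
        unfolding Z_def by blast
      have "r1 6 = k0" "r1 8 = 0" using c1 by (simp_all add: const_regs_def)
      then have e: "effects [Const 14 0, Add 15 6 8] r1 = r1(14 := 0, 15 := k0)" by simp
      let ?r = "r1(14 := 0, 15 := k0)"
      show ?case
      proof (rule wp_Seq, rule wp_Blk, simp, unfold e, rule wp_mono[OF final_phase_wp[of ?r X2 K2 G2 Q2]], goal_cases)
        case (6 r' u2)
        define Y where "Y = (Z + 4) * q"
        have "(q + 2) * (500 * (n * m)\<^sup>2 + 4) = Y + 2 * Z + 8"
          unfolding Z_def Y_def by (simp add: algebra_simps)
        moreover have "u2 \<le> Z" using 6 unfolding Z_def by blast
        ultimately show ?case using 6 u'[folded Y_def] u1 by simp
      qed (use c1 h1 st in simp_all)
    qed (use J p in simp_all)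
  qed
qed

section \<open>The initial packet size, and the program as a whole\<close>

lemma const_regs_packet: "const_regs k r \<Longrightarrow> const_regs k' (r(13 := k'))"
  unfolding const_regs_def by simp

text \<open>Zero amounts are zero packets of any size, so the heap is assumed for every
  \<open>k\<close> and the size can grow without touching the arrays. It is not reset from player to
  player, hence at most \<open>L\<close> doublings altogether.\<close>

lemma init_packet_wp:
  assumes c0: "const_regs k0 r" and h0: "\<And>k. heap k (\<lambda>_ _. 0) b (\<lambda>_. 0) (\<lambda>_. 0) d r"
    and dL: "\<And>i. i < n \<Longrightarrow> d i \<le> 2 ^ L * k0"
  shows "wp init_packet r (\<lambda>r' u. u \<le> 5 * n + 2 * L + 5 \<and>
    (\<exists>q\<le>L. const_regs (2 ^ q * k0) r' \<and> heap (2 ^ q * k0) (\<lambda>_ _. 0) b (\<lambda>_. 0) (\<lambda>_. 0) d r' \<and>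
       r' 14 = of_nat (m + 2) * (2 ^ q * k0) \<and> r' 15 = of_nat n * (2 ^ q * k0) \<and>
       (\<forall>i<n. d i \<le> 2 ^ q * k0)))"
proof -
  define I where "I = (\<lambda>(i, q) s. const_regs (2 ^ q * k0) s \<and> (\<forall>k. heap k (\<lambda>_ _. 0) b (\<lambda>_. 0) (\<lambda>_. 0) d s) \<and>
    s 17 = of_nat i \<and> i \<le> n \<and> q \<le> L \<and> (\<forall>i'<i. d i' \<le> 2 ^ q * k0))"
  let ?\<phi> = "\<lambda>(i, q). 5 * (n - i) + 2 * (L - q)"
  show ?thesis unfolding init_packet_def
  proof (rule wp_Seq, rule wp_Blk, simp, rule wp_Seq, rule wp_While[where I = I and g = "(0, 0)" and \<phi> = ?\<phi>])
    show "I (0, 0) (effects [Const 17 0] r)" unfolding I_def using c0 h0 by simp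
  next
    fix g s assume Ig: "I g s" and lt: "s 17 < s 3"
    obtain i q where g: "g = (i, q)" by force
    note J = Ig[unfolded g I_def prod.case]
    have i: "i < n" using lt J by (simp add: const_regs_def)
    let ?s = "s(26 := of_nat (bD + i), 18 := d i)"
    have e: "effects [Add 26 9 17, Load 18 26] s = ?s"
    proof -
      have v: "s 9 + s 17 = of_nat (bD + i)" using J by (simp add: const_regs_def)
      have "heap 0 (\<lambda>_ _. 0) b (\<lambda>_. 0) (\<lambda>_. 0) d s" using J by blast
      from heap_read(6)[OF this i, of 0] have "s (bD + i) = d i" using m_pos by simp
      moreover have "bD + i \<noteq> 26" using bD_ge by simp
      ultimately show ?thesis by (simp add: v del: of_nat_add)
    qed
    define I2 where "I2 = (\<lambda>q s. const_regs (2 ^ q * k0) s \<and> (\<forall>k. heap k (\<lambda>_ _. 0) b (\<lambda>_. 0) (\<lambda>_. 0) d s) \<and>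
      s 17 = of_nat i \<and> s 18 = d i \<and> q \<le> L \<and> (\<forall>i'<i. d i' \<le> 2 ^ q * k0))"
    show "wp (Blk [Add 26 9 17, Load 18 26] ;; WhileLt 13 18 (Blk [Add 13 13 13]) ;; Blk [Add 17 17 7]) s
       (\<lambda>r' u. \<exists>g'. I g' r' \<and> Suc u + ?\<phi> g' \<le> ?\<phi> g)"
    proof (rule wp_Seq, rule wp_Blk, simp, unfold e, rule wp_Seq,
        rule wp_While[where I = I2 and g = q and \<phi> = "\<lambda>q. 2 * (L - q)"])
      show "I2 q ?s" unfolding I2_def using J by simp
    next
      fix q s assume J2: "I2 q s" and lt: "s 13 < s 18"
      have s13: "s 13 = 2 ^ q * k0" using J2 by (simp add: I2_def const_regs_def)
      have "2 ^ q * k0 < 2 ^ L * k0" using lt s13 J2 dL[OF i] unfolding I2_def by simp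
      then have "(2 :: rat) ^ q < 2 ^ L" using k0_pos by simp
      then have q: "q < L" by simp
      have "2 ^ q * k0 + 2 ^ q * k0 = 2 ^ Suc q * k0" by simp
      then have e: "effects [Add 13 13 13] s = s(13 := 2 ^ Suc q * k0)" unfolding effects.simps effect.simps s13 by metis
      have "I2 (Suc q) (s(13 := 2 ^ Suc q * k0))"
        unfolding I2_def
      proof (intro conjI allI impI)
        show "const_regs (2 ^ Suc q * k0) (s(13 := 2 ^ Suc q * k0))"
          using J2 const_regs_packet unfolding I2_def by blast
        fix i' assume "i' < i"
        then have "d i' \<le> 2 ^ q * k0" using J2 unfolding I2_def by blast
        also have "\<dots> \<le> 2 ^ Suc q * k0" using k0_pos by simp
        finally show "d i' \<le> 2 ^ Suc q * k0" .
      qed (use J2 q in \<open>simp_all add: I2_def\<close>)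
      moreover have "L - q = Suc (L - Suc q)" using q by simp
      ultimately show "wp (Blk [Add 13 13 13]) s (\<lambda>r' u. \<exists>g'. I2 g' r' \<and> Suc u + 2 * (L - g') \<le> 2 * (L - q))"
        by (intro wp_Blk, simp, unfold e, intro exI[of _ "Suc q"]) simp
    next
      fix q' s u assume J2: "I2 q' s" and lt: "\<not> s 13 < s 18" and u: "u + 2 * (L - q') \<le> Suc (2 * (L - q))"
      have "s 13 = 2 ^ q' * k0" "s 7 = 1" using J2 by (simp_all add: I2_def const_regs_def)
      then have "I (Suc i, q') (effects [Add 17 17 7] s)"
        using J2 lt i unfolding I_def I2_def prod.case by (auto simp: less_Suc_eq)
      moreover have "n - i = Suc (n - Suc i)" using i by simp
      ultimately show "wp (Blk [Add 17 17 7]) s (\<lambda>r2 u2. \<exists>g'. I g' r2 \<and>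
          Suc (costs [Add 26 9 17, Load 18 26] + (u + u2)) + ?\<phi> g' \<le> ?\<phi> g)"
        using u by (intro wp_Blk, simp, intro exI[of _ "(Suc i, q')"]) (simp add: g)
    qed
  next
    fix g s u assume Ig: "I g s" and lt: "\<not> s 17 < s 3" and u: "u + ?\<phi> g \<le> Suc (?\<phi> (0, 0))"
    obtain i q where g: "g = (i, q)" by force
    note J = Ig[unfolded g I_def prod.case]
    have i: "i = n" using lt J by (simp add: const_regs_def)
    let ?k = "2 ^ q * k0"
    let ?r = "s(14 := of_nat (m + 2) * ?k, 15 := of_nat n * ?k)"
    have "s 13 = ?k" "s 3 = of_nat n" "s 4 = of_nat m" "s 7 = 1" using J by (simp_all add: const_regs_def)
    then have e: "effects [Add 14 4 7, Add 14 14 7, Mul 14 14 13, Mul 15 3 13] s = ?r"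
      by (simp add: add.commute add.left_commute)
    show "wp (Blk [Add 14 4 7, Add 14 14 7, Mul 14 14 13, Mul 15 3 13]) s (\<lambda>r2 u2.
       costs [Const 17 0] + (u + u2) \<le> 5 * n + 2 * L + 5 \<and>
       (\<exists>q\<le>L. const_regs (2 ^ q * k0) r2 \<and> heap (2 ^ q * k0) (\<lambda>_ _. 0) b (\<lambda>_. 0) (\<lambda>_. 0) d r2 \<and>
       r2 14 = of_nat (m + 2) * (2 ^ q * k0) \<and> r2 15 = of_nat n * (2 ^ q * k0) \<and>
       (\<forall>i<n. d i \<le> 2 ^ q * k0)))"
    proof (rule wp_Blk, simp, unfold e, rule conjI, goal_cases)
      case 1 show ?case using u by (simp add: g)
    next
      case 2 show ?case using J i by (intro exI[of _ q]) simp
    qed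
  qed
qed

text \<open>At zero loads and prices the keys of the empty profile are \<open>b\<close>, and a
  player without packets satisfies the exchange condition vacuously.\<close>

lemma ready_init:
  assumes "k > 0" and dk: "\<And>i. i < n \<Longrightarrow> d i \<le> k"
  shows "ready k (\<lambda>_ _. 0) b (\<lambda>_. 0) d"
proof -
  have "0 \<le> d i" if i: "i < n" for i
    using dem_mult[OF i] k0_pos by force
  moreover have "d i \<le> of_nat (2 * m + 4) * k" if i: "i < n" for i
  proof -
    have "1 * k \<le> of_nat (2 * m + 4) * k" using \<open>k > 0\<close> by (intro mult_right_mono) simp_all
    then show ?thesis using dk[OF i] by linarith
  qed
  ultimately show ?thesis unfolding ready_def keys_ok_def key_def demand_left_def near_response_def best_response_def by simp
qed

text \<open>The input moved as one block already is a valid heap: \<open>b\<close> follows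
  \<open>a\<close> and so occupies the place of the keys, and the zeros behind it act as empty
  strategies, gaps and counters.\<close>

lemma heap_input:
  assumes "\<And>p. 3 \<le> p \<Longrightarrow> r (64 * (n * m) + p - 2) = input_mem n m k0 d a b p"
  shows "heap k (\<lambda>_ _. 0) b (\<lambda>_. 0) (\<lambda>_. 0) d r"
proof -
  have inp: "r (bD + q) = input_mem n m k0 d a b (3 + q)" for q
    using assms[of "3 + q"] by (simp add: bD_def add.commute)
  have e: "r (bA + j) = input_mem n m k0 d a b (3 + (n + j))"
    "r (bA + n * m + j) = input_mem n m k0 d a b (3 + (n + n * m + j))"
    "r (bA + 2 * (n * m) + j) = input_mem n m k0 d a b (3 + (n + 2 * (n * m) + j))"
    "r (bG + j) = input_mem n m k0 d a b (3 + (n + 3 * (n * m) + j))"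
    "r (bS + j) = input_mem n m k0 d a b (3 + (n + 3 * (n * m) + m + j))" for j
    unfolding bases inp[symmetric] by (simp_all only: add.assoc)
  show ?thesis unfolding heap_def
  proof (intro conjI allI impI)
    show "r (bD + i) = d i" if "i < n" for i unfolding inp using that by (simp add: input_mem_def)
    show "r (bA + j) = a (j div m) (j mod m)" if "j < n * m" for j
      unfolding e using that by (simp add: input_mem_def)
    show "r (bA + n * m + j) = b (j div m) (j mod m)" if "j < n * m" for j
      unfolding e using that by (simp add: input_mem_def ac_simps)
    show "r (bA + 2 * (n * m) + j) = of_nat 0 * k" for j
      unfolding e by (simp add: input_mem_def)
    show "r (bG + j) = of_nat 0 * k" for j
      unfolding e by (simp add: input_mem_def)
    show "r (bS + j) = of_nat 0" for j
      unfolding e by (simp add: input_mem_def)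
  qed
qed

lemma program_wp:
  assumes dL: "\<And>i. i < n \<Longrightarrow> d i \<le> 2 ^ L * k0"
  shows "wp program (input_mem n m k0 d a b) (\<lambda>r u. u \<le> 2000 * (n * m)\<^sup>2 * (L + 1) \<and>
     is_equilibrium n m k0 d a b (output_profile m r))"
proof -
  let ?r0 = "input_mem n m k0 d a b"
  have r0: "?r0 0 = of_nat n" "?r0 1 = of_nat m" "?r0 2 = k0" by (simp_all add: input_mem_def)
  have z: "?r0 p = 0" if "3 + n + 2 * (n * m) \<le> p" for p
    using that by (simp add: input_mem_def)
  show ?thesis unfolding program_def
  proof (rule wp_Seq, rule wp_mono[OF boot_wp[OF r0 z]], assumption, elim conjE)
    fix r1 u1
    assume u1: "u1 \<le> 3 * (3 + n + 2 * (n * m)) + 100" and c1: "const_regs k0 r1"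
      and m1: "\<forall>p\<ge>3. r1 (64 * (n * m) + p - 2) = ?r0 p"
    have h1: "heap k (\<lambda>_ _. 0) b (\<lambda>_. 0) (\<lambda>_. 0) d r1" for k
      using m1 by (intro heap_input) blast
    show "wp (init_packet ;; solve ;; write_profile) r1 (\<lambda>r2 u2. u1 + u2 \<le> 2000 * (n * m)\<^sup>2 * (L + 1) \<and>
     is_equilibrium n m k0 d a b (output_profile m r2))"
    proof (rule wp_Seq, rule wp_mono[OF init_packet_wp[OF c1 h1 dL]], assumption, elim conjE exE)
      fix r2 u2 q
      assume u2: "u2 \<le> 5 * n + 2 * L + 5" and q: "q \<le> L" and c2: "const_regs (2 ^ q * k0) r2"
        and h2: "heap (2 ^ q * k0) (\<lambda>_ _. 0) b (\<lambda>_. 0) (\<lambda>_. 0) d r2"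
        and r2: "r2 14 = of_nat (m + 2) * (2 ^ q * k0)" "r2 15 = of_nat n * (2 ^ q * k0)"
        and dq: "\<forall>i<n. d i \<le> 2 ^ q * k0"
      have rd: "ready (2 ^ q * k0) (\<lambda>_ _. 0) b (\<lambda>_. 0) d"
        using dq k0_pos by (intro ready_init) auto
      show "wp (solve ;; write_profile) r2 (\<lambda>r3 u3. u1 + (u2 + u3) \<le> 2000 * (n * m)\<^sup>2 * (L + 1) \<and>
        is_equilibrium n m k0 d a b (output_profile m r3))"
      proof (rule wp_Seq, rule wp_mono[OF solve_wp[OF c2 h2 r2 rd]], elim conjE)
        fix r3 u3
        assume u3: "u3 \<le> (q + 2) * (500 * (n * m)\<^sup>2 + 4)" and c3: "const_regs k0 r3"
          and eq: "is_equilibrium n m k0 d a b (\<lambda>i e. r3 (bA + 2 * (n * m) + (i * m + e)))"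
        show "wp write_profile r3 (\<lambda>r4 u4. u1 + (u2 + (u3 + u4)) \<le> 2000 * (n * m)\<^sup>2 * (L + 1) \<and>
          is_equilibrium n m k0 d a b (output_profile m r4))"
        proof (rule wp_mono[OF write_profile_wp[OF c3]], elim conjE, rule conjI)
          fix r4 u4
          assume u4: "u4 \<le> 4 * (n * m) + 50"
            and o: "\<forall>j<n * m. r4 (3 + j) = r3 (bA + 2 * (n * m) + j)"
          show "is_equilibrium n m k0 d a b (output_profile m r4)"
          proof (rule is_equilibrium_cong[OF _ eq])
            fix i e assume "i < n" "e < m"
            then show "r3 (bA + 2 * (n * m) + (i * m + e)) = output_profile m r4 i e"
              using o idx_less[of i n e m] by (simp add: output_profile_def add.assoc)
          qed
          define Z where "Z = (n * m)\<^sup>2"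
          have nm1: "1 \<le> n * m" by (rule nm_pos)
          have nmZ: "n * m \<le> Z" unfolding Z_def power2_eq_square using nm1 by simp
          have nn: "n \<le> n * m" using m_pos by simp
          have "(q + 2) * (500 * Z + 4) \<le> (L + 2) * (504 * Z)"
            using q nm1 nmZ by (intro mult_le_mono) linarith+
          also have "\<dots> = 504 * (Z * L) + 1008 * Z" by (simp add: algebra_simps)
          finally have "u3 \<le> 504 * (Z * L) + 1008 * Z" using u3 unfolding Z_def by linarith
          moreover have "L \<le> Z * L"
          proof -
            have "1 \<le> Z" using nm1 nmZ by linarith
            then show ?thesis using mult_le_mono1[of 1 Z L] by simp
          qed
          ultimately have "u1 + (u2 + (u3 + u4)) \<le> 2000 * (Z * L) + 2000 * Z"
            using u1[unfolded distrib_left] u2 u4 nm1 nmZ nn by linarith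
          also have "\<dots> = 2000 * Z * (L + 1)" by (simp add: algebra_simps)
          finally show "u1 + (u2 + (u3 + u4)) \<le> 2000 * (n * m)\<^sup>2 * (L + 1)" unfolding Z_def .
        qed
      qed
    qed
  qed
qed

end

theorem mainTheorem6:
  shows "\<exists>(P :: instr list) (C :: real). \<forall>n m k0 d a b (\<delta> :: rat).
     n \<ge> 1 \<and> m \<ge> 1 \<and> valid_game n m k0 d a b \<and> k0 \<le> \<delta> \<and> (\<forall>i<n. d i \<le> \<delta>) \<longrightarrow>
     (\<exists>t. let cfg = (step P ^^ t) (0, input_mem n m k0 d a b, 0) in
        halted P cfg \<and>
        real (snd (snd cfg)) \<le>
          C * real n ^ 2 * real m ^ 14 * (1 + log 2 (real_of_rat (\<delta> / k0))) \<and>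
        is_equilibrium n m k0 d a b (output_profile m (fst (snd cfg))))"
proof (rule exI[of _ "compile 0 program"], rule exI[of _ 4000], intro allI impI, elim conjE)
  fix n m k0 d a b and \<delta> :: rat
  assume n: "n \<ge> 1" and m: "m \<ge> 1" and vg: "valid_game n m k0 d a b" and kd: "k0 \<le> \<delta>"
    and dd: "\<forall>i<n. d i \<le> \<delta>"
  interpret game n m k0 a d b
    using n m vg unfolding valid_game_def by unfold_locales auto
  define l where "l = log 2 (real_of_rat (\<delta> / k0))"
  have "1 \<le> \<delta> / k0" using kd k0_pos by simp
  then have ge1: "1 \<le> real_of_rat (\<delta> / k0)" by simp
  then have l0: "0 \<le> l" unfolding l_def by simp
  \<comment> \<open>This many doublings take \<open>k0\<close> to at least \<open>\<delta>\<close>;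
    rounding up costs less than one phase.\<close>
  define L where "L = nat \<lceil>l\<rceil>"
  have lL: "l \<le> real L" "real L \<le> l + 1" unfolding L_def using l0 by linarith+
  have "real_of_rat (\<delta> / k0) = 2 powr l" unfolding l_def using ge1 by simp
  also have "\<dots> \<le> 2 powr real L" using lL by (intro powr_mono) auto
  also have "\<dots> = real_of_rat (2 ^ L)" by (simp add: powr_realpow of_rat_power)
  finally have "\<delta> / k0 \<le> 2 ^ L" unfolding of_rat_less_eq .
  then have dL: "\<delta> \<le> 2 ^ L * k0" using k0_pos by (simp add: pos_divide_le_eq)
  have "wp program (input_mem n m k0 d a b) (\<lambda>r u. u \<le> 2000 * (n * m)\<^sup>2 * (L + 1) \<and>
     is_equilibrium n m k0 d a b (output_profile m r))"
    using dd dL by (intro program_wp) force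
  from wp_program[OF this] obtain t r u
    where run: "(step (compile 0 program) ^^ t) (0, input_mem n m k0 d a b, 0) = (length (compile 0 program), r, u)"
      and u: "u \<le> 2000 * (n * m)\<^sup>2 * (L + 1)" and eq: "is_equilibrium n m k0 d a b (output_profile m r)"
    by blast
  have "real u \<le> real (2000 * (n * m)\<^sup>2 * (L + 1))" using u by (rule of_nat_mono)
  also have "\<dots> = 2000 * (real n ^ 2 * real m ^ 2) * (real L + 1)"
    by (simp add: power_mult_distrib algebra_simps)
  \<comment> \<open>The count is quadratic in \<open>m\<close> and is only enlarged to the stated
    power. Rounding gives \<open>real L + 1 \<le> l + 2\<close>, absorbed by the factor 2 that turns
    2000 into 4000.\<close>
  also have "\<dots> \<le> 2000 * (real n ^ 2 * real m ^ 14) * (2 * (1 + l))"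
  proof (intro mult_mono)
    show "real m ^ 2 \<le> real m ^ 14" using m by (intro power_increasing) auto
    show "real L + 1 \<le> 2 * (1 + l)" using lL l0 by (simp add: algebra_simps)
  qed (use l0 in auto)
  also have "\<dots> = 4000 * real n ^ 2 * real m ^ 14 * (1 + l)" by simp
  finally have "real u \<le> 4000 * real n ^ 2 * real m ^ 14 * (1 + l)" .
  then show "\<exists>t. let cfg = (step (compile 0 program) ^^ t) (0, input_mem n m k0 d a b, 0) in
        halted (compile 0 program) cfg \<and>
        real (snd (snd cfg)) \<le>
          4000 * real n ^ 2 * real m ^ 14 * (1 + log 2 (real_of_rat (\<delta> / k0))) \<and>
        is_equilibrium n m k0 d a b (output_profile m (fst (snd cfg)))"
    using eq by (intro exI[of _ t]) (simp add: run halted_def l_def)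
qed

end
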